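(* Let $n\ge 1$ be an integer and let $s>0$. Suppose that there exists a Radon measure $\mu$ on $(\mathbb{H}^n,d_H)$ such that the set of points $x\in\mathbb{H}^n$ for which the density $\Theta^s(\mu,x)$ exists and is positive and finite has positive $\mu$ measure. Then $s$ is an integer.
   Context: The Heisenberg group $\mathbb{H}^n$ is $\mathbb{R}^{2n+1}$ with the group law $x\cdot y=(x_1+y_1,\dots,x_{2n}+y_{2n},\,x_{2n+1}+y_{2n+1}+A(x',y'))$, where $x=(x',x_{2n+1})$, $x'=(x_1,\dots,x_{2n})$ (and similarly for $y$), and $A(x',y')=-2\sum_{j=1}^n(x_jy_{j+n}-x_{j+n}y_j)$. The Korányi metric is $d_H(x,y)=\|x^{-1}\cdot y\|$ where $\|x\|=(|x'|^4+x_{2n+1}^2)^{1/4}$ and $|\cdot|$ is the Euclidean norm on $\mathbb{R}^{2n}$. $B(x,r)$ denotes the closed $d_H$-ball with center $x$ and radius $r$. For $0\le s<\infty$ the upper and lower $s$-densities of $\mu$ at $x$ are $\Theta^{*s}(\mu,x)=\limsup_{r\to0}r^{-s}\mu(B(x,r))$ and $\Theta^{s}_{*}(\mu,x)=\liminf_{r\to0}r^{-s}\mu(B(x,r))$. When these agree, the density $\Theta^s(\mu,x)$ is said to exist and denotes their common value. *)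

theory Defs
  imports "HOL-Analysis.Analysis"
begin

section \<open>The Heisenberg group with the Koranyi metric\<close>

text \<open>
  The group \<open>H\<^sup>n\<close> is modelled by \<open>'n heis\<close> with \<open>n = CARD('n) \<ge> 1\<close>. A point
  \<open>x = (x', x\<^bsub>2n+1\<^esub>)\<close> is \<open>Heis x' x\<^bsub>2n+1\<^esub>\<close>, where the \<open>2n\<close> coordinates of \<open>x'\<close> are indexed by the
  disjoint sum \<open>'n + 'n\<close>: \<open>x' $ Inl j\<close> is \<open>x\<^sub>j\<close> and \<open>x' $ Inr j\<close> is \<open>x\<^bsub>j+n\<^esub>\<close>. A separate type is used
  so that \<open>dist\<close>, \<open>cball\<close>, \<open>open\<close>, \<open>compact\<close> and \<open>borel\<close> refer to the Koranyi metric.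
\<close>

datatype ('n::finite) heis = Heis (horiz: "real ^ ('n + 'n)") (vert: real)

definition heis_form :: "real ^ ('n::finite + 'n) \<Rightarrow> real ^ ('n + 'n) \<Rightarrow> real" where
  "heis_form u v = - 2 * (\<Sum>j\<in>UNIV. u $ Inl j * v $ Inr j - u $ Inr j * v $ Inl j)"

lemma heis_form_add_left: "heis_form (u + v) w = heis_form u w + heis_form v w"
  unfolding heis_form_def distrib_left [symmetric] sum.distrib [symmetric]
  by (intro arg_cong2 [where f = times] refl sum.cong) (auto simp: algebra_simps)

lemma heis_form_swap: "heis_form v u = - heis_form u v"
proof -
  have "(\<Sum>j\<in>UNIV. v $ Inl j * u $ Inr j - v $ Inr j * u $ Inl j) =
        (\<Sum>j\<in>UNIV. - (u $ Inl j * v $ Inr j - u $ Inr j * v $ Inl j))"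
    by (intro sum.cong) (auto simp: algebra_simps)
  then show ?thesis
    unfolding heis_form_def sum_negf by simp
qed

lemma heis_form_add_right: "heis_form w (u + v) = heis_form w u + heis_form w v"
  using heis_form_add_left [of u v w] heis_form_swap [of w "u + v"]
    heis_form_swap [of w u] heis_form_swap [of w v] by simp

lemma heis_form_self: "heis_form u u = 0"
  using heis_form_swap [of u u] by simp

lemma heis_form_minus_left: "heis_form (- u) v = - heis_form u v"
  using heis_form_add_left [of u "- u" v] heis_form_add_left [of 0 0 v] by simp

instantiation heis :: (finite) monoid_mult
begin

definition one_heis :: "'a heis" where
  "1 = Heis 0 0"

definition times_heis :: "'a heis \<Rightarrow> 'a heis \<Rightarrow> 'a heis" where
  "x * y = Heis (horiz x + horiz y) (vert x + vert y + heis_form (horiz x) (horiz y))"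

instance
proof
  fix x y z :: "'a heis"
  show "x * y * z = x * (y * z)"
    by (simp add: times_heis_def heis_form_add_left heis_form_add_right algebra_simps)
  have "heis_form 0 u = 0" "heis_form u 0 = 0" for u :: "real ^ ('a + 'a)"
    by (simp_all add: heis_form_def)
  then show "1 * x = x" "x * 1 = x"
    by (simp_all add: times_heis_def one_heis_def)
qed

end

instantiation heis :: (finite) inverse
begin

definition inverse_heis :: "'a heis \<Rightarrow> 'a heis" where
  "inverse x = Heis (- horiz x) (- vert x)"

definition divide_heis :: "'a heis \<Rightarrow> 'a heis \<Rightarrow> 'a heis" where
  "divide_heis x y = x * inverse y"

instance ..

end

lemma heis_left_inverse: "inverse x * x = 1"
  and heis_right_inverse: "x * inverse x = 1" for x :: "'n::finite heis"
  using heis_form_swap [of "horiz x" "- horiz x"]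
  by (simp_all add: times_heis_def inverse_heis_def one_heis_def heis_form_minus_left heis_form_self)

definition koranyi_norm :: "'n::finite heis \<Rightarrow> real" where
  "koranyi_norm x = root 4 (norm (horiz x) ^ 4 + vert x ^ 2)"

lemma koranyi_norm_nonneg: "0 \<le> koranyi_norm x"
  by (simp add: koranyi_norm_def)

lemma koranyi_norm_power4: "koranyi_norm x ^ 4 = norm (horiz x) ^ 4 + vert x ^ 2"
  by (simp add: koranyi_norm_def)

lemma koranyi_norm_eq_0_iff: "koranyi_norm x = 0 \<longleftrightarrow> x = 1"
proof -
  have "koranyi_norm x = 0 \<longleftrightarrow> norm (horiz x) ^ 4 + vert x ^ 2 = 0"
    by (simp add: koranyi_norm_def)
  also have "\<dots> \<longleftrightarrow> horiz x = 0 \<and> vert x = 0"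
    by (subst add_nonneg_eq_0_iff) auto
  also have "\<dots> \<longleftrightarrow> x = 1"
    by (cases x) (simp add: one_heis_def)
  finally show ?thesis .
qed

lemma koranyi_norm_inverse: "koranyi_norm (inverse x) = koranyi_norm x"
  by (simp add: koranyi_norm_def inverse_heis_def)

lemma sum_plus_UNIV:
  fixes f :: "'n::finite + 'n \<Rightarrow> real"
  shows "sum f UNIV = (\<Sum>j\<in>UNIV. f (Inl j)) + (\<Sum>j\<in>UNIV. f (Inr j))"
proof -
  have "sum f (UNIV <+> UNIV) = (\<Sum>j\<in>UNIV. f (Inl j)) + (\<Sum>j\<in>UNIV. f (Inr j))"
    by (subst sum.Plus) auto
  then show ?thesis by simp
qed

lemma heis_form_Cauchy_Schwarz:
  fixes u v :: "real ^ ('n::finite + 'n)"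
  shows "(u \<bullet> v)\<^sup>2 + (heis_form u v / 2)\<^sup>2 \<le> (norm u * norm v)\<^sup>2"
proof -
  define J :: "real ^ ('n + 'n)" where
    "J = (\<chi> i. case i of Inl j \<Rightarrow> v $ Inr j | Inr j \<Rightarrow> - (v $ Inl j))"
  define a where "a = u \<bullet> v"
  define b where "b = u \<bullet> J"
  have b: "heis_form u v / 2 = - b"
    by (simp add: b_def J_def heis_form_def inner_vec_def sum_plus_UNIV sum_subtractf sum_negf)
  have vJ: "v \<bullet> J = 0"
    by (simp add: J_def inner_vec_def sum_plus_UNIV sum_negf mult.commute)
  have JJ: "J \<bullet> J = v \<bullet> v"
    by (simp add: J_def inner_vec_def sum_plus_UNIV)
  define w where "w = a *\<^sub>R v + b *\<^sub>R J"
  have uw: "u \<bullet> w = a\<^sup>2 + b\<^sup>2"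
    by (simp add: w_def inner_add_right a_def b_def power2_eq_square)
  have ww: "w \<bullet> w = (a\<^sup>2 + b\<^sup>2) * (v \<bullet> v)"
    using vJ JJ by (simp add: w_def inner_add_right inner_add_left inner_commute algebra_simps power2_eq_square)
  have "(a\<^sup>2 + b\<^sup>2)\<^sup>2 \<le> (u \<bullet> u) * ((a\<^sup>2 + b\<^sup>2) * (v \<bullet> v))"
    using Cauchy_Schwarz_ineq [of u w] by (simp only: uw ww)
  then have "(a\<^sup>2 + b\<^sup>2) * (a\<^sup>2 + b\<^sup>2) \<le> (a\<^sup>2 + b\<^sup>2) * ((u \<bullet> u) * (v \<bullet> v))"
    by (simp add: power2_eq_square mult_ac)
  moreover have "0 \<le> a\<^sup>2 + b\<^sup>2" "0 \<le> (u \<bullet> u) * (v \<bullet> v)"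
    by simp_all
  ultimately have "a\<^sup>2 + b\<^sup>2 \<le> (u \<bullet> u) * (v \<bullet> v)"
    by (metis mult_le_cancel_left_pos order_le_less)
  then show ?thesis
    by (simp add: a_def b power_mult_distrib dot_square_norm)
qed

lemma koranyi_norm_mult_le: "koranyi_norm (x * y) \<le> koranyi_norm x + koranyi_norm y"
proof -
  define c where "c z = Complex ((norm (horiz z))\<^sup>2) (vert z)" for z :: "'a heis"
  have c: "cmod (c z) = (koranyi_norm z)\<^sup>2" for z
  proof -
    have "(cmod (c z))\<^sup>2 = ((koranyi_norm z)\<^sup>2)\<^sup>2"
      using koranyi_norm_power4 [of z] by (simp add: c_def cmod_power2)
    then show ?thesis
      by (rule power2_eq_imp_eq) simp_all
  qed
  have horiz_le: "norm (horiz z) \<le> koranyi_norm z" for z :: "'a heis"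
  proof -
    have "norm (horiz z) ^ 4 \<le> koranyi_norm z ^ 4"
      by (simp add: koranyi_norm_power4)
    then show ?thesis
      by (simp add: koranyi_norm_nonneg)
  qed
  define d where "d = Complex (horiz x \<bullet> horiz y) (heis_form (horiz x) (horiz y) / 2)"
  have "(cmod d)\<^sup>2 \<le> (norm (horiz x) * norm (horiz y))\<^sup>2"
    using heis_form_Cauchy_Schwarz [of "horiz x" "horiz y"] by (simp add: d_def cmod_power2)
  then have "cmod d \<le> norm (horiz x) * norm (horiz y)"
    by (rule power2_le_imp_le) simp
  also have "\<dots> \<le> koranyi_norm x * koranyi_norm y"
    by (intro mult_mono horiz_le) (auto simp: koranyi_norm_nonneg)
  finally have d: "cmod d \<le> koranyi_norm x * koranyi_norm y" .
  have "c (x * y) = c x + c y + 2 * d"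
    by (simp add: c_def d_def times_heis_def complex_eq_iff power2_norm_eq_inner
        inner_add_left inner_add_right inner_commute)
  then have "cmod (c (x * y)) \<le> cmod (c x) + cmod (c y) + 2 * cmod d"
    using norm_triangle_ineq [of "c x + c y" "2 * d"] norm_triangle_ineq [of "c x" "c y"]
    by (simp add: norm_mult)
  with d have "(koranyi_norm (x * y))\<^sup>2 \<le> (koranyi_norm x + koranyi_norm y)\<^sup>2"
    by (simp add: c power2_sum)
  then show ?thesis
    by (rule power2_le_imp_le) (simp add: koranyi_norm_nonneg)
qed

instantiation heis :: (finite) metric_space
begin

definition dist_heis :: "'a heis \<Rightarrow> 'a heis \<Rightarrow> real" where
  "dist x y = koranyi_norm (inverse x * y)"

definition uniformity_heis :: "('a heis \<times> 'a heis) filter" where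
  "uniformity_heis = (INF e\<in>{0<..}. principal {(x, y). dist x y < e})"

definition open_heis :: "'a heis set \<Rightarrow> bool" where
  "open_heis U \<longleftrightarrow> (\<forall>x\<in>U. \<forall>\<^sub>F (x', y) in uniformity. x' = x \<longrightarrow> y \<in> U)"

instance
proof
  fix x y z :: "'a heis" and U :: "'a heis set"
  have inv_mult: "inverse (inverse p * q) = inverse q * p" for p q :: "'a heis"
    using heis_form_swap [of "horiz p" "horiz q"]
    by (simp add: times_heis_def inverse_heis_def heis_form_minus_left)
  have sym: "dist p q = dist q p" for p q :: "'a heis"
    unfolding dist_heis_def by (metis inv_mult koranyi_norm_inverse)
  have split: "inverse x * y = (inverse x * z) * (inverse z * y)"
    by (metis heis_right_inverse mult.assoc mult_1)
  have "inverse x * y = 1 \<longleftrightarrow> x = y"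
    by (metis heis_left_inverse heis_right_inverse mult.assoc mult_1 mult_1_right)
  then show "dist x y = 0 \<longleftrightarrow> x = y"
    by (simp add: dist_heis_def koranyi_norm_eq_0_iff)
  have "dist x y \<le> dist x z + dist z y"
    unfolding dist_heis_def split by (rule koranyi_norm_mult_le)
  then show "dist x y \<le> dist x z + dist y z"
    by (simp add: sym)
qed (rule uniformity_heis_def open_heis_def)+

end

section \<open>Radon measures and densities\<close>

text \<open>
  In geometric measure theory a Radon measure is an outer measure defined on all subsets, which is
  Borel regular. It is encoded here by its restriction to the Borel sets; its value on an arbitrary
  set \<open>A\<close> is then \<^term>\<open>outer_measure_of M A\<close>, which is \<^term>\<open>emeasure M A\<close> for Borel \<open>A\<close>.
\<close>

definition radon_measure :: "'a::topological_space measure \<Rightarrow> bool" where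
  "radon_measure M \<longleftrightarrow>
     sets M = sets borel \<and>
     (\<forall>K. compact K \<longrightarrow> emeasure M K < \<infinity>) \<and>
     (\<forall>U. open U \<longrightarrow> emeasure M U = (SUP K\<in>{K. compact K \<and> K \<subseteq> U}. emeasure M K)) \<and>
     (\<forall>A\<in>sets borel. emeasure M A = (INF U\<in>{U. open U \<and> A \<subseteq> U}. emeasure M U))"

definition upper_density :: "real \<Rightarrow> 'a::metric_space measure \<Rightarrow> 'a \<Rightarrow> ennreal" where
  "upper_density s M x = Limsup (at_right 0) (\<lambda>r. ennreal (r powr (- s)) * emeasure M (cball x r))"

definition lower_density :: "real \<Rightarrow> 'a::metric_space measure \<Rightarrow> 'a \<Rightarrow> ennreal" where
  "lower_density s M x = Liminf (at_right 0) (\<lambda>r. ennreal (r powr (- s)) * emeasure M (cball x r))"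

definition density_exists :: "real \<Rightarrow> 'a::metric_space measure \<Rightarrow> 'a \<Rightarrow> bool" where
  "density_exists s M x \<longleftrightarrow> upper_density s M x = lower_density s M x"

text \<open>Only meaningful where \<^const>\<open>density_exists\<close> holds.\<close>

definition density_at :: "real \<Rightarrow> 'a::metric_space measure \<Rightarrow> 'a \<Rightarrow> ennreal" where
  "density_at s M x = upper_density s M x"

end

(*
Blowing up the measure at a suitable point gives an s-uniform object: averages I of
exp (- t d(x,.)^4) depend only on t, as c t^(-s/4), when x lies in the support. Suppose that the
support lies in a homogeneous subgroup K but is not all of K. Then F(x) = I(exp (- t d(x,.)^4)) - c t^(-s/4)
vanishes on the support and, for some t, not on K. Since d^4 is a polynomial, F(x * dil l y) is a
power series in l. Let N be the least order of vanishing over all points x of the support, attained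
at x0, and let Q be the N-th coefficient at x0, a function that is homogeneous of degree N. Each
point z in the support of a tangent at x0 is a limit of rescaled support points, where F also
vanishes to order N, and this gives Q(z * y) = Q(y) for all y in K. Hence the tangent is supported
in the homogeneous subgroup {z. Q(z * y) = Q(y) for all y}, which is smaller than K. After finitely
many steps the support is a whole homogeneous subgroup V x {0} or V x R, and comparing s-uniformity
with a count of lattice points yields s = dim V or s = dim V + 2. This avoids any stratification of
analytic varieties.
*)

theory Submission
  imports Defs "HOL-Complex_Analysis.Complex_Analysis" "HOL-Real_Asymp.Real_Asymp"
begin

section \<open>Coordinates, dilations and the topology\<close>

text \<open>The density hypothesis is pointwise, whereas the blow-up must be controlled at all
  points of its support and at all scales. This is obtained on a closed set E where the ball growth
  is uniform, at a density point of E: what lies outside E disappears in the limit, and the density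
  is nearly constant on E close to that point. The exponent d^4 is more than a polynomial, it is a
  sum of two squares of real polynomials. Hence a Gaussian remains bounded by a Gaussian when the
  dilation parameter l becomes complex, and its coefficients in l can be averaged term by term. A
  Gaussian of rate t has width t^(-1/4), which is the origin of the law c t^(-s/4). The order N is
  positive since F vanishes on the support, and Q vanishes at the identity but not everywhere on K;
  this is why the invariance group of Q is strictly smaller than K. The support must finally be a
  whole subgroup because the points of a lattice have to lie in it: as a separated set they bound s
  from below, as a net they bound s from above.\<close>

lemma horiz_mult [simp]: "horiz (x * y) = horiz x + horiz y"
  and vert_mult [simp]: "vert (x * y) = vert x + vert y + heis_form (horiz x) (horiz y)"
  and horiz_inverse [simp]: "horiz (inverse x) = - horiz x"
  and vert_inverse [simp]: "vert (inverse x) = - vert x"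
  and horiz_one [simp]: "horiz 1 = 0"
  and vert_one [simp]: "vert 1 = 0" for x y :: "'n::finite heis"
  by (simp_all add: times_heis_def inverse_heis_def one_heis_def)

lemma heis_eqI: "horiz x = horiz y \<Longrightarrow> vert x = vert y \<Longrightarrow> x = y"
  by (cases x; cases y) simp

lemma heis_form_scale_left: "heis_form (a *\<^sub>R u) v = a * heis_form u v"
  by (simp add: heis_form_def sum_distrib_left algebra_simps)

lemma heis_form_scale_right: "heis_form u (a *\<^sub>R v) = a * heis_form u v"
  by (metis heis_form_scale_left heis_form_swap mult_minus_right)

lemma heis_form_zero [simp]: "heis_form 0 u = 0" "heis_form u 0 = 0"
  by (simp_all add: heis_form_def)

lemma heis_form_minus_right: "heis_form u (- v) = - heis_form u v"
  by (metis heis_form_minus_left heis_form_swap)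

lemma heis_form_diff_right: "heis_form u (v - w) = heis_form u v - heis_form u w"
  using heis_form_add_right [of u v "- w"] by (simp add: heis_form_minus_right)

lemma heis_form_bound: "\<bar>heis_form u v\<bar> \<le> 2 * norm u * norm v"
proof -
  have "(heis_form u v / 2)\<^sup>2 \<le> (norm u * norm v)\<^sup>2"
    using heis_form_Cauchy_Schwarz [of u v] zero_le_power2 [of "u \<bullet> v"] by linarith
  then have "\<bar>heis_form u v / 2\<bar> \<le> norm u * norm v"
    by (metis abs_le_square_iff abs_of_nonneg mult_nonneg_nonneg norm_ge_zero)
  then show ?thesis by simp
qed

lemma heis_inverse_cancel [simp]:
  "inverse x * (x * y) = y" "x * (inverse x * y) = y" for x y :: "'n::finite heis"
  by (metis heis_left_inverse heis_right_inverse mult.assoc mult_1)+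

lemma heis_inverse_mult: "inverse (x * y) = inverse y * inverse x" for x y :: "'n::finite heis"
  by (rule heis_eqI) (use heis_form_swap [of "horiz x" "horiz y"] in
      \<open>simp_all add: heis_form_minus_left heis_form_minus_right\<close>)

lemma dist_mult_left [simp]: "dist (z * x) (z * y) = dist x y" for x y z :: "'n::finite heis"
  by (simp add: dist_heis_def heis_inverse_mult mult.assoc)

text \<open>The right-hand side is a polynomial in the coordinates, which is why all Gaussians below
  use \<open>dist x w ^ 4\<close>: along a dilation curve the exponent is a polynomial of degree at
  most 4 in the parameter.\<close>

lemma dist_pow4:
  "dist x y ^ 4 = norm (horiz y - horiz x) ^ 4 +
     (vert y - vert x - heis_form (horiz x) (horiz y))\<^sup>2" for x y :: "'n::finite heis"
  by (simp add: dist_heis_def koranyi_norm_power4 heis_form_minus_left algebra_simps)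

lemma dist_inverse_mult: "dist y (inverse x * w) = dist (x * y) w" for x y w :: "'n::finite heis"
  using dist_mult_left [of x y "inverse x * w"] by simp

section \<open>Nonisotropic dilations\<close>

definition dil :: "real \<Rightarrow> 'n::finite heis \<Rightarrow> 'n heis" where
  "dil r x = Heis (r *\<^sub>R horiz x) (r\<^sup>2 * vert x)"

lemma horiz_dil [simp]: "horiz (dil r x) = r *\<^sub>R horiz x"
  and vert_dil [simp]: "vert (dil r x) = r\<^sup>2 * vert x"
  by (simp_all add: dil_def)

lemma dil_mult: "dil r (x * y) = dil r x * dil r y"
  by (rule heis_eqI) (simp_all add: heis_form_scale_left heis_form_scale_right
      power2_eq_square algebra_simps)

lemma dil_dil [simp]: "dil r (dil q x) = dil (r * q) x"
  by (rule heis_eqI) (simp_all add: power_mult_distrib)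

lemma dil_1 [simp]: "dil 1 x = x"
  and dil_one [simp]: "dil r 1 = 1"
  and dil_0 [simp]: "dil 0 x = 1"
  by (rule heis_eqI; simp)+

lemma dist_dil:
  fixes x y :: "'n::finite heis"
  assumes "0 \<le> r"
  shows "dist (dil r x) (dil r y) = r * dist x y"
proof -
  have "norm (r *\<^sub>R horiz y - r *\<^sub>R horiz x) = r * norm (horiz y - horiz x)"
    using assms by (simp flip: scaleR_diff_right)
  moreover have "r\<^sup>2 * vert y - r\<^sup>2 * vert x - heis_form (r *\<^sub>R horiz x) (r *\<^sub>R horiz y) =
      r\<^sup>2 * (vert y - vert x - heis_form (horiz x) (horiz y))"
    by (simp add: heis_form_scale_left heis_form_scale_right power2_eq_square algebra_simps)
  ultimately have "dist (dil r x) (dil r y) ^ 4 = (r * dist x y) ^ 4"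
    by (simp add: dist_pow4 power_mult_distrib distrib_left flip: power_mult)
  then show ?thesis
    by (rule power_eq_imp_eq_base) (use assms in auto)
qed

lemma dist_dil_one: "0 \<le> r \<Longrightarrow> dist 1 (dil r x) = r * dist 1 x"
  using dist_dil [of r 1 x] by simp

lemma dist_dil_inverse:
  fixes x y w :: "'n::finite heis"
  assumes "0 < r"
  shows "dist y (dil (1 / r) (inverse x * w)) = dist (x * dil r y) w / r"
proof -
  have "dist (dil r y) (inverse x * w) = r * dist y (dil (1 / r) (inverse x * w))"
    using dist_dil [of r y "dil (1 / r) (inverse x * w)"] assms by simp
  then show ?thesis
    using assms by (simp add: dist_inverse_mult field_simps)
qed

lemma norm_horiz_le: "norm (horiz y - horiz x) \<le> dist x y"
proof -
  have "norm (horiz y - horiz x) ^ 4 \<le> dist x y ^ 4"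
    by (simp add: dist_pow4)
  then show ?thesis
    by (simp add: power_mono_iff)
qed

lemma vert_diff_le: "\<bar>vert y - vert x - heis_form (horiz x) (horiz y)\<bar> \<le> (dist x y)\<^sup>2"
proof -
  have "(vert y - vert x - heis_form (horiz x) (horiz y))\<^sup>2 \<le> ((dist x y)\<^sup>2)\<^sup>2"
    using dist_pow4 [of x y] by simp
  then show ?thesis
    by (metis abs_le_square_iff abs_of_nonneg zero_le_power2)
qed

section \<open>The Koranyi topology in coordinates\<close>

lemma heis_form_tendsto [tendsto_intros]:
  assumes "(f \<longlongrightarrow> a) F" "(g \<longlongrightarrow> b) F"
  shows "((\<lambda>i. heis_form (f i) (g i)) \<longlongrightarrow> heis_form a b) F"
  unfolding heis_form_def by (intro tendsto_intros assms)

text \<open>\<open>dist x y ^ 4\<close> is continuous in the coordinates, and conversely the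
  horizontal difference and the twisted vertical difference are bounded by the distance and by its
  square. So the topology is the Euclidean one, and limits can be taken coordinatewise.\<close>

lemma tendsto_heis_iff:
  fixes x :: "'n::finite heis"
  shows "(X \<longlongrightarrow> x) F \<longleftrightarrow>
    ((\<lambda>i. horiz (X i)) \<longlongrightarrow> horiz x) F \<and> ((\<lambda>i. vert (X i)) \<longlongrightarrow> vert x) F"
proof safe
  assume X: "(X \<longlongrightarrow> x) F"
  then have d: "((\<lambda>i. dist x (X i)) \<longlongrightarrow> 0) F"
    by (simp add: tendsto_dist_iff [of X] dist_commute)
  have "((\<lambda>i. horiz (X i) - horiz x) \<longlongrightarrow> 0) F"
    by (rule Lim_null_comparison [OF always_eventually d]) (simp add: norm_horiz_le)
  then show h: "((\<lambda>i. horiz (X i)) \<longlongrightarrow> horiz x) F"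
    by (simp add: LIM_zero_iff)
  have d2: "((\<lambda>i. (dist x (X i))\<^sup>2) \<longlongrightarrow> 0) F"
    using tendsto_power [OF d, of 2] by simp
  have "((\<lambda>i. vert (X i) - vert x - heis_form (horiz x) (horiz (X i))) \<longlongrightarrow> 0) F"
    by (rule Lim_null_comparison [OF always_eventually d2]) (simp add: vert_diff_le)
  moreover have "((\<lambda>i. heis_form (horiz x) (horiz (X i))) \<longlongrightarrow> heis_form (horiz x) (horiz x)) F"
    by (intro tendsto_intros h)
  ultimately have "((\<lambda>i. vert (X i) - vert x) \<longlongrightarrow> 0) F"
    using tendsto_add [where a = 0 and b = 0] by (fastforce simp: heis_form_self)
  then show "((\<lambda>i. vert (X i)) \<longlongrightarrow> vert x) F"
    by (simp add: LIM_zero_iff)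
next
  assume h: "((\<lambda>i. horiz (X i)) \<longlongrightarrow> horiz x) F" and v: "((\<lambda>i. vert (X i)) \<longlongrightarrow> vert x) F"
  have "((\<lambda>i. norm (horiz (X i) - horiz x) ^ 4 +
     (vert (X i) - vert x - heis_form (horiz x) (horiz (X i)))\<^sup>2) \<longlongrightarrow>
     norm (horiz x - horiz x) ^ 4 + (vert x - vert x - heis_form (horiz x) (horiz x))\<^sup>2) F"
    by (intro tendsto_intros h v)
  then have "((\<lambda>i. dist x (X i) ^ 4) \<longlongrightarrow> 0) F"
    by (simp add: dist_pow4 heis_form_self)
  then have "((\<lambda>i. root 4 (dist x (X i) ^ 4)) \<longlongrightarrow> root 4 0) F"
    by (rule tendsto_real_root)
  then show "(X \<longlongrightarrow> x) F"
    by (simp add: tendsto_dist_iff [of X] dist_commute real_root_power_cancel)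
qed

lemma tendsto_heis_mult [tendsto_intros]:
  fixes x y :: "'n::finite heis"
  assumes "(X \<longlongrightarrow> x) F" "(Y \<longlongrightarrow> y) F"
  shows "((\<lambda>i. X i * Y i) \<longlongrightarrow> x * y) F"
  using assms by (auto simp: tendsto_heis_iff intro!: tendsto_intros)

lemma tendsto_dil [tendsto_intros]:
  fixes x :: "'n::finite heis"
  assumes "(R \<longlongrightarrow> r) F" "(X \<longlongrightarrow> x) F"
  shows "((\<lambda>i. dil (R i) (X i)) \<longlongrightarrow> dil r x) F"
  using assms by (auto simp: tendsto_heis_iff intro!: tendsto_intros)

lemma continuous_on_horiz: "continuous_on A horiz"
  and continuous_on_vert: "continuous_on A vert"
  using tendsto_heis_iff [of "\<lambda>x. x"] tendsto_ident_at by (force simp: continuous_on_def)+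

lemma compact_cball_heis: "compact (cball (x :: 'n::finite heis) r)"
proof -
  define R where "R = dist 1 x + \<bar>r\<bar>"
  define h where "h p = Heis (fst p) (snd p)" for p :: "(real ^ ('n + 'n)) \<times> real"
  have c: "continuous_on UNIV h"
    unfolding continuous_on_def h_def tendsto_heis_iff
    by (auto intro!: tendsto_fst tendsto_snd tendsto_ident_at simp del: split_paired_All)
  have "compact (h ` (cball 0 R \<times> {- R\<^sup>2 .. R\<^sup>2}))"
    by (rule compact_continuous_image) (auto intro: continuous_on_subset [OF c] compact_Times)
  moreover have "cball x r \<subseteq> h ` (cball 0 R \<times> {- R\<^sup>2 .. R\<^sup>2})"
  proof
    fix y assume "y \<in> cball x r"
    then have d: "dist 1 y \<le> R"
      using dist_triangle [of 1 y x] by (auto simp: R_def)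
    then have "norm (horiz y) \<le> R" "\<bar>vert y\<bar> \<le> R\<^sup>2"
      using norm_horiz_le [of y 1] vert_diff_le [of y 1] power_mono [OF d, of 2] by auto
    then have "y = h (horiz y, vert y)" "(horiz y, vert y) \<in> cball 0 R \<times> {- R\<^sup>2 .. R\<^sup>2}"
      by (auto simp: h_def)
    then show "y \<in> h ` (cball 0 R \<times> {- R\<^sup>2 .. R\<^sup>2})" by blast
  qed
  ultimately show ?thesis
    by (metis closed_cball compact_Int_closed inf.absorb_iff2)
qed

section \<open>Positive functionals on functions of Gaussian decay\<close>

text \<open>A function of width about \<open>t powr (- 1 / 4)\<close> that replaces the indicator of
  a ball of that radius; unlike the indicator it is analytic in the centre along dilation
  curves.\<close>

definition gauss :: "real \<Rightarrow> 'a::metric_space \<Rightarrow> 'a \<Rightarrow> real" where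
  "gauss t x w = exp (- t * dist x w ^ 4)"

lemma gauss_pos [simp]: "0 < gauss t x w" and gauss_nonneg [simp]: "0 \<le> gauss t x w"
  and gauss_le_1: "0 \<le> t \<Longrightarrow> gauss t x w \<le> 1"
  and gauss_self [simp]: "gauss t x x = 1"
  by (simp_all add: gauss_def)

lemma gauss_antimono: "t \<le> t' \<Longrightarrow> gauss t' x w \<le> gauss t x w"
  by (simp add: gauss_def mult_right_mono)

lemma continuous_on_gauss [continuous_intros]: "continuous_on A (gauss t x)"
  unfolding gauss_def by (intro continuous_intros)

lemma power4_add_le: "(a + b) ^ 4 \<le> 8 * (a ^ 4 + b ^ 4)" for a b :: real
proof -
  have sq: "(x + y)\<^sup>2 \<le> 2 * (x\<^sup>2 + y\<^sup>2)" for x y :: real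
    using zero_le_power2 [of "x - y"] by (simp add: power2_eq_square algebra_simps)
  have "((a + b)\<^sup>2)\<^sup>2 \<le> (2 * (a\<^sup>2 + b\<^sup>2))\<^sup>2"
    by (intro power_mono sq) simp
  also have "\<dots> = 4 * (a\<^sup>2 + b\<^sup>2)\<^sup>2" by (simp only: power_mult_distrib) simp
  also have "\<dots> \<le> 4 * (2 * ((a\<^sup>2)\<^sup>2 + (b\<^sup>2)\<^sup>2))"
    using sq [of "a\<^sup>2" "b\<^sup>2"] by linarith
  finally show ?thesis by simp
qed

text \<open>Recentring costs a factor 8 in the rate, from \<open>power4_add_le\<close>, and a
  constant that depends on t and R only. Estimates at varying centres can thus be dominated by one
  fixed Gaussian.\<close>

lemma gauss_recenter:
  assumes "0 \<le> t" "dist z x \<le> R"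
  shows "gauss t x w \<le> exp (t * R ^ 4) * gauss (t / 8) z w"
proof -
  have "dist z w ^ 4 \<le> (dist z x + dist x w) ^ 4"
    by (intro power_mono dist_triangle) simp
  also have "\<dots> \<le> 8 * (dist z x ^ 4 + dist x w ^ 4)"
    by (rule power4_add_le)
  also have "\<dots> \<le> 8 * (R ^ 4 + dist x w ^ 4)"
    using power_mono [OF assms(2), of 4] by simp
  finally have "t / 8 * dist z w ^ 4 \<le> t / 8 * (8 * (R ^ 4 + dist x w ^ 4))"
    using assms(1) by (intro mult_left_mono) auto
  then show ?thesis
    by (simp add: gauss_def algebra_simps flip: exp_add)
qed

text \<open>\<open>b ^ 4 - a ^ 4\<close> is \<open>b - a\<close> times a cubic of size at most
  \<open>32 * (1 + a ^ 4)\<close>; half of the exponent is spent on absorbing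
  \<open>1 + a ^ 4\<close>, which leaves the rate t / 2.\<close>

lemma gauss_diff_le:
  fixes x y w :: "'a::metric_space"
  assumes t: "0 < t" and d: "dist x y \<le> 1" and le: "dist x w \<le> dist y w"
  shows "\<bar>gauss t x w - gauss t y w\<bar> \<le> 32 * t * (1 + 2 / t) * dist x y * gauss (t / 2) x w"
proof -
  define a b where "a = dist x w" and "b = dist y w"
  have ab: "0 \<le> a" "a \<le> b" "b - a \<le> dist x y" "b \<le> a + 1"
    using le d dist_triangle [of y w x] by (simp_all add: a_def b_def dist_commute [of y x])
  have b4: "b ^ 4 - a ^ 4 = (b - a) * (b ^ 3 + b\<^sup>2 * a + b * a\<^sup>2 + a ^ 3)"
    by (simp add: eval_nat_numeral algebra_simps)
  have le3: "b\<^sup>2 * a \<le> b ^ 3" "b * a\<^sup>2 \<le> b ^ 3" "a ^ 3 \<le> b ^ 3"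
    using mult_left_mono [OF ab(2), of "b\<^sup>2"] mult_left_mono [OF power_mono [OF ab(2,1), of 2], of b]
      power_mono [OF ab(2,1), of 3] ab by (simp_all add: power2_eq_square power3_eq_cube mult_ac)
  have "b ^ 3 \<le> (a + 1) ^ 3"
    using ab by (intro power_mono) auto
  also have "\<dots> \<le> (a + 1) ^ 4"
    using ab by (intro power_increasing) auto
  also have "\<dots> \<le> 8 * (a ^ 4 + 1)"
    using power4_add_le [of a 1] by simp
  finally have b3: "b ^ 3 \<le> 8 * (a ^ 4 + 1)" .
  have "p \<le> 8 * (q + 1) \<Longrightarrow> x \<le> p \<Longrightarrow> y \<le> p \<Longrightarrow> z \<le> p \<Longrightarrow> p + x + y + z \<le> 32 * (1 + q)"
    for p q x y z :: real by simp
  from this [OF b3 le3] have "b ^ 3 + b\<^sup>2 * a + b * a\<^sup>2 + a ^ 3 \<le> 32 * (1 + a ^ 4)" .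
  then have diff: "b ^ 4 - a ^ 4 \<le> dist x y * (32 * (1 + a ^ 4))"
    unfolding b4 using ab by (intro mult_mono) auto
  have "gauss t x w - gauss t y w = exp (- t * a ^ 4) * (1 - exp (- (t * (b ^ 4 - a ^ 4))))"
    by (simp add: gauss_def a_def b_def algebra_simps flip: exp_add)
  also have "\<dots> \<le> exp (- t * a ^ 4) * (t * (b ^ 4 - a ^ 4))"
    using exp_ge_add_one_self [of "- (t * (b ^ 4 - a ^ 4))"] by (intro mult_left_mono) auto
  also have "\<dots> \<le> exp (- t * a ^ 4) * (t * (dist x y * (32 * (1 + a ^ 4))))"
    using diff t by (intro mult_left_mono) auto
  also have "\<dots> = 32 * t * dist x y * (exp (- t * a ^ 4) * (1 + a ^ 4))"
    by simp
  also have "\<dots> \<le> 32 * t * dist x y * ((1 + 2 / t) * exp (- (t / 2) * a ^ 4))"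
  proof (intro mult_left_mono)
    have "t / 2 * a ^ 4 \<le> exp (t / 2 * a ^ 4)"
      using exp_ge_add_one_self [of "t / 2 * a ^ 4"] by linarith
    then have "a ^ 4 \<le> 2 / t * exp (t / 2 * a ^ 4)"
      using t by (simp add: field_simps)
    moreover have "1 \<le> exp (t / 2 * a ^ 4)"
      using t by simp
    ultimately have "1 + a ^ 4 \<le> (1 + 2 / t) * exp (t / 2 * a ^ 4)"
      unfolding distrib_right by linarith
    then have "exp (- t * a ^ 4) * (1 + a ^ 4) \<le>
        exp (- t * a ^ 4) * ((1 + 2 / t) * exp (t / 2 * a ^ 4))"
      by (intro mult_left_mono) auto
    also have "\<dots> = (1 + 2 / t) * exp (- (t / 2) * a ^ 4)"
      by (simp add: mult_ac flip: exp_add)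
    finally show "exp (- t * a ^ 4) * (1 + a ^ 4) \<le> (1 + 2 / t) * exp (- (t / 2) * a ^ 4)" .
  qed (use t in auto)
  finally have "gauss t x w - gauss t y w \<le> 32 * t * (1 + 2 / t) * dist x y * gauss (t / 2) x w"
    by (simp only: gauss_def a_def b_def mult_ac)
  moreover have "gauss t y w \<le> gauss t x w"
    using t ab by (simp add: gauss_def a_def b_def power_mono)
  ultimately show ?thesis by simp
qed

text \<open>The rate t / 16 is the t / 2 of \<open>gauss_diff_le\<close> after the loss of 8 in
  \<open>gauss_recenter\<close>. The majorant has the fixed centre z, so a positive functional can
  be applied to both sides.\<close>

lemma gauss_close:
  fixes z :: "'a::metric_space"
  assumes t: "0 < t"
  obtains C where "0 \<le> C" "\<And>x y w. dist z x \<le> R \<Longrightarrow> dist z y \<le> R \<Longrightarrow> dist x y \<le> 1 \<Longrightarrow>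
    \<bar>gauss t x w - gauss t y w\<bar> \<le> C * dist x y * gauss (t / 16) z w"
proof
  define C where "C = 32 * t * (1 + 2 / t) * exp (t / 2 * R ^ 4)"
  show "0 \<le> C" using t by (simp add: C_def)
  fix x y w assume R: "dist z x \<le> R" "dist z y \<le> R" "dist x y \<le> 1"
  have *: "\<bar>gauss t x w - gauss t y w\<bar> \<le> C * dist x y * gauss (t / 16) z w"
    if R: "dist z x \<le> R" "dist z y \<le> R" "dist x y \<le> 1" "dist x w \<le> dist y w" for x y
  proof -
    have "gauss (t / 2) x w \<le> exp (t / 2 * R ^ 4) * gauss (t / 16) z w"
      using gauss_recenter [of "t / 2" z x R w] t R by simp
    then have "32 * t * (1 + 2 / t) * dist x y * gauss (t / 2) x w \<le>
        32 * t * (1 + 2 / t) * dist x y * (exp (t / 2 * R ^ 4) * gauss (t / 16) z w)"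
      using t by (intro mult_left_mono) auto
    then show ?thesis
      using gauss_diff_le [OF t R(3,4)] by (simp add: C_def mult_ac)
  qed
  show "\<bar>gauss t x w - gauss t y w\<bar> \<le> C * dist x y * gauss (t / 16) z w"
    using *[of x y] *[of y x] R by (cases "dist x w \<le> dist y w") (auto simp: dist_commute abs_minus_commute)
qed

text \<open>The test functions. They include the Gaussians and the continuous functions of bounded
  support, are stable under zooming, and are each dominated by a multiple of one Gaussian, so that
  bounds on Gaussian averages bound a functional on all of them.\<close>

definition gauss_decay :: "('n::finite heis \<Rightarrow> real) set" where
  "gauss_decay = {f. continuous_on UNIV f \<and> (\<exists>C t. 0 < t \<and> (\<forall>w. \<bar>f w\<bar> \<le> C * gauss t 1 w))}"

lemma gauss_decayI:
  assumes "continuous_on UNIV f" "0 < t" "\<And>w. \<bar>f w\<bar> \<le> C * gauss t x w"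
  shows "f \<in> gauss_decay"
proof -
  have C: "0 \<le> C"
    using assms(3) [of x] by simp
  have "\<bar>f w\<bar> \<le> (C * exp (t * dist 1 x ^ 4)) * gauss (t / 8) 1 w" for w
    using mult_left_mono [OF gauss_recenter [of t 1 x "dist 1 x" w] C] assms(2) assms(3) [of w]
    by (simp add: mult_ac)
  moreover have "0 < t / 8"
    using assms(2) by simp
  ultimately show ?thesis
    unfolding gauss_decay_def using assms(1) by blast
qed

lemma gauss_decayE:
  assumes "f \<in> gauss_decay"
  obtains t C where "0 < t" "0 \<le> C" "\<And>w. \<bar>f w\<bar> \<le> C * gauss t 1 w"
proof -
  obtain C t where *: "0 < t" "\<And>w. \<bar>f w\<bar> \<le> C * gauss t 1 w"
    using assms by (auto simp: gauss_decay_def)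
  moreover have "0 \<le> C" using *(2) [of 1] by simp
  ultimately show ?thesis using that by blast
qed

lemma gauss_decay_cont: "f \<in> gauss_decay \<Longrightarrow> continuous_on A f"
  by (auto simp: gauss_decay_def intro: continuous_on_subset)

lemma gauss_in_decay [intro, simp]: "0 < t \<Longrightarrow> gauss t x \<in> gauss_decay"
  by (rule gauss_decayI [of _ t 1 x]) (auto intro: continuous_intros)

lemma gauss_decay_add [intro]:
  assumes "f \<in> gauss_decay" "g \<in> gauss_decay"
  shows "(\<lambda>w. f w + g w) \<in> gauss_decay"
proof -
  obtain C t where 1: "0 < t" "0 \<le> C" "\<And>w. \<bar>f w\<bar> \<le> C * gauss t 1 w"
    by (rule gauss_decayE [OF assms(1)], rule that)
  obtain D u where 2: "0 < u" "0 \<le> D" "\<And>w. \<bar>g w\<bar> \<le> D * gauss u 1 w"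
    by (rule gauss_decayE [OF assms(2)], rule that)
  have "\<bar>f w + g w\<bar> \<le> (C + D) * gauss (min t u) 1 w" for w
  proof -
    have "C * gauss t 1 w \<le> C * gauss (min t u) 1 w" "D * gauss u 1 w \<le> D * gauss (min t u) 1 w"
      using 1(2) 2(2) by (auto intro!: mult_left_mono gauss_antimono)
    then show ?thesis
      using 1(3) [of w] 2(3) [of w] by (simp add: algebra_simps)
  qed
  then show ?thesis
    using 1 2 assms by (intro gauss_decayI [of _ "min t u" "C + D" 1] continuous_on_add) (auto intro: gauss_decay_cont)
qed

lemma gauss_decay_dominated:
  assumes "g \<in> gauss_decay" "continuous_on UNIV f" "\<And>w. \<bar>f w\<bar> \<le> \<bar>g w\<bar>"
  shows "f \<in> gauss_decay"
proof -
  obtain C t where 1: "0 < t" "0 \<le> C" "\<And>w. \<bar>g w\<bar> \<le> C * gauss t 1 w"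
    by (rule gauss_decayE [OF assms(1)], rule that)
  show ?thesis
    using 1(1) assms(2) order_trans [OF assms(3) 1(3)] by (intro gauss_decayI [of f t C 1])
qed

lemma gauss_decay_mult:
  assumes "f \<in> gauss_decay"
  shows "(\<lambda>w. c * f w) \<in> gauss_decay"
proof -
  obtain C t where 1: "0 < t" "0 \<le> C" "\<And>w. \<bar>f w\<bar> \<le> C * gauss t 1 w"
    by (rule gauss_decayE [OF assms(1)], rule that)
  have "\<bar>c * f w\<bar> \<le> (\<bar>c\<bar> * C) * gauss t 1 w" for w
    using mult_left_mono [OF 1(3) [of w], of "\<bar>c\<bar>"] by (simp add: abs_mult mult_ac)
  then show ?thesis
    using 1 assms by (intro gauss_decayI [of _ t "\<bar>c\<bar> * C" 1] continuous_on_mult_left) (auto intro: gauss_decay_cont)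
qed

lemma gauss_decay_diff [intro]:
  "f \<in> gauss_decay \<Longrightarrow> g \<in> gauss_decay \<Longrightarrow> (\<lambda>w. f w - g w) \<in> gauss_decay"
  using gauss_decay_add [of f "\<lambda>w. - 1 * g w"] gauss_decay_mult [of g "- 1"] by simp

lemma gauss_decay_zero [simp]: "(\<lambda>w. 0) \<in> gauss_decay"
  using gauss_decay_mult [of "gauss 1 1" 0] by simp

lemma gauss_decay_max [intro]: "f \<in> gauss_decay \<Longrightarrow> (\<lambda>w. max 0 (f w)) \<in> gauss_decay"
  by (rule gauss_decay_dominated [of f]) (auto intro: continuous_on_max continuous_on_const gauss_decay_cont)

lemma gauss_decay_sum [intro]:
  "(\<And>i. i \<in> A \<Longrightarrow> f i \<in> gauss_decay) \<Longrightarrow> (\<lambda>w. \<Sum>i\<in>A. f i w) \<in> gauss_decay"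
  by (induction A rule: infinite_finite_induct) auto

lemma gauss_decay_bounded_support:
  assumes c: "continuous_on UNIV f" and B: "\<And>w. \<bar>f w\<bar> \<le> B" and s: "\<And>w. dist z w > R \<Longrightarrow> f w = 0"
  shows "f \<in> gauss_decay"
proof (rule gauss_decayI [OF c, of 1])
  fix w
  show "\<bar>f w\<bar> \<le> (B * exp (R ^ 4)) * gauss 1 z w"
  proof (cases "dist z w \<le> R")
    case True
    then have "1 \<le> exp (R ^ 4) * gauss 1 z w"
      using power_mono [OF True, of 4] by (simp add: gauss_def flip: exp_add)
    then have "B * 1 \<le> B * (exp (R ^ 4) * gauss 1 z w)"
      using order_trans [OF abs_ge_zero B] by (rule mult_left_mono)
    then show ?thesis
      using B [of w] by (simp only: mult_1_right mult.assoc)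
  next
    case False
    then show ?thesis using s [of w] B [of w] by simp
  qed
qed simp

lemma gauss_decay_blowup:
  assumes f: "f \<in> gauss_decay" and r: "0 < r"
  shows "(\<lambda>w. f (dil (1 / r) (inverse x * w))) \<in> gauss_decay"
proof -
  obtain C t where 1: "0 < t" "0 \<le> C" "\<And>w. \<bar>f w\<bar> \<le> C * gauss t 1 w"
    by (rule gauss_decayE [OF f], rule that)
  have c: "continuous_on UNIV (\<lambda>w. dil (1 / r) (inverse x * w))"
    unfolding continuous_on_def by (intro ballI tendsto_intros)
  show ?thesis
  proof (rule gauss_decayI)
    show "continuous_on UNIV (\<lambda>w. f (dil (1 / r) (inverse x * w)))"
      using continuous_on_compose [OF c gauss_decay_cont [OF f]] by (simp add: o_def)
    show "\<bar>f (dil (1 / r) (inverse x * w))\<bar> \<le> C * gauss (t / r ^ 4) x w" for w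
      using 1(3) [of "dil (1 / r) (inverse x * w)"] dist_dil_inverse [OF r, of 1 x w]
      by (simp add: gauss_def power_divide)
  qed (use 1 r in auto)
qed

text \<open>Cut-off functions, for the places where a test function must vanish exactly outside a
  ball.\<close>

definition bump :: "'a::metric_space \<Rightarrow> real \<Rightarrow> 'a \<Rightarrow> real" where
  "bump z e w = max 0 (1 - dist z w / e)"

lemma bump_nonneg [simp]: "0 \<le> bump z e w"
  and bump_le_1: "0 < e \<Longrightarrow> bump z e w \<le> 1"
  and bump_self [simp]: "bump z e z = 1"
  and bump_outside: "0 < e \<Longrightarrow> e \<le> dist z w \<Longrightarrow> bump z e w = 0"
  by (auto simp: bump_def max_def)

lemma bump_decay [simp]: "0 < e \<Longrightarrow> bump z e \<in> gauss_decay"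
proof (rule gauss_decay_bounded_support [where B = 1 and z = z and R = e])
  assume "0 < e"
  show "continuous_on UNIV (bump z e)"
    unfolding bump_def using \<open>0 < e\<close> by (intro continuous_intros) auto
qed (auto simp: bump_outside bump_le_1)

section \<open>Positive functionals and their supports\<close>

definition positive_functional :: "(('n::finite heis \<Rightarrow> real) \<Rightarrow> real) \<Rightarrow> bool" where
  "positive_functional I \<longleftrightarrow>
     (\<forall>f\<in>gauss_decay. \<forall>g\<in>gauss_decay. I (\<lambda>w. f w + g w) = I f + I g) \<and>
     (\<forall>c. \<forall>f\<in>gauss_decay. I (\<lambda>w. c * f w) = c * I f) \<and>
     (\<forall>f\<in>gauss_decay. (\<forall>w. 0 \<le> f w) \<longrightarrow> 0 \<le> I f)"

lemma
  assumes "positive_functional I"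
  shows pf_add: "f \<in> gauss_decay \<Longrightarrow> g \<in> gauss_decay \<Longrightarrow> I (\<lambda>w. f w + g w) = I f + I g"
    and pf_mult: "f \<in> gauss_decay \<Longrightarrow> I (\<lambda>w. c * f w) = c * I f"
    and pf_nonneg: "f \<in> gauss_decay \<Longrightarrow> (\<And>w. 0 \<le> f w) \<Longrightarrow> 0 \<le> I f"
  using assms by (auto simp: positive_functional_def)

lemma pf_diff:
  assumes "positive_functional I" "f \<in> gauss_decay" "g \<in> gauss_decay"
  shows "I (\<lambda>w. f w - g w) = I f - I g"
  using pf_add [OF assms(1,2), of "\<lambda>w. - 1 * g w"] pf_mult [OF assms(1,3), of "- 1"]
    gauss_decay_mult [OF assms(3), of "- 1"] by simp

lemma pf_mono:
  assumes "positive_functional I" "f \<in> gauss_decay" "g \<in> gauss_decay" "\<And>w. f w \<le> g w"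
  shows "I f \<le> I g"
  using pf_nonneg [OF assms(1) gauss_decay_diff [OF assms(3,2)]] pf_diff [OF assms(1,3,2)] assms(4)
  by simp

lemma pf_zero: "positive_functional I \<Longrightarrow> I (\<lambda>w. 0) = 0"
  using pf_mult [of I "\<lambda>w. 0" 0] by simp

lemma pf_abs_le:
  assumes "positive_functional I" "f \<in> gauss_decay" "g \<in> gauss_decay" "\<And>w. \<bar>f w\<bar> \<le> g w"
  shows "\<bar>I f\<bar> \<le> I g"
proof -
  have "f w \<le> g w" "- 1 * f w \<le> g w" for w
    using assms(4) [of w] by auto
  then have "I f \<le> I g" "I (\<lambda>w. - 1 * f w) \<le> I g"
    using pf_mono [OF assms(1,2,3)] pf_mono [OF assms(1) gauss_decay_mult [OF assms(2)] assms(3)] by blast+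
  then show ?thesis
    using pf_mult [OF assms(1,2), of "- 1"] by simp
qed

lemma pf_sum:
  assumes "positive_functional I" "finite A" "\<And>i. i \<in> A \<Longrightarrow> f i \<in> gauss_decay"
  shows "I (\<lambda>w. \<Sum>i\<in>A. f i w) = (\<Sum>i\<in>A. I (f i))"
  using assms(2,3)
proof (induction A)
  case empty
  then show ?case by (simp add: pf_zero [OF assms(1)])
next
  case (insert a A)
  then have "I (\<lambda>w. f a w + (\<Sum>i\<in>A. f i w)) = I (f a) + I (\<lambda>w. \<Sum>i\<in>A. f i w)"
    by (intro pf_add [OF assms(1)] gauss_decay_sum) auto
  with insert show ?case by simp
qed

text \<open>For integration against a finite Borel measure this is the topological support of the
  measure.\<close>

definition fsupport :: "(('n::finite heis \<Rightarrow> real) \<Rightarrow> real) \<Rightarrow> 'n heis set" where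
  "fsupport I = {x. \<forall>f\<in>gauss_decay. (\<forall>w. 0 \<le> f w) \<longrightarrow> 0 < f x \<longrightarrow> 0 < I f}"

lemma fsupportD:
  "x \<in> fsupport I \<Longrightarrow> f \<in> gauss_decay \<Longrightarrow> (\<And>w. 0 \<le> f w) \<Longrightarrow> 0 < f x \<Longrightarrow> 0 < I f"
  by (simp add: fsupport_def)

text \<open>
  Functionals rather than measures are used so that limits come from Tychonoff's theorem, without
  the Riesz representation theorem. For a measure, the condition says that the balls centred on the
  support have measure proportional to \<open>r\<^sup>s\<close>.
\<close>

definition uniform_functional :: "real \<Rightarrow> real \<Rightarrow> (('n::finite heis \<Rightarrow> real) \<Rightarrow> real) \<Rightarrow> bool" where
  "uniform_functional s c I \<longleftrightarrow> 0 < c \<and> positive_functional I \<and> 1 \<in> fsupport I \<and>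
     (\<forall>x\<in>fsupport I. \<forall>t>0. I (gauss t x) = c * t powr (- s / 4))"

lemma
  assumes "uniform_functional s c I"
  shows uf_pf: "positive_functional I" and uf_pos: "0 < c" and uf_one: "1 \<in> fsupport I"
    and uf_gauss: "x \<in> fsupport I \<Longrightarrow> 0 < t \<Longrightarrow> I (gauss t x) = c * t powr (- s / 4)"
  using assms by (auto simp: uniform_functional_def)

text \<open>Mass must accumulate at x: away from x, \<open>gauss t x\<close> is at most an
  exponentially small multiple of \<open>gauss (t / 2) x\<close>, while the assumed law lets the
  averages of the two differ only by the factor \<open>2 powr (s / 4)\<close>. So for large t a part
  of the average comes from the region where f is bounded below.\<close>

lemma fsupportI_gauss:
  assumes I: "positive_functional I" and c: "0 < c"
    and x: "\<And>t. 0 < t \<Longrightarrow> I (gauss t x) = c * t powr (- s / 4)"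
  shows "x \<in> fsupport I"
  unfolding fsupport_def
proof (intro CollectI ballI impI)
  fix f :: "'a heis \<Rightarrow> real" assume f: "f \<in> gauss_decay" "\<forall>w. 0 \<le> f w" "0 < f x"
  have "isCont f x"
    using gauss_decay_cont [OF f(1), of UNIV] by (simp add: continuous_on_eq_continuous_at)
  then obtain e where e: "0 < e" "\<And>w. dist w x < e \<Longrightarrow> dist (f w) (f x) < f x / 2"
    unfolding continuous_at_eps_delta using f(3) half_gt_zero by blast
  \<comment> \<open>\<open>2 powr (s / 4)\<close> is the ratio of the averages of
    \<open>gauss (t / 2) x\<close> and \<open>gauss t x\<close>; t is taken so large that the outer
    part, of weight \<open>q\<close>, cannot account for the whole average.\<close>
  have "((\<lambda>t. 2 powr (s / 4) * exp (- (e ^ 4 / 2) * t)) \<longlongrightarrow> 2 powr (s / 4) * 0) at_top"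
    using e by (intro tendsto_intros filterlim_compose [OF exp_at_bot] filterlim_tendsto_neg_mult_at_bot
        [OF tendsto_const] filterlim_ident) auto
  then have "\<forall>\<^sub>F t in at_top. 2 powr (s / 4) * exp (- (e ^ 4 / 2) * t) < 1"
    by (intro order_tendstoD(2)) auto
  then have "\<forall>\<^sub>F t in at_top. 0 < t \<and> 2 powr (s / 4) * exp (- (e ^ 4 / 2) * t) < 1"
    by (intro eventually_conj eventually_gt_at_top)
  then obtain t where t: "0 < t" "2 powr (s / 4) * exp (- (e ^ 4 / 2) * t) < 1"
    using eventually_happens [of _ "at_top :: real filter"] by auto
  define q where "q = exp (- (e ^ 4 / 2) * t)"
  have "gauss t x w \<le> 2 / f x * f w + q * gauss (t / 2) x w" for w
  proof (cases "dist w x < e")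
    case True
    then have "f x / 2 \<le> f w"
      using e(2) [OF True] by (simp add: dist_real_def abs_if split: if_splits)
    then have "1 \<le> 2 / f x * f w"
      using f(3) by (simp add: field_simps)
    then show ?thesis
      using gauss_le_1 [of t x w] t by (simp add: q_def add_increasing2)
  next
    case False
    then have "e ^ 4 \<le> dist x w ^ 4"
      using e by (intro power_mono) (auto simp: dist_commute)
    then have "gauss t x w \<le> q * gauss (t / 2) x w"
      using t mult_right_mono [of "e ^ 4" "dist x w ^ 4" "t / 2"]
      by (simp add: gauss_def q_def algebra_simps flip: exp_add)
    moreover have "0 \<le> 2 / f x * f w"
      using f by simp
    ultimately show ?thesis by linarith
  qed
  moreover have g: "gauss (t / 2) x \<in> gauss_decay" "gauss t x \<in> gauss_decay"
    using t by auto
  ultimately have "I (gauss t x) \<le> I (\<lambda>w. 2 / f x * f w + q * gauss (t / 2) x w)"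
    by (rule_tac pf_mono [OF I _ gauss_decay_add [OF gauss_decay_mult [OF f(1)] gauss_decay_mult]])
  also have "\<dots> = 2 / f x * I f + q * I (gauss (t / 2) x)"
    by (simp only: pf_add [OF I gauss_decay_mult [OF f(1)] gauss_decay_mult [OF g(1)]]
        pf_mult [OF I f(1)] pf_mult [OF I g(1)])
  finally have le: "c * t powr (- s / 4) \<le> 2 / f x * I f + q * (c * (t / 2) powr (- s / 4))"
    unfolding x [OF t(1)] x [OF half_gt_zero [OF t(1)]] .
  have half: "(t / 2) powr (- s / 4) = t powr (- s / 4) * 2 powr (s / 4)"
  proof -
    have "(t / 2) powr (- s / 4) = t powr (- s / 4) / 2 powr (- s / 4)"
      by (rule powr_divide)
    also have "2 powr (- s / 4) = inverse (2 powr (s / 4))"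
      using powr_minus [of "2::real" "s / 4"] by (simp only: minus_divide_left)
    finally show ?thesis
      by (simp only: divide_inverse inverse_inverse_eq)
  qed
  have "p \<le> b + q * (c * (d * e)) \<Longrightarrow> p = c * d \<Longrightarrow> p * (1 - e * q) \<le> b" for p b d e
    by (simp add: algebra_simps)
  from this [OF le [unfolded half] refl]
  have "c * t powr (- s / 4) * (1 - 2 powr (s / 4) * q) \<le> 2 / f x * I f" .
  moreover have "0 < c * t powr (- s / 4) * (1 - 2 powr (s / 4) * q)"
    using t c by (simp add: q_def)
  ultimately have "0 < 2 / f x * I f" by (rule less_le_trans [rotated])
  then show "0 < I f"
    using f(3) by (simp add: zero_less_mult_iff zero_less_divide_iff)
qed

text \<open>At each point of K some nonnegative test function is positive although its functional
  value is 0; by compactness finitely many of them add up to a function bounded below on K, and a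
  multiple of the sum dominates f.\<close>

lemma pf_zero_off_support:
  assumes I: "positive_functional I" and f: "f \<in> gauss_decay"
    and K: "compact K" "K \<inter> fsupport I = {}" "\<And>w. w \<notin> K \<Longrightarrow> f w = 0"
  shows "I f = 0"
proof (cases "K = {}")
  case True
  then have "f = (\<lambda>w. 0)" using K by auto
  then show ?thesis using pf_zero [OF I] by simp
next
  case False
  have "\<exists>g\<in>gauss_decay. (\<forall>w. 0 \<le> g w) \<and> 0 < g x \<and> I g \<le> 0" if "x \<in> K" for x
  proof -
    from that K have "x \<notin> fsupport I" by auto
    then show ?thesis by (auto simp: fsupport_def not_less)
  qed
  then obtain g where g: "\<And>x. x \<in> K \<Longrightarrow> g x \<in> gauss_decay" "\<And>x w. x \<in> K \<Longrightarrow> 0 \<le> g x w"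
    "\<And>x. x \<in> K \<Longrightarrow> 0 < g x x" "\<And>x. x \<in> K \<Longrightarrow> I (g x) \<le> 0"
    by metis
  have op: "open {w. 0 < g x w}" if "x \<in> K" for x
    using open_Collect_less [of "\<lambda>_. 0" "g x"] gauss_decay_cont [OF g(1) [OF that]] by simp
  obtain X where X: "X \<subseteq> K" "finite X" "K \<subseteq> (\<Union>x\<in>X. {w. 0 < g x w})"
    by (rule compactE_image [OF K(1), of K "\<lambda>x. {w. 0 < g x w}"]) (use op g(3) in auto)
  define G where "G w = (\<Sum>x\<in>X. g x w)" for w
  have G: "G \<in> gauss_decay" "\<And>w. 0 \<le> G w"
    using X g unfolding G_def by (auto intro!: sum_nonneg)
  have "I G = (\<Sum>x\<in>X. I (g x))"
    unfolding G_def using X g by (intro pf_sum I) auto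
  also have "\<dots> \<le> 0"
    using X g by (intro sum_nonpos) auto
  finally have IG: "I G = 0"
    using pf_nonneg [OF I G] by simp
  have Gpos: "0 < G w" if w: "w \<in> K" for w
  proof -
    obtain x where x: "x \<in> X" "0 < g x w" using X w by auto
    then have "g x w \<le> G w"
      unfolding G_def using X g by (intro member_le_sum) auto
    then show ?thesis using x by simp
  qed
  obtain a where a: "a \<in> K" "\<And>w. w \<in> K \<Longrightarrow> G a \<le> G w"
    using continuous_attains_inf [OF K(1) False gauss_decay_cont [OF G(1)]] by blast
  obtain C t where C: "0 < t" "0 \<le> C" "\<And>w. \<bar>f w\<bar> \<le> C * gauss t 1 w"
    by (rule gauss_decayE [OF f], rule that)
  have "\<bar>f w\<bar> \<le> C / G a * G w" for w
  proof (cases "w \<in> K")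
    case True
    have "\<bar>f w\<bar> \<le> C * 1"
      using C(3) [of w] mult_left_mono [OF gauss_le_1 [of t 1 w] C(2)] C(1) by linarith
    also have "\<dots> \<le> C * (G w / G a)"
      using a Gpos [OF a(1)] True C(2) by (intro mult_left_mono) auto
    finally show ?thesis by simp
  next
    case False
    then show ?thesis using K(3) [of w] Gpos [OF a(1)] G(2) [of w] C(2) by simp
  qed
  then have "\<bar>I f\<bar> \<le> I (\<lambda>w. C / G a * G w)"
    by (rule pf_abs_le [OF I f gauss_decay_mult [OF G(1)]])
  also have "\<dots> = 0"
    using pf_mult [OF I G(1), of "C / G a"] IG by simp
  finally show ?thesis by simp
qed

section \<open>Limits and tangents of functionals\<close>

text \<open>Compactness of a product of intervals gives a cluster point of the sequence. A finer
  filter is returned because, with uncountably many coordinates, there need not be a convergent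
  subsequence.\<close>

lemma cluster_functional:
  fixes I :: "nat \<Rightarrow> 'b \<Rightarrow> real"
  assumes B: "\<And>j f. \<bar>I j f\<bar> \<le> B f"
  obtains J U where "U \<noteq> bot" "U \<le> sequentially" "\<And>f. ((\<lambda>j. I j f) \<longlongrightarrow> J f) U"
proof -
  define K where "K = PiE UNIV (\<lambda>f. {- B f .. B f})"
  have "compactin (product_topology (\<lambda>_. euclidean) UNIV) K"
    unfolding K_def compactin_PiE by (simp add: compactin_euclidean_iff)
  then have "compact K"
    by (simp add: euclidean_product_topology compactin_euclidean_iff)
  moreover have "\<forall>\<^sub>F x in filtermap I sequentially. x \<in> K"
    using B by (auto simp: eventually_filtermap K_def PiE_iff abs_le_iff minus_le_iff)
  ultimately obtain J where J: "inf (nhds J) (filtermap I sequentially) \<noteq> bot"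
    unfolding compact_filter by (metis filtermap_bot_iff sequentially_bot)
  \<comment> \<open>The coarsest filter finer than \<open>sequentially\<close> along which
    \<open>I\<close> tends to \<open>J\<close>; it is proper because \<open>J\<close> is a cluster
    point.\<close>
  define U where "U = inf sequentially (filtercomap I (nhds J))"
  have "U \<noteq> bot"
  proof
    assume "U = bot"
    then have "eventually (\<lambda>_. False) U" by simp
    then obtain P Q where PQ: "eventually P sequentially" "eventually Q (filtercomap I (nhds J))"
      "\<And>j. P j \<Longrightarrow> Q j \<Longrightarrow> False"
      unfolding U_def eventually_inf by blast
    then obtain Q' where Q': "eventually Q' (nhds J)" "\<And>j. Q' (I j) \<Longrightarrow> Q j"
      unfolding eventually_filtercomap by blast
    have "eventually (\<lambda>x. \<not> Q' x) (filtermap I sequentially)"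
      unfolding eventually_filtermap using PQ(1) by (rule eventually_mono) (use PQ Q' in blast)
    then have "eventually (\<lambda>_. False) (inf (nhds J) (filtermap I sequentially))"
      unfolding eventually_inf using Q'(1) by blast
    then show False using J by (simp add: trivial_limit_def)
  qed
  moreover have "U \<le> sequentially" by (simp add: U_def)
  moreover have "((\<lambda>j. I j f) \<longlongrightarrow> J f) U" for f
  proof -
    have "filterlim I (nhds J) U"
      unfolding filterlim_def U_def
      by (meson filtermap_filtercomap filtermap_mono inf.cobounded2 order_trans)
    then show ?thesis
      using continuous_on_tendsto_compose [OF continuous_on_product_coordinates, of I J U f]
      by simp
  qed
  ultimately show ?thesis using that by blast
qed

text \<open>Shared by the tangents of a functional, where \<open>S j\<close> is the rescaled
  support, and the blow-ups of a measure, where \<open>S j\<close> is the rescaled set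
  \<open>E\<close>. The law holds asymptotically on \<open>S j\<close>, and balls missed by
  \<open>S j\<close> lose their mass. Hence points of \<open>S j\<close> approximate the support of
  the limit, and the law carries over to it because Gaussian averages are locally Lipschitz in the
  centre.\<close>

lemma limit_functional:
  fixes I :: "nat \<Rightarrow> ('n::finite heis \<Rightarrow> real) \<Rightarrow> real" and S :: "nat \<Rightarrow> 'n heis set"
  assumes c: "0 < c" and pf: "\<And>j. positive_functional (I j)" and one: "\<And>j. 1 \<in> S j"
    and gauss: "\<And>t R e. 0 < t \<Longrightarrow> 0 < e \<Longrightarrow> \<forall>\<^sub>F j in sequentially.
      \<forall>y\<in>S j. dist 1 y \<le> R \<longrightarrow> \<bar>I j (gauss t y) - c * t powr (- s / 4)\<bar> \<le> e"
    and null: "\<And>z e q. 0 < e \<Longrightarrow> 0 < q \<Longrightarrow> \<forall>\<^sub>F j in sequentially.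
      S j \<inter> ball z e = {} \<longrightarrow> I j (bump z (e / 2)) \<le> q"
  obtains J where "uniform_functional s c J"
    "\<And>z e. z \<in> fsupport J \<Longrightarrow> 0 < e \<Longrightarrow> \<exists>\<^sub>F j in sequentially. S j \<inter> ball z e \<noteq> {}"
proof -
  have bdd: "\<exists>B. \<forall>j. \<bar>I j f\<bar> \<le> B" if f: "f \<in> gauss_decay" for f
  proof -
    obtain C t where C: "0 < t" "0 \<le> C" "\<And>w. \<bar>f w\<bar> \<le> C * gauss t 1 w"
      by (rule gauss_decayE [OF f], rule that)
    have "\<forall>\<^sub>F j in sequentially. \<bar>I j (gauss t 1) - c * t powr (- s / 4)\<bar> \<le> 1"
      using gauss [OF C(1) zero_less_one, of 0] by (rule eventually_mono) (use one in auto)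
    then have "\<forall>\<^sub>F j in sequentially. norm (I j f) \<le> C * (c * t powr (- s / 4) + 1)"
    proof eventually_elim
      case (elim j)
      have "\<bar>I j f\<bar> \<le> I j (\<lambda>w. C * gauss t 1 w)"
        by (rule pf_abs_le [OF pf f gauss_decay_mult [OF gauss_in_decay [OF C(1)]] C(3)])
      also have "\<dots> = C * I j (gauss t 1)"
        by (rule pf_mult [OF pf gauss_in_decay [OF C(1)]])
      also have "\<dots> \<le> C * (c * t powr (- s / 4) + 1)"
        using elim C(2) by (intro mult_left_mono) auto
      finally show ?case by simp
    qed
    then have "Bseq (\<lambda>j. I j f)"
      by (rule BfunI)
    then obtain B where "\<forall>j. norm (I j f) \<le> B"
      by (rule BseqE) blast
    then show ?thesis by auto
  qed
  then obtain B where B: "\<And>f j. f \<in> gauss_decay \<Longrightarrow> \<bar>I j f\<bar> \<le> B f"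
    by metis
  \<comment> \<open>\<open>cluster_functional\<close> asks for a bound at every function, so the
    value 0 is taken where none is known.\<close>
  define I' where "I' j f = (if f \<in> gauss_decay then I j f else 0)" for j f
  have "\<bar>I' j f\<bar> \<le> (if f \<in> gauss_decay then B f else 0)" for j f
    using B by (simp add: I'_def)
  then obtain J U where U: "U \<noteq> bot" "U \<le> sequentially"
    and J': "\<And>f. ((\<lambda>j. I' j f) \<longlongrightarrow> J f) U"
    by (rule cluster_functional [of I']) (rule that)
  have J: "((\<lambda>j. I j f) \<longlongrightarrow> J f) U" if "f \<in> gauss_decay" for f
    using J' [of f] that by (simp add: I'_def)
  have evU: "eventually P U" if "eventually P sequentially" for P
    using that U(2) by (simp add: le_filter_def)
  have pfJ: "positive_functional J"
    unfolding positive_functional_def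
  proof (intro conjI ballI allI impI)
    fix f g :: "'n heis \<Rightarrow> real" and a :: real assume f: "f \<in> gauss_decay" 
    { assume g: "g \<in> gauss_decay"
      have "((\<lambda>j. I j f + I j g) \<longlongrightarrow> J (\<lambda>w. f w + g w)) U"
        using J [OF gauss_decay_add [OF f g]] by (simp only: pf_add [OF pf f g])
      moreover have "((\<lambda>j. I j f + I j g) \<longlongrightarrow> J f + J g) U"
        by (intro tendsto_add J f g)
      ultimately show "J (\<lambda>w. f w + g w) = J f + J g"
        by (rule tendsto_unique [OF U(1)]) }
    have "((\<lambda>j. a * I j f) \<longlongrightarrow> J (\<lambda>w. a * f w)) U"
      using J [OF gauss_decay_mult [OF f, of a]] by (simp only: pf_mult [OF pf f])
    moreover have "((\<lambda>j. a * I j f) \<longlongrightarrow> a * J f) U"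
      by (intro tendsto_mult_left J f)
    ultimately show "J (\<lambda>w. a * f w) = a * J f"
      by (rule tendsto_unique [OF U(1)])
    assume "\<forall>w. 0 \<le> f w"
    then show "0 \<le> J f"
      by (intro tendsto_lowerbound [OF J [OF f] always_eventually U(1)] allI pf_nonneg [OF pf f]) auto
  qed
  have J1: "J (gauss t 1) = c * t powr (- s / 4)" if t: "0 < t" for t
  proof -
    have "((\<lambda>j. I j (gauss t 1)) \<longlongrightarrow> c * t powr (- s / 4)) U"
    proof (rule tendstoI)
      fix e :: real assume "0 < e"
      then have "\<forall>\<^sub>F j in sequentially. \<forall>y\<in>S j. dist 1 y \<le> 0 \<longrightarrow>
          \<bar>I j (gauss t y) - c * t powr (- s / 4)\<bar> \<le> e / 2"
        using t by (intro gauss) auto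
      then have "\<forall>\<^sub>F j in sequentially. dist (I j (gauss t 1)) (c * t powr (- s / 4)) < e"
        by (rule eventually_mono) (use one \<open>0 < e\<close> in \<open>fastforce simp: dist_real_def\<close>)
      then show "\<forall>\<^sub>F j in U. dist (I j (gauss t 1)) (c * t powr (- s / 4)) < e"
        by (rule evU)
    qed
    then show ?thesis
      by (rule tendsto_unique [OF U(1) J [OF gauss_in_decay [OF t]]])
  qed
  \<comment> \<open>Otherwise \<open>null\<close> would keep the averages of the bump below half of
    their positive limit.\<close>
  have near: "\<forall>\<^sub>F j in U. S j \<inter> ball z e \<noteq> {}" if z: "z \<in> fsupport J" and e: "0 < e" for z e
  proof -
    have b: "bump z (e / 2) \<in> gauss_decay" using e by simp
    have pos: "0 < J (bump z (e / 2))"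
      by (rule fsupportD [OF z b]) simp_all
    have "\<forall>\<^sub>F j in U. J (bump z (e / 2)) / 2 < I j (bump z (e / 2))"
      using pos by (intro order_tendstoD(1) [OF J [OF b]]) simp
    moreover have "\<forall>\<^sub>F j in U. S j \<inter> ball z e = {} \<longrightarrow> I j (bump z (e / 2)) \<le> J (bump z (e / 2)) / 2"
      using pos e by (intro evU null) auto
    ultimately show ?thesis
      by eventually_elim force
  qed
  have Jz: "J (gauss t z) = c * t powr (- s / 4)" if z: "z \<in> fsupport J" and t: "0 < t" for z t
  proof -
    define R where "R = dist 1 z + 1"
    obtain C where C: "0 \<le> C" "\<And>x y w. dist 1 x \<le> R \<Longrightarrow> dist 1 y \<le> R \<Longrightarrow> dist x y \<le> 1 \<Longrightarrow>
      \<bar>gauss t x w - gauss t y w\<bar> \<le> C * dist x y * gauss (t / 16) (1::'n heis) w"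
      using gauss_close [OF t, of "1::'n heis" R] by blast
    define M where "M = c * (t / 16) powr (- s / 4) + 1"
    have M: "0 < M" using c t by (simp add: M_def add_nonneg_pos)
    have g: "gauss t x \<in> gauss_decay" "gauss (t / 16) x \<in> gauss_decay" for x :: "'n heis"
      using t by auto
    \<comment> \<open>A point y of \<open>S j\<close> within e of z has the right average up to e,
      and moving the centre from y to z costs at most \<open>C * e * M\<close>.\<close>
    have small: "\<bar>J (gauss t z) - c * t powr (- s / 4)\<bar> \<le> e * (2 + C * M)" if e: "0 < e" "e \<le> 1" for e
    proof -
      have "\<forall>\<^sub>F j in U. S j \<inter> ball z e \<noteq> {}"
        using near [OF z] e by simp
      moreover have "\<forall>\<^sub>F j in U. dist (I j (gauss t z)) (J (gauss t z)) < e"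
        by (rule tendstoD [OF J [OF g(1)] e(1)])
      moreover have "\<forall>\<^sub>F j in U. dist (I j (gauss (t / 16) 1)) (J (gauss (t / 16) 1)) < 1"
        using J [OF g(2)] by (rule tendstoD) simp
      moreover have "\<forall>\<^sub>F j in U. \<forall>y\<in>S j. dist 1 y \<le> R \<longrightarrow> \<bar>I j (gauss t y) - c * t powr (- s / 4)\<bar> \<le> e"
        using gauss [OF t e(1)] by (rule evU)
      ultimately have "\<forall>\<^sub>F j in U. \<bar>J (gauss t z) - c * t powr (- s / 4)\<bar> \<le> e * (2 + C * M)"
      proof eventually_elim
        case (elim j)
        then obtain y where "y \<in> S j \<inter> ball z e" by blast
        then have y: "y \<in> S j" "dist z y < e" by auto
        have dy: "dist 1 y \<le> R" "dist 1 z \<le> R" "dist z y \<le> 1"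
          using y e dist_triangle [of 1 y z] by (auto simp: R_def)
        have "\<bar>I j (\<lambda>w. gauss t z w - gauss t y w)\<bar> \<le> I j (\<lambda>w. C * dist z y * gauss (t / 16) 1 w)"
          by (rule pf_abs_le [OF pf gauss_decay_diff [OF g(1) g(1)] gauss_decay_mult [OF g(2)] C(2) [OF dy(2,1,3)]])
        then have "\<bar>I j (gauss t z) - I j (gauss t y)\<bar> \<le> C * dist z y * I j (gauss (t / 16) 1)"
          by (simp only: pf_diff [OF pf g(1) g(1)] pf_mult [OF pf g(2)])
        also have "\<dots> \<le> C * e * M"
        proof (intro mult_mono)
          show "I j (gauss (t / 16) 1) \<le> M"
            using elim(3) J1 [of "t / 16"] t by (simp add: M_def dist_real_def)
          show "0 \<le> I j (gauss (t / 16) 1)"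
            by (rule pf_nonneg [OF pf g(2)]) simp
        qed (use C y e in auto)
        finally have 1: "\<bar>I j (gauss t z) - I j (gauss t y)\<bar> \<le> C * e * M" .
        have 2: "\<bar>I j (gauss t y) - c * t powr (- s / 4)\<bar> \<le> e"
          using elim(4) y(1) dy(1) by blast
        have 3: "\<bar>I j (gauss t z) - J (gauss t z)\<bar> < e"
          using elim(2) by (simp add: dist_real_def)
        have "\<bar>J (gauss t z) - c * t powr (- s / 4)\<bar> \<le> C * e * M + e + e"
          using 1 2 3 by linarith
        then show ?case by (simp add: algebra_simps)
      qed
      then show ?thesis
        using eventually_happens' [OF U(1)] by blast
    qed
    have "\<bar>J (gauss t z) - c * t powr (- s / 4)\<bar> \<le> 0"
    proof (rule field_le_epsilon)
      fix q :: real assume q: "0 < q"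
      define e where "e = min 1 (q / (2 + C * M))"
      have p: "0 < 2 + C * M" using C M by (simp add: add_pos_nonneg)
      then have e: "0 < e" "e \<le> 1" "e * (2 + C * M) \<le> q"
        using q mult_right_mono [of e "q / (2 + C * M)" "2 + C * M"] by (auto simp: e_def)
      show "\<bar>J (gauss t z) - c * t powr (- s / 4)\<bar> \<le> 0 + q"
        using small [OF e(1,2)] e(3) by simp
    qed
    then show ?thesis by simp
  qed
  show ?thesis
  proof
    show "uniform_functional s c J"
      unfolding uniform_functional_def using c pfJ Jz fsupportI_gauss [OF pfJ c J1] by blast
    show "\<exists>\<^sub>F j in sequentially. S j \<inter> ball z e \<noteq> {}" if "z \<in> fsupport J" "0 < e" for z e
      \<comment> \<open>Eventually along the finer filter \<open>U\<close> gives only frequently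
        along the sequence itself.\<close>
      using near [OF that] U by (meson eventually_frequently frequently_def filter_leD le_filter_def)
  qed
qed

text \<open>The push-forward under the zoom by 1 / r that moves x to the identity, normalised by
  \<open>r powr s\<close>, the order of the mass of a ball of radius r.\<close>

definition blowup :: "real \<Rightarrow> 'n::finite heis \<Rightarrow> real \<Rightarrow> (('n heis \<Rightarrow> real) \<Rightarrow> real) \<Rightarrow> ('n heis \<Rightarrow> real) \<Rightarrow> real"
  where "blowup s x r I f = r powr (- s) * I (\<lambda>w. f (dil (1 / r) (inverse x * w)))"

lemma positive_functional_blowup:
  assumes I: "positive_functional I" and r: "0 < r"
  shows "positive_functional (blowup s x r I)"
  unfolding positive_functional_def blowup_def
proof (intro conjI ballI allI impI)
  note bl = gauss_decay_blowup [OF _ r, where x = x]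
  fix f g :: "'a heis \<Rightarrow> real" and a :: real assume f: "f \<in> gauss_decay"
  { assume g: "g \<in> gauss_decay"
    show "r powr (- s) * I (\<lambda>w. f (dil (1 / r) (inverse x * w)) + g (dil (1 / r) (inverse x * w))) =
      r powr (- s) * I (\<lambda>w. f (dil (1 / r) (inverse x * w))) +
      r powr (- s) * I (\<lambda>w. g (dil (1 / r) (inverse x * w)))"
      by (simp only: pf_add [OF I bl [OF f] bl [OF g]] distrib_left) }
  show "r powr (- s) * I (\<lambda>w. a * f (dil (1 / r) (inverse x * w))) =
      a * (r powr (- s) * I (\<lambda>w. f (dil (1 / r) (inverse x * w))))"
    by (simp only: pf_mult [OF I bl [OF f]] mult.left_commute)
  assume "\<forall>w. 0 \<le> f w"
  then show "0 \<le> r powr (- s) * I (\<lambda>w. f (dil (1 / r) (inverse x * w)))"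
    using pf_nonneg [OF I bl [OF f]] by simp
qed

lemma blowup_gauss:
  assumes "0 < r"
  shows "blowup s x r I (gauss t y) = r powr (- s) * I (gauss (t / r ^ 4) (x * dil r y))"
proof -
  have "(\<lambda>w. gauss t y (dil (1 / r) (inverse x * w))) = gauss (t / r ^ 4) (x * dil r y)"
    unfolding gauss_def dist_dil_inverse [OF assms] by (simp add: power_divide)
  then show ?thesis by (simp add: blowup_def)
qed

text \<open>With p = s the factor in r disappears, so blow-ups keep the law; with p = s + 1 a factor
  r remains, which makes an error term vanish in the blow-up of a measure.\<close>

lemma powr_rescale:
  assumes t: "0 < t" and r: "0 < (r::real)"
  shows "r powr (- s) * (t / r ^ 4) powr (- p / 4) = t powr (- p / 4) * r powr (p - s)"
proof -
  have "(t / r ^ 4) powr (- p / 4) = t powr (- p / 4) / (r powr 4) powr (- p / 4)"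
    using r t by (simp add: powr_divide flip: powr_numeral)
  also have "(r powr 4) powr (- p / 4) = r powr (- p)"
    by (simp add: powr_powr)
  finally show ?thesis
    using r by (simp add: powr_diff powr_minus field_simps)
qed

text \<open>By scale invariance the law holds exactly on the rescaled support, and a blow-up gives
  the value 0 to bumps away from it, so \<open>limit_functional\<close> applies without any
  error.\<close>

lemma tangent_functional:
  fixes I :: "('n::finite heis \<Rightarrow> real) \<Rightarrow> real" and r :: "nat \<Rightarrow> real"
  assumes I: "uniform_functional s c I" and x: "x \<in> fsupport I" and r: "\<And>j. 0 < r j"
  obtains J where "uniform_functional s c J"
    "\<And>z e. z \<in> fsupport J \<Longrightarrow> 0 < e \<Longrightarrow> \<exists>\<^sub>F j in sequentially. \<exists>y. x * dil (r j) y \<in> fsupport I \<and> dist z y < e"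
proof -
  define T where "T j = blowup s x (r j) I" for j
  define S where "S j = {y. x * dil (r j) y \<in> fsupport I}" for j
  note pfI = uf_pf [OF I] and c = uf_pos [OF I] and unif = uf_gauss [OF I]
  note bl = gauss_decay_blowup [OF _ r]
  have pf: "positive_functional (T j)" for j
    unfolding T_def by (rule positive_functional_blowup [OF pfI r])
  have Tg: "T j (gauss t y) = c * t powr (- s / 4)" if "y \<in> S j" "0 < t" for j t y
  proof -
    have "T j (gauss t y) = c * (r j powr (- s) * (t / r j ^ 4) powr (- s / 4))"
      using that r [of j] by (simp add: T_def blowup_gauss S_def unif)
    then show ?thesis
      using powr_rescale [OF that(2) r, of j s s] r [of j] by simp
  qed
  obtain J where J: "uniform_functional s c J"
    "\<And>z e. z \<in> fsupport J \<Longrightarrow> 0 < e \<Longrightarrow> \<exists>\<^sub>F j in sequentially. S j \<inter> ball z e \<noteq> {}"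
  proof (rule limit_functional [OF c pf])
    show "1 \<in> S j" for j
      using x by (simp add: S_def)
    show "\<forall>\<^sub>F j in sequentially. \<forall>y\<in>S j. dist 1 y \<le> R \<longrightarrow> \<bar>T j (gauss t y) - c * t powr (- s / 4)\<bar> \<le> e"
      if "0 < t" "0 < e" for t R e
      using Tg that by simp
    show "\<forall>\<^sub>F j in sequentially. S j \<inter> ball z e = {} \<longrightarrow> T j (bump z (e / 2)) \<le> q"
      if e: "0 < e" and q: "0 < q" for z e q
    proof (rule always_eventually, intro allI impI)
      fix j assume S: "S j \<inter> ball z e = {}"
      define K where "K = cball (x * dil (r j) z) (r j * (e / 2))"
      have d: "dist z (dil (1 / r j) (inverse x * w)) = dist (x * dil (r j) z) w / r j" for w
        by (rule dist_dil_inverse [OF r])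
      have "I (\<lambda>w. bump z (e / 2) (dil (1 / r j) (inverse x * w))) = 0"
      proof (rule pf_zero_off_support [OF pfI bl])
        show "compact K" by (simp add: K_def compact_cball_heis)
        show "K \<inter> fsupport I = {}"
        proof (rule ccontr)
          assume "K \<inter> fsupport I \<noteq> {}"
          then obtain w where w: "w \<in> K" "w \<in> fsupport I" by auto
          have "dil (1 / r j) (inverse x * w) \<in> S j"
            using w r [of j] by (simp add: S_def)
          moreover have "dist z (dil (1 / r j) (inverse x * w)) \<le> e / 2"
            using w r [of j] unfolding d K_def pos_divide_le_eq [OF r] by (simp add: mult.commute)
          then have "dist z (dil (1 / r j) (inverse x * w)) < e"
            using e by linarith
          ultimately show False using S by auto
        qed
        show "bump z (e / 2) (dil (1 / r j) (inverse x * w)) = 0" if "w \<notin> K" for w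
        proof (rule bump_outside)
          show "e / 2 \<le> dist z (dil (1 / r j) (inverse x * w))"
            using that unfolding d K_def pos_le_divide_eq [OF r] by (simp add: mult.commute)
        qed (use e in simp)
      qed (use e in auto)
      then show "T j (bump z (e / 2)) \<le> q"
        using q by (simp add: T_def blowup_def)
    qed
  qed blast
  show ?thesis
  proof
    show "uniform_functional s c J" by fact
    show "\<exists>\<^sub>F j in sequentially. \<exists>y. x * dil (r j) y \<in> fsupport I \<and> dist z y < e"
      if "z \<in> fsupport J" "0 < e" for z e
      using J(2) [OF that] by (rule frequently_elim1) (auto simp: S_def)
  qed
qed

section \<open>Power series along dilations\<close>

text \<open>The bound on \<open>a\<close> means radius of convergence at least 2, so on [0, 1] the
  tail is dominated by a geometric series of ratio 1 / 2.\<close>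

lemma series_remainder:
  fixes a :: "nat \<Rightarrow> real"
  assumes a: "\<And>k. \<bar>a k\<bar> \<le> C / 2 ^ k" and l: "0 \<le> l" "l \<le> 1" and G: "(\<lambda>k. a k * l ^ k) sums G"
  shows "\<bar>G - (\<Sum>j\<le>k. a j * l ^ j)\<bar> \<le> C * l ^ Suc k / 2 ^ k"
proof -
  have C: "0 \<le> C" using a [of 0] by simp
  have 1: "(\<lambda>i. a (i + Suc k) * l ^ (i + Suc k)) sums (G - (\<Sum>j<Suc k. a j * l ^ j))"
    using sums_split_initial_segment [OF G] .
  have 2: "(\<lambda>i. C * l ^ Suc k / 2 ^ Suc k * (1 / 2) ^ i) sums (C * l ^ Suc k / 2 ^ Suc k * (1 / (1 - 1 / 2)))"
    by (intro sums_mult geometric_sums) simp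
  have "\<bar>a (i + Suc k) * l ^ (i + Suc k)\<bar> \<le> C * l ^ Suc k / 2 ^ Suc k * (1 / 2) ^ i" for i
  proof -
    have "\<bar>a (i + Suc k) * l ^ (i + Suc k)\<bar> = \<bar>a (i + Suc k)\<bar> * l ^ (i + Suc k)"
      using l by (simp add: abs_mult)
    also have "\<dots> \<le> C / 2 ^ (i + Suc k) * l ^ Suc k"
      using a [of "i + Suc k"] l C power_decreasing [of "Suc k" "i + Suc k" l] by (intro mult_mono) auto
    finally show ?thesis
      by (simp add: power_add power_divide mult_ac)
  qed
  then have "norm (G - (\<Sum>j<Suc k. a j * l ^ j)) \<le> C * l ^ Suc k / 2 ^ Suc k * (1 / (1 - 1 / 2))"
    by (intro norm_sums_le [OF 1 2]) simp
  then show ?thesis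
    by (simp add: lessThan_Suc_atMost)
qed

text \<open>Induction on k. The lower coefficients converge already, and after division by
  \<open>l ^ k\<close> the tail is of order l uniformly in i. So a small l is fixed first, and the
  convergence at this single l is used afterwards.\<close>

lemma series_coeff_tendsto:
  fixes a :: "'i \<Rightarrow> nat \<Rightarrow> real" and b :: "nat \<Rightarrow> real"
  assumes a: "\<And>i k. \<bar>a i k\<bar> \<le> C / 2 ^ k" and b: "\<And>k. \<bar>b k\<bar> \<le> C / 2 ^ k"
    and g: "\<And>i l. 0 < l \<Longrightarrow> l \<le> 1 \<Longrightarrow> (\<lambda>k. a i k * l ^ k) sums g i l"
    and h: "\<And>l. 0 < l \<Longrightarrow> l \<le> 1 \<Longrightarrow> (\<lambda>k. b k * l ^ k) sums h l"
    and lim: "\<And>l. 0 < l \<Longrightarrow> l \<le> 1 \<Longrightarrow> ((\<lambda>i. g i l) \<longlongrightarrow> h l) F"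
  shows "((\<lambda>i. a i k) \<longlongrightarrow> b k) F"
proof (induction k rule: less_induct)
  case (less k)
  have C: "0 \<le> C" using b [of 0] by simp
  show ?case
  proof (rule tendstoI)
    fix e :: real assume e: "0 < e"
    \<comment> \<open>The two tails cost \<open>2 * C * l\<close> times \<open>l ^ k\<close>; this l
      keeps the cost within half of the tolerance, and the summand 4 covers C = 0.\<close>
    define l where "l = min 1 (e / (4 * C + 4))"
    have l: "0 < l" "l \<le> 1" "2 * C * l \<le> e / 2"
    proof -
      show "0 < l" "l \<le> 1" using e C by (auto simp: l_def)
      have "2 * C * l \<le> 2 * C * (e / (4 * C + 4))"
        using C by (intro mult_left_mono) (auto simp: l_def)
      also have "\<dots> \<le> e / 2"
        using C e by (simp add: field_simps)
      finally show "2 * C * l \<le> e / 2" .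
    qed
    define d where "d i = \<bar>g i l - h l\<bar> + (\<Sum>j<k. \<bar>a i j - b j\<bar> * l ^ j)" for i
    have "(d \<longlongrightarrow> \<bar>h l - h l\<bar> + (\<Sum>j<k. \<bar>b j - b j\<bar> * l ^ j)) F"
      unfolding d_def using l by (intro tendsto_intros lim less) auto
    then have "\<forall>\<^sub>F i in F. d i < e / 2 * l ^ k"
      by (rule order_tendstoD(2)) (use e l in simp)
    then show "\<forall>\<^sub>F i in F. dist (a i k) (b k) < e"
    proof eventually_elim
      case (elim i)
      have 1: "\<bar>g i l - (\<Sum>j\<le>k. a i j * l ^ j)\<bar> \<le> C * l ^ Suc k"
        using series_remainder [OF a _ _ g, of l i k] l C
        by (auto intro: order_trans [OF _ divide_left_mono [of 1 "2 ^ k" "C * l ^ Suc k"], simplified])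
      have 2: "\<bar>h l - (\<Sum>j\<le>k. b j * l ^ j)\<bar> \<le> C * l ^ Suc k"
        using series_remainder [OF b _ _ h, of l k] l C
        by (auto intro: order_trans [OF _ divide_left_mono [of 1 "2 ^ k" "C * l ^ Suc k"], simplified])
      have s: "(\<Sum>j\<le>k. a i j * l ^ j) - (\<Sum>j\<le>k. b j * l ^ j) =
          (\<Sum>j<k. (a i j - b j) * l ^ j) + (a i k - b k) * l ^ k"
        by (simp add: lessThan_Suc_atMost [symmetric] sum_subtractf left_diff_distrib)
      have 3: "\<bar>\<Sum>j<k. (a i j - b j) * l ^ j\<bar> \<le> (\<Sum>j<k. \<bar>a i j - b j\<bar> * l ^ j)"
        using l by (intro order_trans [OF sum_abs]) (simp add: abs_mult)
      have "\<bar>(a i k - b k) * l ^ k\<bar> \<le> d i + 2 * (C * l ^ Suc k)"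
        using 1 2 s 3 unfolding d_def by linarith
      also have "\<dots> < e / 2 * l ^ k + (2 * C * l) * l ^ k"
        using elim by simp
      also have "\<dots> \<le> e / 2 * l ^ k + e / 2 * l ^ k"
        using l by (intro add_left_mono mult_right_mono) auto
      finally have "\<bar>a i k - b k\<bar> * l ^ k < e * l ^ k"
        using l by (simp add: abs_mult)
      then show ?case
        using l by (simp add: dist_real_def)
    qed
  qed
qed

text \<open>From 2ab \<ge> - (a^2 / 2 + 2 b^2): a real number keeps half of its square under a
  complex perturbation, up to the squared size of the latter. This is what keeps the complexified
  Gaussian small.\<close>

lemma Re_square_add_ge: "a\<^sup>2 / 2 - 3 * (cmod z)\<^sup>2 \<le> Re ((of_real a + z)\<^sup>2)"
proof -
  have "Re ((of_real a + z)\<^sup>2) = a\<^sup>2 + 2 * a * Re z + Re (z\<^sup>2)"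
    by (simp add: power2_eq_square algebra_simps)
  moreover have "- (cmod z)\<^sup>2 \<le> Re (z\<^sup>2)"
    using abs_Re_le_cmod [of "z\<^sup>2"] by (simp add: norm_power)
  moreover have "- (a\<^sup>2 / 2 + 2 * (Re z)\<^sup>2) \<le> 2 * a * Re z"
    using zero_le_power2 [of "a + 2 * Re z"] by (simp add: power2_eq_square algebra_simps)
  moreover have "(Re z)\<^sup>2 \<le> (cmod z)\<^sup>2"
    by (simp add: cmod_power2)
  ultimately show ?thesis by linarith
qed

text \<open>The exponent is a sum of squares of two real quadratic polynomials in l, so the Gaussian
  extends to an entire function of l. Cauchy's inequality on the circle of radius 2 yields the
  factor \<open>2 ^ k\<close>; the Gaussian factor in w is kept so that the coefficients are
  themselves test functions.\<close>

lemma gauss_line_expansion: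
  fixes t R :: real
  assumes t: "0 < t"
  obtains C where "0 \<le> C" "\<And>x y w :: 'n::finite heis. dist 1 x \<le> R \<Longrightarrow> dist 1 y \<le> R \<Longrightarrow>
    \<exists>c. (\<forall>k. \<bar>c k\<bar> \<le> C * gauss (t / 32) 1 w / 2 ^ k) \<and>
      (\<forall>l\<in>{0..1}. (\<lambda>k. c k * l ^ k) sums gauss t (x * dil l y) w)"
proof
  define M where "M = exp (t * ((192 * R\<^sup>2)\<^sup>2 + 192 * R ^ 4))"
  define C where "C = M * exp (t / 4 * R ^ 4)"
  show "0 \<le> C" by (simp add: C_def M_def)
  fix x y w :: "'n heis" assume R: "dist 1 x \<le> R" "dist 1 y \<le> R"
  define u where "u = horiz w - horiz x"
  define d where "d = dist x w"
  \<comment> \<open>Coefficients in l of the squared horizontal displacement, and then of the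
    twisted vertical displacement, from \<open>x * dil l y\<close> to w.\<close>
  define a1 b1 g1 where "a1 = (norm u)\<^sup>2" and "b1 = - 2 * (u \<bullet> horiz y)" and "g1 = (norm (horiz y))\<^sup>2"
  define a2 b2 g2 where "a2 = vert w - vert x - heis_form (horiz x) (horiz w)"
    and "b2 = - heis_form (horiz y) u" and "g2 = - vert y"
  define q where "q a b g z = of_real a + (of_real b * z + of_real g * z\<^sup>2)" for a b g :: real and z :: complex
  define h where "h z = exp (- of_real t * ((q a1 b1 g1 z)\<^sup>2 + (q a2 b2 g2 z)\<^sup>2))" for z
  define B where "B = C * gauss (t / 32) 1 w"
  have hol: "h holomorphic_on S" for S
    unfolding h_def q_def by (intro holomorphic_intros)
  have d4: "d ^ 4 = a1\<^sup>2 + a2\<^sup>2"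
    by (simp add: d_def dist_pow4 a1_def a2_def u_def)
  have u: "norm u \<le> d"
    using norm_horiz_le [of w x] by (simp add: u_def d_def)
  have d0: "0 \<le> d" by (simp add: d_def)
  have hy: "norm (horiz y) \<le> R"
    using norm_horiz_le [of y 1] R by simp
  have vy: "\<bar>vert y\<bar> \<le> R\<^sup>2"
    using vert_diff_le [of y 1] power_mono [OF R(2), of 2] by simp
  have uy: "norm u * norm (horiz y) \<le> d * R"
    using u hy d0 by (intro mult_mono) auto
  have b1: "\<bar>b1\<bar> \<le> 2 * (d * R)" and b2: "\<bar>b2\<bar> \<le> 2 * (d * R)"
    using Cauchy_Schwarz_ineq2 [of u "horiz y"] heis_form_bound [of "horiz y" u] uy
    by (simp_all add: b1_def b2_def mult_ac)
  have g1: "\<bar>g1\<bar> \<le> R\<^sup>2" and g2: "\<bar>g2\<bar> \<le> R\<^sup>2"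
    using hy vy by (simp_all add: g1_def g2_def power_mono)
  have bound: "cmod (h z) \<le> B" if z: "cmod z = 2" for z
  proof -
    have "(cmod (of_real b * z + of_real g * z\<^sup>2))\<^sup>2 \<le> 32 * R\<^sup>2 * d\<^sup>2 + 32 * R ^ 4"
      if "\<bar>b\<bar> \<le> 2 * (d * R)" "\<bar>g\<bar> \<le> R\<^sup>2" for b g
    proof -
      have "cmod (of_real b * z + of_real g * z\<^sup>2) \<le> \<bar>b\<bar> * 2 + \<bar>g\<bar> * 4"
        using norm_triangle_ineq [of "of_real b * z" "of_real g * z\<^sup>2"] z
        by (simp add: norm_mult norm_power)
      also have "\<dots> \<le> 4 * (d * R + R\<^sup>2)"
        using that by simp
      finally have "(cmod (of_real b * z + of_real g * z\<^sup>2))\<^sup>2 \<le> (4 * (d * R + R\<^sup>2))\<^sup>2"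
        by (rule power_mono) simp
      also have "\<dots> \<le> 32 * R\<^sup>2 * d\<^sup>2 + 32 * R ^ 4"
        using zero_le_power2 [of "d * R - R\<^sup>2"]
        by (simp add: power2_eq_square power4_eq_xxxx algebra_simps)
      finally show ?thesis .
    qed
    then have z1: "(cmod (of_real b1 * z + of_real g1 * z\<^sup>2))\<^sup>2 \<le> 32 * R\<^sup>2 * d\<^sup>2 + 32 * R ^ 4"
      and z2: "(cmod (of_real b2 * z + of_real g2 * z\<^sup>2))\<^sup>2 \<le> 32 * R\<^sup>2 * d\<^sup>2 + 32 * R ^ 4"
      using b1 b2 g1 g2 by blast+
    \<comment> \<open>Two perturbations at the cost 3 * 32 each make 192. Of the surviving half of
      \<open>d ^ 4 = a1\<^sup>2 + a2\<^sup>2\<close>, one half pays for the term in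
      \<open>d\<^sup>2\<close>.\<close>
    have "192 * R\<^sup>2 * d\<^sup>2 \<le> d ^ 4 / 4 + (192 * R\<^sup>2)\<^sup>2"
      using zero_le_power2 [of "d\<^sup>2 / 2 - 192 * R\<^sup>2"]
      by (simp add: power2_eq_square power4_eq_xxxx algebra_simps)
    then have "d ^ 4 / 4 - ((192 * R\<^sup>2)\<^sup>2 + 192 * R ^ 4) \<le>
        Re ((q a1 b1 g1 z)\<^sup>2) + Re ((q a2 b2 g2 z)\<^sup>2)"
      using Re_square_add_ge [of a1 "of_real b1 * z + of_real g1 * z\<^sup>2"]
        Re_square_add_ge [of a2 "of_real b2 * z + of_real g2 * z\<^sup>2"] z1 z2 d4
      unfolding q_def by linarith
    then have "- t * (Re ((q a1 b1 g1 z)\<^sup>2) + Re ((q a2 b2 g2 z)\<^sup>2)) \<le>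
        - t * (d ^ 4 / 4 - ((192 * R\<^sup>2)\<^sup>2 + 192 * R ^ 4))"
      using t by (intro mult_left_mono_neg) auto
    then have "cmod (h z) \<le> M * gauss (t / 4) x w"
      by (simp add: h_def M_def gauss_def d_def algebra_simps flip: exp_add)
    also have "\<dots> \<le> M * (exp (t / 4 * R ^ 4) * gauss (t / 32) 1 w)"
      using gauss_recenter [of "t / 4" 1 x R w] R t by (intro mult_left_mono) (auto simp: M_def)
    finally show ?thesis by (simp add: B_def C_def mult_ac)
  qed
  define c where "c k = Re ((deriv ^^ k) h 0 / fact k)" for k
  have "\<bar>c k\<bar> \<le> B / 2 ^ k" for k
  proof -
    have "cmod ((deriv ^^ k) h 0) \<le> fact k * B / 2 ^ k"
      by (rule Cauchy_inequality) (use hol holomorphic_on_imp_continuous_on bound in auto)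
    then have "cmod ((deriv ^^ k) h 0 / fact k) \<le> B / 2 ^ k"
      by (simp add: norm_divide field_simps)
    then show ?thesis
      using abs_Re_le_cmod order_trans unfolding c_def by blast
  qed
  moreover have "(\<lambda>k. c k * l ^ k) sums gauss t (x * dil l y) w" if l: "l \<in> {0..1}" for l
  proof -
    have "(\<lambda>k. (deriv ^^ k) h 0 / fact k * (of_real l - 0) ^ k) sums h (of_real l)"
      by (rule holomorphic_power_series [of h 0 2]) (use hol l in auto)
    then have "(\<lambda>k. Re ((deriv ^^ k) h 0 / fact k * (of_real l - 0) ^ k)) sums Re (h (of_real l))"
      by (rule sums_Re)
    moreover have "Re ((deriv ^^ k) h 0 / fact k * (of_real l - 0) ^ k) = c k * l ^ k" for k
    proof -
      have "Re (z * of_real r) = Re z * r" for z r by simp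
      then show ?thesis
        by (simp only: diff_zero of_real_power [symmetric] c_def)
    qed
    moreover have "Re (h (of_real l)) = gauss t (x * dil l y) w"
    proof -
      have "horiz w - horiz (x * dil l y) = u - l *\<^sub>R horiz y"
        by (simp add: u_def)
      then have 1: "(norm (horiz w - horiz (x * dil l y)))\<^sup>2 = a1 + (b1 * l + g1 * l\<^sup>2)"
        by (simp only: power2_norm_eq_inner a1_def b1_def g1_def)
          (simp add: inner_diff_left inner_diff_right inner_commute power2_eq_square algebra_simps)
      have 2: "vert w - vert (x * dil l y) - heis_form (horiz (x * dil l y)) (horiz w) = a2 + (b2 * l + g2 * l\<^sup>2)"
        using heis_form_swap [of "horiz x" "horiz y"]
        by (simp add: a2_def b2_def g2_def u_def heis_form_add_left heis_form_scale_left heis_form_scale_right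
            heis_form_diff_right algebra_simps)
      have "norm (horiz w - horiz (x * dil l y)) ^ 4 = ((norm (horiz w - horiz (x * dil l y)))\<^sup>2)\<^sup>2"
        by simp
      also have "\<dots> = (a1 + (b1 * l + g1 * l\<^sup>2))\<^sup>2"
        unfolding 1 ..
      finally have n4: "norm (horiz w - horiz (x * dil l y)) ^ 4 = (a1 + (b1 * l + g1 * l\<^sup>2))\<^sup>2" .
      have "dist (x * dil l y) w ^ 4 = (a1 + (b1 * l + g1 * l\<^sup>2))\<^sup>2 + (a2 + (b2 * l + g2 * l\<^sup>2))\<^sup>2"
        unfolding dist_pow4 2 n4 ..
      moreover have "h (of_real l) = of_real (exp (- t * ((a1 + (b1 * l + g1 * l\<^sup>2))\<^sup>2 + (a2 + (b2 * l + g2 * l\<^sup>2))\<^sup>2)))"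
        unfolding h_def q_def exp_of_real [symmetric] by simp
      ultimately show ?thesis
        by (simp add: gauss_def)
    qed
    ultimately show ?thesis by simp
  qed
  ultimately show "\<exists>c. (\<forall>k. \<bar>c k\<bar> \<le> C * gauss (t / 32) 1 w / 2 ^ k) \<and>
      (\<forall>l\<in>{0..1}. (\<lambda>k. c k * l ^ k) sums gauss t (x * dil l y) w)"
    unfolding B_def by blast
qed

text \<open>Taylor expansion along the curves \<open>l \<mapsto> x * dil l y\<close>, with radius of
  convergence at least 2 and a bound uniform for x and y in a ball. Only these curves matter, so
  analyticity in several variables is not involved.\<close>

definition line_analytic :: "('n::finite heis \<Rightarrow> real) \<Rightarrow> bool" where
  "line_analytic F \<longleftrightarrow> (\<forall>R. \<exists>C. \<forall>x y. dist 1 x \<le> R \<longrightarrow> dist 1 y \<le> R \<longrightarrow>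
     (\<exists>a. (\<forall>k. \<bar>a k\<bar> \<le> C / 2 ^ k) \<and> (\<forall>l\<in>{0..1}. (\<lambda>k. a k * l ^ k) sums F (x * dil l y))))"

text \<open>The functional is applied to the expansion of the Gaussian term by term: the remainder
  is at most \<open>C / 2 ^ k\<close> times a fixed Gaussian, so positivity alone controls the limit
  of the partial sums. The constant b only changes the coefficient of order 0.\<close>

lemma line_analytic_functional:
  assumes I: "positive_functional I" and t: "0 < t"
  shows "line_analytic (\<lambda>x. I (gauss t x) - b)"
  unfolding line_analytic_def
proof
  fix R :: real
  obtain C where C: "0 \<le> C" "\<And>x y w :: 'a heis. dist 1 x \<le> R \<Longrightarrow> dist 1 y \<le> R \<Longrightarrow>
    \<exists>c. (\<forall>k. \<bar>c k\<bar> \<le> C * gauss (t / 32) 1 w / 2 ^ k) \<and>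
      (\<forall>l\<in>{0..1}. (\<lambda>k. c k * l ^ k) sums gauss t (x * dil l y) w)"
    by (rule gauss_line_expansion [OF t, of R]) (rule that)
  define A where "A = I (gauss (t / 32) 1)"
  have g: "gauss t x \<in> gauss_decay" "gauss (t / 32) x \<in> gauss_decay" for x :: "'a heis"
    using t by auto
  have A: "0 \<le> A" unfolding A_def by (rule pf_nonneg [OF I g(2)]) simp
  show "\<exists>C. \<forall>x y. dist 1 x \<le> R \<longrightarrow> dist 1 y \<le> R \<longrightarrow>
     (\<exists>a. (\<forall>k. \<bar>a k\<bar> \<le> C / 2 ^ k) \<and> (\<forall>l\<in>{0..1}. (\<lambda>k. a k * l ^ k) sums (I (gauss t (x * dil l y)) - b)))"
  proof (intro exI [of _ "C * A + \<bar>b\<bar>"] allI impI)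
    fix x y :: "'a heis" assume R: "dist 1 x \<le> R" "dist 1 y \<le> R"
    from choice [OF allI [OF C(2) [OF R]]] obtain c where
      c': "\<forall>w. (\<forall>k. \<bar>c w k\<bar> \<le> C * gauss (t / 32) 1 w / 2 ^ k) \<and>
        (\<forall>l\<in>{0..1}. (\<lambda>k. c w k * l ^ k) sums gauss t (x * dil l y) w)" ..
    have c: "\<bar>c w k\<bar> \<le> C * gauss (t / 32) 1 w / 2 ^ k"
      "l \<in> {0..1} \<Longrightarrow> (\<lambda>k. c w k * l ^ k) sums gauss t (x * dil l y) w" for w k l
      using c' by blast+
    have c1: "\<bar>c w k\<bar> \<le> C / 2 ^ k" for w k
      using order_trans [OF c(1) divide_right_mono [OF mult_left_mono [OF gauss_le_1 C(1)]]] t by simp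
    \<comment> \<open>\<open>c\<close> was obtained by choice, yet it is continuous in w, because
      convergence of the Gaussians forces convergence of their coefficients.\<close>
    have cd: "(\<lambda>w. c w k) \<in> gauss_decay" for k
    proof (rule gauss_decayI)
      show "continuous_on UNIV (\<lambda>w. c w k)"
        unfolding continuous_on_def
      proof (intro ballI series_coeff_tendsto)
        fix w l assume l: "0 < l" "l \<le> (1::real)"
        show "((\<lambda>w. gauss t (x * dil l y) w) \<longlongrightarrow> gauss t (x * dil l y) w) (at w)"
          using continuous_on_gauss [of UNIV t "x * dil l y"] by (simp add: continuous_on_def)
        show "(\<lambda>k. c v k * l ^ k) sums gauss t (x * dil l y) v" for v
          by (rule c(2)) (use l in auto)
      qed (rule c1 c(2); simp)+
      show "\<bar>c w k\<bar> \<le> (C / 2 ^ k) * gauss (t / 32) 1 w" for w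
        using c(1) [of w k] by simp
    qed (use t in simp)
    have ab: "\<bar>I (\<lambda>w. c w k)\<bar> \<le> C * A / 2 ^ k" for k
    proof -
      have "\<bar>I (\<lambda>w. c w k)\<bar> \<le> I (\<lambda>w. C / 2 ^ k * gauss (t / 32) 1 w)"
        using c(1) [of _ k] by (intro pf_abs_le [OF I cd gauss_decay_mult [OF g(2)]]) simp
      then show ?thesis
        unfolding pf_mult [OF I g(2)] by (simp add: A_def)
    qed
    have sums: "(\<lambda>k. I (\<lambda>w. c w k) * l ^ k) sums I (gauss t (x * dil l y))" if l: "l \<in> {0..1}" for l
      unfolding sums_def_le
    proof (rule LIM_zero_cancel, rule Lim_null_comparison [OF always_eventually], intro allI)
      fix k
      define p where "p = x * dil l y"
      have cm: "(\<lambda>w. l ^ j * c w j) \<in> gauss_decay" for j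
        by (rule gauss_decay_mult [OF cd])
      have cs: "(\<lambda>w. \<Sum>j\<le>k. l ^ j * c w j) \<in> gauss_decay"
        by (rule gauss_decay_sum [OF cm])
      have "I (\<lambda>w. \<Sum>j\<le>k. l ^ j * c w j) = (\<Sum>j\<le>k. I (\<lambda>w. c w j) * l ^ j)"
        by (simp only: pf_sum [OF I finite_atMost cm] pf_mult [OF I cd] mult.commute)
      then have "(\<Sum>j\<le>k. I (\<lambda>w. c w j) * l ^ j) - I (gauss t p) =
          I (\<lambda>w. (\<Sum>j\<le>k. l ^ j * c w j) - gauss t p w)"
        by (simp only: pf_diff [OF I cs g(1)])
      also have "\<bar>\<dots>\<bar> \<le> I (\<lambda>w. C / 2 ^ k * gauss (t / 32) 1 w)"
      proof (rule pf_abs_le [OF I gauss_decay_diff [OF cs g(1)] gauss_decay_mult [OF g(2)]])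
        fix w
        have "\<bar>gauss t p w - (\<Sum>j\<le>k. c w j * l ^ j)\<bar> \<le> C * gauss (t / 32) 1 w * l ^ Suc k / 2 ^ k"
          using l by (intro series_remainder c) (auto simp: p_def intro!: c)
        also have "\<dots> \<le> C * gauss (t / 32) 1 w * 1 / 2 ^ k"
          using l C(1) by (intro divide_right_mono mult_left_mono power_le_one) auto
        finally show "\<bar>(\<Sum>j\<le>k. l ^ j * c w j) - gauss t p w\<bar> \<le> C / 2 ^ k * gauss (t / 32) 1 w"
          by (simp add: mult.commute abs_minus_commute)
      qed
      also have "\<dots> = C * A / 2 ^ k"
        unfolding pf_mult [OF I g(2)] by (simp add: A_def)
      finally show "norm ((\<Sum>j\<le>k. I (\<lambda>w. c w j) * l ^ j) - I (gauss t (x * dil l y))) \<le> C * A * (1 / 2) ^ k"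
        by (simp add: p_def power_divide)
    next
      show "(\<lambda>k. C * A * (1 / 2) ^ k) \<longlonglongrightarrow> 0"
        by (intro tendsto_mult_right_zero LIMSEQ_power_zero) simp
    qed
    define a where "a k = I (\<lambda>w. c w k) - (if k = 0 then b else 0)" for k
    have "\<bar>a k\<bar> \<le> (C * A + \<bar>b\<bar>) / 2 ^ k" for k
      using ab [of k] A C(1) by (cases "k = 0") (auto simp: a_def add_divide_distrib intro: order_trans)
    moreover have "(\<lambda>k. a k * l ^ k) sums (I (gauss t (x * dil l y)) - b)" if l: "l \<in> {0..1}" for l
    proof -
      have "(\<lambda>k. if k = 0 then b else 0) sums b"
        using sums_single [of 0 "\<lambda>_. b"] by simp
      from sums_diff [OF sums [OF l] this] show ?thesis
        by (rule sums_cong [THEN iffD1, rotated]) (simp add: a_def left_diff_distrib)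
    qed
    ultimately show "\<exists>a. (\<forall>k. \<bar>a k\<bar> \<le> (C * A + \<bar>b\<bar>) / 2 ^ k) \<and>
        (\<forall>l\<in>{0..1}. (\<lambda>k. a k * l ^ k) sums (I (gauss t (x * dil l y)) - b))"
      by blast
  qed
qed

lemma tendsto_functional_gauss:
  fixes x :: "'n::finite heis"
  assumes I: "positive_functional I" and t: "0 < t" and X: "X \<longlonglongrightarrow> x"
  shows "(\<lambda>j. I (gauss t (X j))) \<longlonglongrightarrow> I (gauss t x)"
proof -
  define R where "R = dist 1 x + 1"
  obtain C where C: "0 \<le> C" "\<And>x y w. dist 1 x \<le> R \<Longrightarrow> dist 1 y \<le> R \<Longrightarrow> dist x y \<le> 1 \<Longrightarrow>
    \<bar>gauss t x w - gauss t y w\<bar> \<le> C * dist x y * gauss (t / 16) (1::'n heis) w"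
    by (rule gauss_close [OF t, of "1::'n heis" R]) (rule that)
  have g: "gauss t x \<in> gauss_decay" "gauss (t / 16) x \<in> gauss_decay" for x :: "'n heis"
    using t by auto
  have d: "(\<lambda>j. dist (X j) x) \<longlonglongrightarrow> 0"
    by (rule tendsto_dist_iff [THEN iffD1, OF X])
  show ?thesis
  proof (rule LIM_zero_cancel, rule Lim_null_comparison)
    have "\<forall>\<^sub>F j in sequentially. dist (X j) x < 1"
      using X by (rule tendstoD) simp
    then show "\<forall>\<^sub>F j in sequentially. norm (I (gauss t (X j)) - I (gauss t x)) \<le> C * dist (X j) x * I (gauss (t / 16) 1)"
    proof eventually_elim
      case (elim j)
      have dx: "dist 1 (X j) \<le> R" "dist 1 x \<le> R" "dist (X j) x \<le> 1"
        using elim dist_triangle [of 1 "X j" x] by (auto simp: R_def dist_commute)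
      have "\<bar>I (\<lambda>w. gauss t (X j) w - gauss t x w)\<bar> \<le> I (\<lambda>w. C * dist (X j) x * gauss (t / 16) 1 w)"
        by (rule pf_abs_le [OF I gauss_decay_diff [OF g(1) g(1)] gauss_decay_mult [OF g(2)] C(2) [OF dx]])
      then show ?case
        by (simp only: pf_diff [OF I g(1) g(1)] pf_mult [OF I g(2)] real_norm_def)
    qed
    show "(\<lambda>j. C * dist (X j) x * I (gauss (t / 16) 1)) \<longlonglongrightarrow> 0"
      by (intro tendsto_mult_left_zero tendsto_mult_right_zero d)
  qed
qed

section \<open>Reduction to homogeneous subgroups\<close>

definition hom_subgroup :: "'n::finite heis set \<Rightarrow> bool" where
  "hom_subgroup G \<longleftrightarrow> 1 \<in> G \<and> (\<forall>x\<in>G. \<forall>y\<in>G. x * y \<in> G) \<and> (\<forall>x\<in>G. inverse x \<in> G) \<and>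
     (\<forall>r>0. \<forall>x\<in>G. dil r x \<in> G)"

lemma
  assumes "hom_subgroup G"
  shows hom_subgroup_one: "1 \<in> G"
    and hom_subgroup_mult: "x \<in> G \<Longrightarrow> y \<in> G \<Longrightarrow> x * y \<in> G"
    and hom_subgroup_inverse: "x \<in> G \<Longrightarrow> inverse x \<in> G"
    and hom_subgroup_dil: "0 < r \<Longrightarrow> x \<in> G \<Longrightarrow> dil r x \<in> G"
  using assms by (auto simp: hom_subgroup_def)

text \<open>In \<open>x * x * dil 2 (inverse x)\<close> the horizontal parts cancel while the
  vertical part is 2 v - 4 v; the inverse and the dilation by \<open>1 / sqrt 2\<close> turn this
  into v.\<close>

lemma hom_subgroup_vert:
  assumes G: "hom_subgroup G" and x: "x \<in> G"
  shows "Heis 0 (vert x) \<in> G"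
proof -
  have "dil (1 / sqrt 2) (inverse (x * x * dil 2 (inverse x))) \<in> G"
    using G x by (intro hom_subgroup_dil hom_subgroup_mult hom_subgroup_inverse) auto
  also have "dil (1 / sqrt 2) (inverse (x * x * dil 2 (inverse x))) = Heis 0 (vert x)"
    by (rule heis_eqI) (simp_all add: heis_form_self heis_form_scale_right heis_form_minus_right
        heis_form_add_left power_divide scaleR_2)
  finally show ?thesis .
qed

lemma hom_subgroup_horiz:
  assumes G: "hom_subgroup G" and x: "x \<in> G"
  shows "Heis (horiz x) 0 \<in> G"
proof -
  have "x * inverse (Heis 0 (vert x)) \<in> G"
    by (intro hom_subgroup_mult hom_subgroup_inverse hom_subgroup_vert G x)
  also have "x * inverse (Heis 0 (vert x)) = Heis (horiz x) 0"
    by (rule heis_eqI) simp_all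
  finally show ?thesis .
qed

lemma hom_subgroup_vertical:
  assumes G: "hom_subgroup G" and x: "Heis 0 t \<in> G" "t \<noteq> 0"
  shows "Heis 0 u \<in> G"
proof -
  have pos: "Heis 0 u \<in> G" if "0 < u / t" for u
  proof -
    have "dil (sqrt (u / t)) (Heis 0 t) \<in> G"
      using that by (intro hom_subgroup_dil G x) simp
    also have "dil (sqrt (u / t)) (Heis 0 t) = Heis 0 u"
      using that x(2) by (simp add: dil_def)
    finally show ?thesis .
  qed
  consider "u / t = 0" | "0 < u / t" | "u / t < 0"
    by linarith
  then show ?thesis
  proof cases
    case 1
    then show ?thesis using hom_subgroup_one [OF G] x(2) by (simp add: one_heis_def)
  next
    case 2
    then show ?thesis by (rule pos)
  next
    case 3
    then have "inverse (Heis 0 (- u)) \<in> G"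
      by (intro hom_subgroup_inverse G pos) simp
    then show ?thesis by (simp add: inverse_heis_def)
  qed
qed

lemma subspace_horiz_hom_subgroup:
  assumes G: "hom_subgroup G"
  shows "subspace (horiz ` G)"
  unfolding subspace_def
proof (intro conjI ballI allI)
  show "0 \<in> horiz ` G"
    using hom_subgroup_one [OF G] by (force intro!: image_eqI [of _ _ 1])
  show "u + v \<in> horiz ` G" if "u \<in> horiz ` G" "v \<in> horiz ` G" for u v
    using that hom_subgroup_mult [OF G] by (auto simp flip: horiz_mult)
  fix a :: real and u assume "u \<in> horiz ` G"
  then obtain x where x: "x \<in> G" "u = horiz x" by auto
  have pos: "a *\<^sub>R horiz x \<in> horiz ` G" if "0 < a" "x \<in> G" for a x
    using hom_subgroup_dil [OF G that] by (auto simp flip: horiz_dil)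
  consider "a = 0" | "0 < a" | "0 < - a" by linarith
  then show "a *\<^sub>R u \<in> horiz ` G"
  proof cases
    case 1
    then show ?thesis using \<open>0 \<in> horiz ` G\<close> by simp
  next
    case 2
    then show ?thesis using pos x by simp
  next
    case 3
    then show ?thesis using pos [OF 3 hom_subgroup_inverse [OF G x(1)]] x(2) by simp
  qed
qed

text \<open>Splitting off the vertical part shows that only two data matter, the horizontal subspace
  and whether the centre of the group is contained. \<open>hom_dim\<close> and the lattice count
  rest on this classification.\<close>

lemma hom_subgroup_eq:
  assumes G: "hom_subgroup G"
  shows "G = {x. horiz x \<in> horiz ` G \<and> (Heis 0 1 \<in> G \<or> vert x = 0)}"
proof (intro set_eqI iffI CollectI conjI)
  fix x assume x: "x \<in> G"
  then show "horiz x \<in> horiz ` G" by simp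
  show "Heis 0 1 \<in> G \<or> vert x = 0"
    using hom_subgroup_vertical [OF G hom_subgroup_vert [OF G x]] by auto
next
  fix x assume x: "x \<in> {x. horiz x \<in> horiz ` G \<and> (Heis 0 1 \<in> G \<or> vert x = 0)}"
  then obtain x' where "x' \<in> G" "horiz x = horiz x'" by blast
  then have h: "Heis (horiz x) 0 \<in> G"
    using hom_subgroup_horiz [OF G, of x'] by simp
  have v: "Heis 0 (vert x) \<in> G"
  proof (cases "Heis 0 1 \<in> G")
    case True
    then show ?thesis by (rule hom_subgroup_vertical [OF G]) simp
  next
    case False
    then have "vert x = 0" using x by simp
    then show ?thesis using hom_subgroup_one [OF G] by (simp add: one_heis_def)
  qed
  have "Heis (horiz x) 0 * Heis 0 (vert x) = x"
    by (rule heis_eqI) simp_all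
  then show "x \<in> G"
    using hom_subgroup_mult [OF G h v] by simp
qed

text \<open>The product of two horizontal elements has vertical part \<open>heis_form u v\<close>.
  In the lattice lemma this removes a vertical error that could not be corrected when the centre is
  missing.\<close>

lemma hom_subgroup_isotropic:
  assumes G: "hom_subgroup G" and "Heis 0 1 \<notin> G" "u \<in> horiz ` G" "v \<in> horiz ` G"
  shows "heis_form u v = 0"
proof -
  have "Heis u 0 * Heis v 0 \<in> G"
    using assms by (intro hom_subgroup_mult) (auto intro: hom_subgroup_horiz)
  then have "vert (Heis u 0 * Heis v 0) = 0"
    using hom_subgroup_eq [OF G] assms(2) by blast
  then show ?thesis by simp
qed

lemma closed_hom_subgroup:
  assumes G: "hom_subgroup G"
  shows "closed G"
proof -
  have 1: "closed (horiz -` (horiz ` G))"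
    by (intro closed_vimage closed_subspace subspace_horiz_hom_subgroup G continuous_on_horiz)
  have 2: "closed {x :: 'a heis. vert x = 0}"
    by (intro closed_Collect_eq continuous_on_vert continuous_on_const)
  have eq: "G = horiz -` (horiz ` G) \<inter> (if Heis 0 1 \<in> G then UNIV else {x. vert x = 0})"
    using hom_subgroup_eq [OF G] by auto
  show ?thesis
    by (subst eq) (use 1 2 in \<open>simp add: closed_Int\<close>)
qed

text \<open>The homogeneous dimension: the vertical direction counts twice because dilations scale
  it by \<open>r\<^sup>2\<close>. It is both the exponent of the lattice count and the quantity that
  drops in the induction.\<close>

definition hom_dim :: "'n::finite heis set \<Rightarrow> nat" where
  "hom_dim G = dim (horiz ` G) + (if Heis 0 1 \<in> G then 2 else 0)"

lemma hom_dim_less: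
  assumes G: "hom_subgroup G" and H: "hom_subgroup H" and sub: "G \<subset> H"
  shows "hom_dim G < hom_dim H"
proof (cases "horiz ` G = horiz ` H")
  case True
  then have "Heis 0 1 \<notin> G" "Heis 0 1 \<in> H"
    using hom_subgroup_eq [OF G] hom_subgroup_eq [OF H] sub by auto
  then show ?thesis
    using True by (simp add: hom_dim_def)
next
  case False
  have sp: "span (horiz ` G) = horiz ` G" "span (horiz ` H) = horiz ` H"
    using subspace_horiz_hom_subgroup G H by (auto simp only: span_eq_iff)
  have "span (horiz ` G) \<subset> span (horiz ` H)"
    unfolding sp using False sub by auto
  then have "dim (horiz ` G) < dim (horiz ` H)"
    by (rule dim_psubset)
  then show ?thesis
    using sub by (auto simp: hom_dim_def)
qed

section \<open>Taylor coefficients and the descent to a smaller subgroup\<close>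

lemma series_coeff_unique:
  fixes a b :: "nat \<Rightarrow> real"
  assumes a: "\<And>k. \<bar>a k\<bar> \<le> C / 2 ^ k" and b: "\<And>k. \<bar>b k\<bar> \<le> D / 2 ^ k"
    and g: "\<And>l. 0 < l \<Longrightarrow> l \<le> 1 \<Longrightarrow> (\<lambda>k. a k * l ^ k) sums g l"
    and h: "\<And>l. 0 < l \<Longrightarrow> l \<le> 1 \<Longrightarrow> (\<lambda>k. b k * l ^ k) sums g l"
  shows "a = b"
proof
  fix k
  have "((\<lambda>i::nat. a k) \<longlongrightarrow> b k) sequentially"
  proof (rule series_coeff_tendsto [where C = "max C D" and g = "\<lambda>i. g" and h = g])
    show "\<bar>a k\<bar> \<le> max C D / 2 ^ k" "\<bar>b k\<bar> \<le> max C D / 2 ^ k" for k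
      by (rule order_trans [OF a divide_right_mono], simp_all)
        (rule order_trans [OF b divide_right_mono], simp_all)
  qed (use g h in auto)
  then show "a k = b k"
    by (simp add: LIMSEQ_const_iff)
qed

text \<open>Everything follows from uniqueness of the coefficients: the uniform bound passes to the
  chosen ones, convergence comes from \<open>series_coeff_tendsto\<close>, and substituting l * r
  for l yields homogeneity of degree k in y.\<close>

lemma line_analytic_coeff:
  fixes F :: "'n::finite heis \<Rightarrow> real"
  assumes F: "line_analytic F" and cont: "\<And>X x. X \<longlonglongrightarrow> x \<Longrightarrow> (\<lambda>j. F (X j)) \<longlonglongrightarrow> F x"
  obtains a where "\<And>R. \<exists>C. \<forall>x y k. dist 1 x \<le> R \<longrightarrow> dist 1 y \<le> R \<longrightarrow> \<bar>a x y k\<bar> \<le> C / 2 ^ k"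
    "\<And>x y l. l \<in> {0..1} \<Longrightarrow> (\<lambda>k. a x y k * l ^ k) sums F (x * dil l y)"
    "\<And>X Y x y k. X \<longlonglongrightarrow> x \<Longrightarrow> Y \<longlonglongrightarrow> y \<Longrightarrow> (\<lambda>j. a (X j) (Y j) k) \<longlonglongrightarrow> a x y k"
    "\<And>x y k r. 0 < r \<Longrightarrow> a x (dil r y) k = r ^ k * a x y k"
proof -
  obtain C where C: "\<And>R x y. dist 1 x \<le> R \<Longrightarrow> dist 1 y \<le> R \<Longrightarrow>
     \<exists>a. (\<forall>k. \<bar>a k\<bar> \<le> C R / 2 ^ k) \<and> (\<forall>l\<in>{0..1}. (\<lambda>k. a k * l ^ k) sums F (x * dil l y))"
    using choice [OF F [unfolded line_analytic_def]] by blast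
  define P where "P x y a \<longleftrightarrow> (\<exists>C. \<forall>k. \<bar>a k\<bar> \<le> C / 2 ^ k) \<and>
    (\<forall>l\<in>{0..1}. (\<lambda>k. a k * l ^ k) sums F (x * dil l y))" for x y and a :: "nat \<Rightarrow> real"
  have uniq: "a = b" if ab: "P x y a" "P x y b" for x y a b
  proof -
    obtain C D where "\<And>k. \<bar>a k\<bar> \<le> C / 2 ^ k" "\<And>k. \<bar>b k\<bar> \<le> D / 2 ^ k"
      using ab unfolding P_def by blast
    then show ?thesis
      by (rule series_coeff_unique [where g = "\<lambda>l. F (x * dil l y)"]) (use ab in \<open>auto simp: P_def\<close>)
  qed
  define a where "a x y = (SOME a. P x y a)" for x y
  have P: "P x y (a x y)" for x y
  proof -
    have "\<exists>a. P x y a"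
      using C [of x "max (dist 1 x) (dist 1 y)" y] unfolding P_def by auto
    then show ?thesis
      unfolding a_def by (rule someI_ex)
  qed
  have bd: "\<bar>a x y k\<bar> \<le> C R / 2 ^ k" if R: "dist 1 x \<le> R" "dist 1 y \<le> R" for x y R k
  proof -
    obtain b where b: "\<forall>k. \<bar>b k\<bar> \<le> C R / 2 ^ k" "\<forall>l\<in>{0..1}. (\<lambda>k. b k * l ^ k) sums F (x * dil l y)"
      using C [OF R] by blast
    then have "P x y b" by (auto simp: P_def)
    then have "a x y = b" by (rule uniq [OF P])
    then show ?thesis using b by simp
  qed
  have sums: "(\<lambda>k. a x y k * l ^ k) sums F (x * dil l y)" if "l \<in> {0..1}" for x y l
    using P [of x y] that by (simp add: P_def)
  show ?thesis
  proof
    show "\<exists>C. \<forall>x y k. dist 1 x \<le> R \<longrightarrow> dist 1 y \<le> R \<longrightarrow> \<bar>a x y k\<bar> \<le> C / 2 ^ k" for R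
      using bd by blast
    show "(\<lambda>k. a x y k * l ^ k) sums F (x * dil l y)" if "l \<in> {0..1}" for x y l
      by (rule sums [OF that])
    show "(\<lambda>j. a (X j) (Y j) k) \<longlonglongrightarrow> a x y k" if X: "X \<longlonglongrightarrow> x" and Y: "Y \<longlonglongrightarrow> y" for X Y x y k
    proof -
      have "bounded (range X)" "bounded (range Y)"
        using X Y convergent_imp_bounded by blast+
      then obtain R1 R2 where R: "\<And>j. dist 1 (X j) \<le> R1" "\<And>j. dist 1 (Y j) \<le> R2"
        unfolding bounded_any_center [of _ 1] by blast
      define R where "R = max R1 R2"
      have R': "dist 1 (X j) \<le> R" "dist 1 (Y j) \<le> R" for j
        using R [of j] by (auto simp: R_def)
      have R'': "dist 1 x \<le> R" "dist 1 y \<le> R"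
        using R' by (auto intro!: LIMSEQ_le_const2 [OF tendsto_dist [OF tendsto_const]] X Y)
      show ?thesis
      proof (rule series_coeff_tendsto [where C = "C R"])
        fix l :: real assume "0 < l" "l \<le> 1"
        then have l: "l \<in> {0..1}" by auto
        show "(\<lambda>k. a (X j) (Y j) k * l ^ k) sums F (X j * dil l (Y j))" for j
          by (rule sums [OF l])
        show "(\<lambda>k. a x y k * l ^ k) sums F (x * dil l y)"
          by (rule sums [OF l])
        show "(\<lambda>j. F (X j * dil l (Y j))) \<longlonglongrightarrow> F (x * dil l y)"
          by (intro cont tendsto_intros X Y)
      qed (intro bd R' R'')+
    qed
    have le1: "a x (dil r y) k = r ^ k * a x y k" if r: "0 < r" "r \<le> 1" for x y k r
    proof -
      obtain D where D: "\<And>k. \<bar>a x y k\<bar> \<le> D / 2 ^ k"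
        using P [of x y] by (auto simp: P_def)
      have "P x (dil r y) (\<lambda>k. r ^ k * a x y k)"
        unfolding P_def
      proof (intro conjI exI [of _ D] allI ballI)
        fix k
        have "\<bar>r ^ k * a x y k\<bar> \<le> 1 * (D / 2 ^ k)"
          unfolding abs_mult using r D [of k] by (intro mult_mono) (auto simp: power_le_one)
        then show "\<bar>r ^ k * a x y k\<bar> \<le> D / 2 ^ k" by simp
      next
        fix l :: real assume l: "l \<in> {0..1}"
        then have "(\<lambda>k. a x y k * (l * r) ^ k) sums F (x * dil (l * r) y)"
          using r by (intro sums) (auto simp: mult_le_one)
        then show "(\<lambda>k. r ^ k * a x y k * l ^ k) sums F (x * dil l (dil r y))"
          by (simp add: power_mult_distrib mult_ac)
      qed
      from uniq [OF P this] show ?thesis by simp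
    qed
    show "a x (dil r y) k = r ^ k * a x y k" if r: "0 < r" for x y k r
    proof (cases "r \<le> 1")
      case True
      then show ?thesis using le1 r by blast
    next
      case False
      \<comment> \<open>For r > 1 the substitution would leave [0, 1], so the case of 1 / r is
        inverted.\<close>
      then have "a x (dil (1 / r) (dil r y)) k = (1 / r) ^ k * a x (dil r y) k"
        by (intro le1) auto
      then show ?thesis
        using r by (simp add: power_divide field_simps)
    qed
  qed
qed

text \<open>Minimality of N over the whole support, and not only at x, is what makes the blow-up
  work: the support points near x that approximate the tangent have no terms of lower order
  either.\<close>

lemma blowup_to_smaller_subgroup:
  fixes I :: "('n::finite heis \<Rightarrow> real) \<Rightarrow> real"
  assumes I: "uniform_functional s c I" and K: "hom_subgroup K" and sub: "fsupport I \<subset> K"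
  obtains J G where "uniform_functional s c J" "hom_subgroup G" "fsupport J \<subseteq> G" "G \<subset> K"
proof -
  note pfI = uf_pf [OF I] and c = uf_pos [OF I] and one = uf_one [OF I] and unif = uf_gauss [OF I]
  obtain p where p: "p \<in> K" "p \<notin> fsupport I" using sub by auto
  \<comment> \<open>By \<open>fsupportI_gauss\<close> the law fails for some rate at a point outside
    the support.\<close>
  then obtain t where t: "0 < t" "I (gauss t p) \<noteq> c * t powr (- s / 4)"
    using fsupportI_gauss [OF pfI c] by blast
  define F where "F x = I (gauss t x) - c * t powr (- s / 4)" for x
  have F0: "F x = 0" if "x \<in> fsupport I" for x
    using unif [OF that t(1)] by (simp add: F_def)
  have FA: "line_analytic F"
    unfolding F_def by (rule line_analytic_functional [OF pfI t(1)])
  have Fc: "(\<lambda>j. F (X j)) \<longlonglongrightarrow> F x" if "X \<longlonglongrightarrow> x" for X x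
    unfolding F_def by (intro tendsto_diff tendsto_const tendsto_functional_gauss pfI t that)
  obtain a where
    bd: "\<And>R. \<exists>C. \<forall>x y k. dist 1 x \<le> R \<longrightarrow> dist 1 y \<le> R \<longrightarrow> \<bar>a x y k\<bar> \<le> C / 2 ^ k" and
    sums: "\<And>x y l. l \<in> {0..1} \<Longrightarrow> (\<lambda>k. a x y k * l ^ k) sums F (x * dil l y)" and
    cont: "\<And>X Y x y k. X \<longlonglongrightarrow> x \<Longrightarrow> Y \<longlonglongrightarrow> y \<Longrightarrow> (\<lambda>j. a (X j) (Y j) k) \<longlonglongrightarrow> a x y k" and
    hom: "\<And>x y k r. 0 < r \<Longrightarrow> a x (dil r y) k = r ^ k * a x y k"
    by (rule line_analytic_coeff [OF FA Fc]) (assumption, rule that)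
  \<comment> \<open>The identity lies in the support, and at l = 1 the curve from it reaches p,
    where \<open>F\<close> is not 0.\<close>
  have nz: "\<exists>k. \<exists>x\<in>fsupport I. \<exists>y\<in>K. a x y k \<noteq> 0"
  proof (rule ccontr)
    assume "\<not> ?thesis"
    then have "a 1 p k = 0" for k using one p by blast
    then have "(\<lambda>k. 0) sums F p"
      using sums [of 1 1 p] by simp
    then have "F p = 0"
      using sums_unique2 sums_zero by blast
    then show False using t(2) by (simp add: F_def)
  qed
  define N where "N = (LEAST k. \<exists>x\<in>fsupport I. \<exists>y\<in>K. a x y k \<noteq> 0)"
  have low: "a x y k = 0" if "k < N" "x \<in> fsupport I" "y \<in> K" for x y k
    using not_less_Least [OF that(1) [unfolded N_def]] that by blast
  obtain x y0 where x: "x \<in> fsupport I" "y0 \<in> K" "a x y0 N \<noteq> 0"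
    using LeastI_ex [OF nz] unfolding N_def by blast
  define Q where "Q y = a x y N" for y
  \<comment> \<open>The identity is fixed by dilations, so homogeneity of positive degree forces the
    value 0. At the end this gives \<open>Q 1 = 0\<close> and separates y0 from
    \<open>G\<close>.\<close>
  have const: "a z 1 k = 0" if "k > 0" for z k
  proof -
    have "a z (dil 2 1) k = 2 ^ k * a z 1 k" by (rule hom) simp
    then show ?thesis using one_less_power [OF _ that, of "2::real"] by simp
  qed
  have a0: "a z y 0 = F z" for z y
  proof -
    have "(\<lambda>k. a z y k * 0 ^ k) sums F (z * dil 0 y)"
      by (rule sums) simp
    from sums_unique2 [OF powser_sums_zero this] show ?thesis by simp
  qed
  \<comment> \<open>The coefficient of order 0 is the value of \<open>F\<close>, which is 0 on the
    support.\<close>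
  have N0: "0 < N"
  proof (rule ccontr)
    assume "\<not> 0 < N"
    then have "a x y0 0 \<noteq> 0" using x by simp
    then show False using a0 F0 x(1) by simp
  qed
  have lead: "\<bar>F (z * dil l y) - a z y N * l ^ N\<bar> \<le> C * l ^ Suc N"
    if z: "z \<in> fsupport I" "y \<in> K" and l: "l \<in> {0..1}" and C: "\<And>k. \<bar>a z y k\<bar> \<le> C / 2 ^ k" for z y l C
  proof -
    have "\<bar>F (z * dil l y) - (\<Sum>j\<le>N. a z y j * l ^ j)\<bar> \<le> C * l ^ Suc N / 2 ^ N"
      using l by (intro series_remainder C sums) auto
    also have "(\<Sum>j\<le>N. a z y j * l ^ j) = a z y N * l ^ N"
      using low z by (simp add: lessThan_Suc_atMost [symmetric])
    also have "C * l ^ Suc N / 2 ^ N \<le> C * l ^ Suc N / 1"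
      using C [of 0] l by (intro divide_left_mono) auto
    finally show ?thesis by simp
  qed
  have xK: "x \<in> K" using x sub by auto
  define r where "r j = 1 / real (Suc j)" for j
  have r: "0 < r j" "r j \<le> 1" for j by (auto simp: r_def)
  obtain J where J: "uniform_functional s c J"
    "\<And>z e. z \<in> fsupport J \<Longrightarrow> 0 < e \<Longrightarrow> \<exists>\<^sub>F j in sequentially. \<exists>y. x * dil (r j) y \<in> fsupport I \<and> dist z y < e"
    by (rule tangent_functional [OF I x(1) r(1)]) (rule that)
  define G where "G = {z \<in> K. \<forall>y\<in>K. Q (z * y) = Q y}"
  have "z \<in> G" if z: "z \<in> fsupport J" for z
  proof -
    \<comment> \<open>The tangent property holds only frequently; the tolerance \<open>r n\<close>
      and an index beyond n yield one sequence along which the points tend to z and the radii to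
      0.\<close>
    have "\<exists>j y. n \<le> j \<and> x * dil (r j) y \<in> fsupport I \<and> dist z y < r n" for n
      using J(2) [OF z r(1) [of n]] unfolding frequently_sequentially by blast
    then obtain j y where jy: "\<And>n. n \<le> j n" "\<And>n. x * dil (r (j n)) (y n) \<in> fsupport I"
      "\<And>n. dist z (y n) < r n"
      by metis
    have r0: "r \<longlonglongrightarrow> 0"
      unfolding r_def by (rule LIMSEQ_Suc) (rule lim_1_over_n)
    have y: "y \<longlonglongrightarrow> z"
    proof (rule tendsto_dist_iff [THEN iffD2], rule Lim_null_comparison [OF always_eventually r0], intro allI)
      show "norm (dist (y n) z) \<le> r n" for n
        using jy(3) [of n] by (simp add: dist_commute)
    qed
    have rj: "(\<lambda>n. r (j n)) \<longlonglongrightarrow> 0"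
    proof (rule Lim_null_comparison [OF always_eventually r0], intro allI)
      show "norm (r (j n)) \<le> r n" for n
        using jy(1) [of n] by (simp add: r_def frac_le)
    qed
    have yK: "y n \<in> K" for n
    proof -
      have "x * dil (r (j n)) (y n) \<in> K"
        using jy(2) sub by blast
      then have "dil (1 / r (j n)) (inverse x * (x * dil (r (j n)) (y n))) \<in> K"
        using r(1) [of "j n"]
        by (intro hom_subgroup_dil [OF K _ hom_subgroup_mult [OF K hom_subgroup_inverse [OF K xK]]]) auto
      then show ?thesis using r(1) [of "j n"] by simp
    qed
    then have zK: "z \<in> K"
      using closed_sequentially [OF closed_hom_subgroup [OF K] _ y] by blast
    have "Q (z * v) = Q v" if v: "v \<in> K" for v
    proof -
      define X where "X n = x * dil (r (j n)) (y n)" for n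
      have X: "X \<longlonglongrightarrow> x"
      proof -
        have "X \<longlonglongrightarrow> x * dil 0 z"
          unfolding X_def by (intro tendsto_intros rj y)
        then show ?thesis by simp
      qed
      have Y: "(\<lambda>n. y n * v) \<longlonglongrightarrow> z * v"
        by (intro tendsto_intros y)
      have "bounded (range X)" "bounded (range (\<lambda>n. y n * v))"
        using X Y convergent_imp_bounded by blast+
      then obtain R1 R2 where R: "\<And>n. dist 1 (X n) \<le> R1" "\<And>n. dist 1 (y n * v) \<le> R2"
        unfolding bounded_any_center [of _ 1] by blast
      define R where "R = Max {R1, R2, dist 1 x, dist 1 v}"
      have R': "dist 1 (X n) \<le> R" "dist 1 (y n * v) \<le> R" "dist 1 x \<le> R" "dist 1 v \<le> R" for n
        using R [of n] by (auto simp: R_def le_max_iff_disj)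
      obtain C where C: "\<And>x y k. dist 1 x \<le> R \<Longrightarrow> dist 1 y \<le> R \<Longrightarrow> \<bar>a x y k\<bar> \<le> C / 2 ^ k"
        using bd [of R] by blast
      \<comment> \<open>One value of \<open>F\<close>, at
        \<open>x * dil l (y n * v) = X n * dil l v\<close>, is expanded from x and from
        \<open>X n\<close>. Both points are in the support, so both expansions start at order N, and
        division by \<open>l ^ N\<close> leaves an error of order l.\<close>
      have diff: "\<bar>a x (y n * v) N - a (X n) v N\<bar> \<le> 2 * C * r (j n)" for n
      proof -
        define l where "l = r (j n)"
        have l: "0 < l" "l \<in> {0..1}" using r [of "j n"] by (auto simp: l_def)
        have "\<bar>F (x * dil l (y n * v)) - a x (y n * v) N * l ^ N\<bar> \<le> C * l ^ Suc N"
          using yK v R' l by (intro lead x C hom_subgroup_mult [OF K]) auto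
        moreover have "\<bar>F (X n * dil l v) - a (X n) v N * l ^ N\<bar> \<le> C * l ^ Suc N"
          using jy(2) v R' l by (intro lead C) (auto simp: X_def)
        moreover have "x * dil l (y n * v) = X n * dil l v"
          by (simp add: X_def l_def dil_mult mult.assoc)
        ultimately have "\<bar>a x (y n * v) N * l ^ N - a (X n) v N * l ^ N\<bar> \<le> 2 * (C * l ^ Suc N)"
          by simp
        then have "\<bar>a x (y n * v) N - a (X n) v N\<bar> * l ^ N \<le> (2 * C * l) * l ^ N"
          using l by (simp only: left_diff_distrib [symmetric] abs_mult) (simp add: mult_ac)
        then show ?thesis
          using l by (simp add: l_def)
      qed
      have "(\<lambda>n. a x (y n * v) N - a (X n) v N) \<longlonglongrightarrow> a x (z * v) N - a x v N"
        by (intro tendsto_diff cont Y X tendsto_const)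
      moreover have "(\<lambda>n. a x (y n * v) N - a (X n) v N) \<longlonglongrightarrow> 0"
      proof (rule Lim_null_comparison [OF always_eventually])
        show "\<forall>n. norm (a x (y n * v) N - a (X n) v N) \<le> 2 * C * r (j n)"
          using diff by simp
        show "(\<lambda>n. 2 * C * r (j n)) \<longlonglongrightarrow> 0"
          by (rule tendsto_mult_right_zero [OF rj])
      qed
      ultimately have "a x (z * v) N - a x v N = 0"
        by (rule LIMSEQ_unique)
      then show ?thesis by (simp add: Q_def)
    qed
    then show ?thesis using zK by (simp add: G_def)
  qed
  then have "fsupport J \<subseteq> G" by auto
  moreover have "hom_subgroup G"
    unfolding hom_subgroup_def
  proof (intro conjI ballI allI impI)
    show "1 \<in> G" using hom_subgroup_one [OF K] by (simp add: G_def)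
    fix z assume z: "z \<in> G"
    then have zK: "z \<in> K" and zQ: "\<And>y. y \<in> K \<Longrightarrow> Q (z * y) = Q y" by (auto simp: G_def)
    show "z * w \<in> G" if "w \<in> G" for w
      using that zK zQ by (auto simp: G_def mult.assoc hom_subgroup_mult [OF K])
    show "inverse z \<in> G"
      using zQ [of "inverse z * y" for y] zK
      by (auto simp: G_def hom_subgroup_mult [OF K] hom_subgroup_inverse [OF K])
    fix q :: real assume q: "0 < q"
    have "Q (dil q z * y) = Q y" if y: "y \<in> K" for y
    proof -
      have "dil q z * y = dil q (z * dil (1 / q) y)"
        using q by (simp add: dil_mult)
      then have "Q (dil q z * y) = q ^ N * Q (z * dil (1 / q) y)"
        using hom [OF q] by (simp add: Q_def)
      also have "Q (z * dil (1 / q) y) = Q (dil (1 / q) y)"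
        using q y by (intro zQ hom_subgroup_dil [OF K]) auto
      also have "q ^ N * Q (dil (1 / q) y) = Q (dil q (dil (1 / q) y))"
        using hom [OF q] by (simp only: Q_def)
      finally show ?thesis using q by simp
    qed
    then show "dil q z \<in> G"
      using q zK by (simp add: G_def hom_subgroup_dil [OF K])
  qed
  moreover have "G \<subset> K"
  proof -
    have "y0 \<notin> G"
    proof
      assume "y0 \<in> G"
      then have "Q (y0 * 1) = Q 1"
        using hom_subgroup_one [OF K] unfolding G_def by blast
      then show False
        using x(3) const [OF N0] by (simp add: Q_def)
    qed
    then show ?thesis using x(2) by (auto simp: G_def)
  qed
  ultimately show ?thesis using that J(1) by blast
qed

lemma hom_subgroup_UNIV: "hom_subgroup UNIV"
  by (simp add: hom_subgroup_def)

text \<open>Descent on the natural number \<open>hom_dim\<close>, starting from the whole group; s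
  and c stay the same at each step.\<close>

lemma uniform_functional_on_subgroup:
  fixes I :: "('n::finite heis \<Rightarrow> real) \<Rightarrow> real"
  assumes "uniform_functional s c I"
  obtains J :: "('n heis \<Rightarrow> real) \<Rightarrow> real" and G
  where "uniform_functional s c J" "hom_subgroup G" "fsupport J = G"
proof -
  have "\<exists>(J :: ('n heis \<Rightarrow> real) \<Rightarrow> real) H. uniform_functional s c J \<and> hom_subgroup H \<and> fsupport J = H"
    if "uniform_functional s c I" "hom_subgroup G" "fsupport I \<subseteq> G"
    for I and G :: "'n heis set"
    using that
  proof (induction "hom_dim G" arbitrary: I G rule: less_induct)
    case less
    show ?case
    proof (cases "fsupport I = G")
      case True
      then show ?thesis using less(2,3) by blast
    next
      case False
      then have "fsupport I \<subset> G" using less by blast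
      then obtain J H where "uniform_functional s c J" "hom_subgroup H" "fsupport J \<subseteq> H" "H \<subset> G"
        by (rule blowup_to_smaller_subgroup [OF less(2,3)]) (rule that)
      then show ?thesis using less(1) hom_dim_less [OF _ less(3)] by blast
    qed
  qed
  from this [OF assms hom_subgroup_UNIV subset_UNIV] show ?thesis
    using that by blast
qed

section \<open>The support being a subgroup forces integrality\<close>

text \<open>Packing: the bumps of radius e at the points do not overlap, each has average at least a
  constant times \<open>e powr s\<close>, and their sum is dominated by one fixed Gaussian.\<close>

lemma separated_set_card_le:
  fixes I :: "('n::finite heis \<Rightarrow> real) \<Rightarrow> real"
  assumes I: "uniform_functional s c I"
  shows "\<exists>C. \<forall>X e. finite X \<longrightarrow> X \<subseteq> fsupport I \<longrightarrow> X \<subseteq> cball 1 R \<longrightarrow> 0 < e \<longrightarrow> e \<le> 1 \<longrightarrow>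
    (\<forall>x\<in>X. \<forall>y\<in>X. x \<noteq> y \<longrightarrow> 2 * e \<le> dist x y) \<longrightarrow> card X \<le> C * e powr (- s)"
proof -
  note pfI = uf_pf [OF I] and c = uf_pos [OF I] and one = uf_one [OF I] and unif = uf_gauss [OF I]
  \<comment> \<open>With \<open>t = M / e ^ 4\<close> the part of the Gaussian beyond e / 2 gets the
    weight \<open>q = exp (- M / 32)\<close>, and M / 32 = 1 + |s| / 4 makes
    \<open>q * 2 powr (s / 4)\<close> at most 1 / 2.\<close>
  define M where "M = 32 * (1 + \<bar>s\<bar> / 4)"
  define A where "A = M powr (- s / 4) / 4"
  have M: "0 < M" by (simp add: M_def add_pos_nonneg)
  then have A: "0 < A" by (simp add: A_def)
  have bump_ge: "c * A * e powr s \<le> I (bump x e)" if x: "x \<in> fsupport I" and e: "0 < e" for x e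
  proof -
    define t where "t = M / e ^ 4"
    have t: "0 < t" using M e by (simp add: t_def)
    define q where "q = exp (- M / 32)"
    have q0: "0 < q" by (simp add: q_def)
    have g: "gauss t x \<in> gauss_decay" "gauss (t / 2) x \<in> gauss_decay" "bump x e \<in> gauss_decay"
      using t e by auto
    have "gauss t x w \<le> 2 * bump x e w + q * gauss (t / 2) x w" for w
    proof (cases "dist x w \<le> e / 2")
      case True
      then have "1 \<le> 2 * bump x e w"
        using e by (simp add: bump_def max_def field_simps)
      then show ?thesis
        using gauss_le_1 [of t x w] t q0 by (simp add: add_increasing2)
    next
      case False
      then have "(e / 2) ^ 4 \<le> dist x w ^ 4"
        using e by (intro power_mono) auto
      then have "t / 2 * (e / 2) ^ 4 \<le> t / 2 * dist x w ^ 4"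
        using t by (intro mult_left_mono) auto
      also have "t / 2 * (e / 2) ^ 4 = M / 32"
        using e by (simp add: t_def field_simps)
      finally have "gauss t x w \<le> q * gauss (t / 2) x w"
        by (simp add: gauss_def q_def flip: exp_add)
      then show ?thesis
        by (simp add: add_increasing)
    qed
    then have "I (gauss t x) \<le> I (\<lambda>w. 2 * bump x e w + q * gauss (t / 2) x w)"
      by (intro pf_mono [OF pfI g(1) gauss_decay_add [OF gauss_decay_mult [OF g(3)] gauss_decay_mult [OF g(2)]]])
    also have "\<dots> = 2 * I (bump x e) + q * I (gauss (t / 2) x)"
      by (simp only: pf_add [OF pfI gauss_decay_mult [OF g(3)] gauss_decay_mult [OF g(2)]]
          pf_mult [OF pfI g(3)] pf_mult [OF pfI g(2)])
    finally have le: "c * t powr (- s / 4) \<le> 2 * I (bump x e) + q * (c * (t / 2) powr (- s / 4))"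
      unfolding unif [OF x t] unif [OF x half_gt_zero [OF t]] .
    have tpos: "0 < t powr (- s / 4)" using t by simp
    have "q * (t / 2) powr (- s / 4) \<le> 1 / 2 * t powr (- s / 4)"
    proof -
      have "(t / 2) powr (- s / 4) = t powr (- s / 4) / 2 powr (- s / 4)"
        by (rule powr_divide)
      moreover have "q / 2 powr (- s / 4) \<le> 1 / 2"
      proof -
        have "- M / 32 + s / 4 * ln 2 \<le> - 1"
        proof -
          have "s / 4 * ln 2 \<le> \<bar>s\<bar> / 4 * 1"
            using ln_2_less_1 by (intro mult_mono) auto
          moreover have "- M / 32 = - 1 - \<bar>s\<bar> / 4"
            by (simp add: M_def diff_divide_distrib)
          ultimately show ?thesis by linarith
        qed
        then have "exp (- M / 32 + s / 4 * ln 2) \<le> exp (- 1)"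
          by simp
        also have "\<dots> \<le> 1 / 2"
          using exp_ge_add_one_self [of 1] by (simp add: exp_minus field_simps)
        finally show ?thesis
          by (simp add: q_def powr_def flip: exp_diff)
      qed
      ultimately show ?thesis
        using mult_right_mono [of "q / 2 powr (- s / 4)" "1 / 2" "t powr (- s / 4)"] tpos by simp
    qed
    then have "q * (c * (t / 2) powr (- s / 4)) \<le> c * (1 / 2 * t powr (- s / 4))"
      using mult_left_mono [of _ _ c] c by (metis less_eq_real_def mult.left_commute)
    then have "c * (t powr (- s / 4) / 4) \<le> I (bump x e)"
      using le by simp
    also have "t powr (- s / 4) = M powr (- s / 4) / (e powr 4) powr (- s / 4)"
      using e M by (simp add: t_def powr_divide powr_numeral)
    also have "(e powr 4) powr (- s / 4) = e powr (- s)"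
      by (simp add: powr_powr)
    finally have le: "c * (M powr (- s / 4) / e powr (- s) / 4) \<le> I (bump x e)" .
    have "e powr s = inverse (e powr (- s))"
      by (simp add: powr_minus)
    then have "c * A * e powr s = c * (M powr (- s / 4) / e powr (- s) / 4)"
      by (simp only: A_def divide_inverse mult_ac)
    then show ?thesis using le by simp
  qed
  \<comment> \<open>Makes \<open>D * gauss 1 1\<close> at least 1 on the ball of radius R + 1, which
    contains all the bumps since e is at most 1.\<close>
  define D where "D = exp ((R + 1) ^ 4)"
  show ?thesis
  proof (intro exI allI impI)
    fix X :: "'n heis set" and e :: real
    assume X: "finite X" "X \<subseteq> fsupport I" "X \<subseteq> cball 1 R" and e: "0 < e" "e \<le> 1"
      and sep: "\<forall>x\<in>X. \<forall>y\<in>X. x \<noteq> y \<longrightarrow> 2 * e \<le> dist x y"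
    have b: "bump x e \<in> gauss_decay" for x :: "'n heis"
      using e by simp
    have le: "(\<Sum>x\<in>X. bump x e w) \<le> D * gauss 1 1 w" for w
    proof (cases "\<exists>x\<in>X. dist x w < e")
      case True
      then obtain x where x: "x \<in> X" "dist x w < e" by blast
      have "bump y e w = 0" if "y \<in> X - {x}" for y
      proof (rule bump_outside [OF e(1)])
        have "2 * e \<le> dist y x" using sep that x by auto
        also have "\<dots> \<le> dist y w + dist x w" by (rule dist_triangle2)
        finally show "e \<le> dist y w" using x by simp
      qed
      then have "(\<Sum>x\<in>X. bump x e w) = bump x e w"
        using X(1) x(1) by (simp add: sum.remove)
      also have "\<dots> \<le> 1" by (rule bump_le_1 [OF e(1)])
      also have "1 \<le> D * gauss 1 1 w"
      proof -
        have "dist 1 w \<le> R + 1"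
          using X(3) x e dist_triangle [of 1 w x] by auto
        then have "dist 1 w ^ 4 \<le> (R + 1) ^ 4"
          by (intro power_mono) auto
        then show ?thesis
          by (simp add: D_def gauss_def flip: exp_add)
      qed
      finally show ?thesis .
    next
      case False
      then have "(\<Sum>x\<in>X. bump x e w) = 0"
        by (intro sum.neutral ballI bump_outside e) (auto simp: not_less)
      then show ?thesis by (simp add: D_def)
    qed
    have "card X * (c * A * e powr s) \<le> (\<Sum>x\<in>X. I (bump x e))"
      using bump_ge X(2) e by (intro sum_bounded_below) auto
    also have "\<dots> = I (\<lambda>w. \<Sum>x\<in>X. bump x e w)"
      using pf_sum [OF pfI X(1) b] by simp
    also have "\<dots> \<le> I (\<lambda>w. D * gauss 1 1 w)"
      using le by (intro pf_mono [OF pfI gauss_decay_sum [OF b] gauss_decay_mult [OF gauss_in_decay]]) auto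
    also have "\<dots> = D * c"
      using pf_mult [OF pfI gauss_in_decay [of 1 1]] unif [OF one, of 1] by simp
    finally have "card X * (A * e powr s) \<le> D"
      using c by (simp add: mult_ac)
    then show "card X \<le> D / A * e powr (- s)"
      using A e by (simp add: powr_minus field_simps)
  qed
qed

text \<open>Covering: Gaussians of width e at the points of the net, multiplied by 4, add up to more
  than 1 at each support point of the unit ball and so dominate a fixed bump there, while each has
  average of order \<open>e powr s\<close>. The factor 4 only has to exceed
  \<open>exp 1\<close>.\<close>

lemma net_card_ge:
  fixes I :: "('n::finite heis \<Rightarrow> real) \<Rightarrow> real"
  assumes I: "uniform_functional s c I"
  shows "\<exists>C>0. \<forall>X e. finite X \<longrightarrow> X \<subseteq> fsupport I \<longrightarrow> 0 < e \<longrightarrow>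
    (\<forall>w\<in>fsupport I. dist 1 w \<le> 1 \<longrightarrow> (\<exists>x\<in>X. dist x w \<le> e)) \<longrightarrow> C * e powr (- s) \<le> card X"
proof -
  note pfI = uf_pf [OF I] and c = uf_pos [OF I] and one = uf_one [OF I] and unif = uf_gauss [OF I]
  have b: "bump 1 1 \<in> gauss_decay" by simp
  have b0: "0 < I (bump 1 1)"
    by (rule fsupportD [OF one b]) simp_all
  show ?thesis
  proof (intro exI conjI allI impI)
    show "0 < I (bump 1 1) / (4 * c)" using b0 c by simp
    fix X :: "'n heis set" and e :: real
    assume X: "finite X" "X \<subseteq> fsupport I" and e: "0 < e"
      and net: "\<forall>w\<in>fsupport I. dist 1 w \<le> 1 \<longrightarrow> (\<exists>x\<in>X. dist x w \<le> e)"
    define t where "t = 1 / e ^ 4"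
    have t: "0 < t" using e by (simp add: t_def)
    define S where "S w = (\<Sum>x\<in>X. 4 * gauss t x w)" for w
    have g: "gauss t x \<in> gauss_decay" for x :: "'n heis" using t by simp
    have g4: "(\<lambda>w. 4 * gauss t x w) \<in> gauss_decay" for x :: "'n heis"
      by (rule gauss_decay_mult [OF g])
    have S: "S \<in> gauss_decay" unfolding S_def by (rule gauss_decay_sum [OF g4])
    \<comment> \<open>The domination is known on the support only. The excess \<open>f\<close> is
      carried by a compact set disjoint from the support, so its average is 0.\<close>
    define f where "f w = max 0 (bump 1 1 w - S w)" for w
    have f: "f \<in> gauss_decay"
      unfolding f_def by (intro gauss_decay_max gauss_decay_diff b S)
    have S0: "0 \<le> S w" for w by (simp add: S_def sum_nonneg)
    define K where "K = cball 1 1 \<inter> {w. S w \<le> 1}"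
    have "I f = 0"
    proof (rule pf_zero_off_support [OF pfI f])
      have "closed {w. S w \<le> 1}"
        by (intro closed_Collect_le gauss_decay_cont S continuous_on_const)
      then show "compact K"
        unfolding K_def by (intro compact_Int_closed compact_cball_heis)
      show "K \<inter> fsupport I = {}"
      proof (rule ccontr)
        assume "K \<inter> fsupport I \<noteq> {}"
        then obtain w where w: "w \<in> fsupport I" "dist 1 w \<le> 1" "S w \<le> 1" by (auto simp: K_def)
        then obtain x where x: "x \<in> X" "dist x w \<le> e" using net by blast
        have "t * dist x w ^ 4 \<le> 1"
          using power_mono [OF x(2), of 4] e by (simp add: t_def)
        then have "exp (- 1) \<le> gauss t x w"
          by (simp add: gauss_def)
        moreover have "1 < 4 * exp (- 1 :: real)"
          using exp_le by (simp add: exp_minus field_simps)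
        ultimately have "1 < 4 * gauss t x w" by linarith
        also have "\<dots> \<le> S w"
          unfolding S_def using X(1) x(1) by (intro member_le_sum) auto
        finally show False using w by simp
      qed
      show "f w = 0" if "w \<notin> K" for w
      proof (cases "w \<in> cball 1 1")
        case True
        then have "1 < S w" using that by (auto simp: K_def)
        then show ?thesis using bump_le_1 [of 1 1 w] by (simp add: f_def)
      next
        case False
        then have "bump 1 1 w = 0" by (intro bump_outside) auto
        then show ?thesis using S0 [of w] by (simp add: f_def)
      qed
    qed
    have "I (bump 1 1) \<le> I (\<lambda>w. f w + S w)"
      by (rule pf_mono [OF pfI b gauss_decay_add [OF f S]]) (simp add: f_def)
    also have "\<dots> = I S"
      using pf_add [OF pfI f S] \<open>I f = 0\<close> by simp
    also have "\<dots> = (\<Sum>x\<in>X. 4 * I (gauss t x))"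
      unfolding S_def by (simp only: pf_sum [OF pfI X(1) g4] pf_mult [OF pfI g])
    also have "\<dots> = card X * (4 * (c * t powr (- s / 4)))"
      using X(2) unif t by (simp add: subset_iff)
    also have "t powr (- s / 4) = e powr s"
    proof -
      have "t = e powr (- 4)"
        using e by (simp add: t_def powr_minus powr_numeral divide_inverse)
      then show ?thesis by (simp add: powr_powr)
    qed
    finally show "I (bump 1 1) / (4 * c) * e powr (- s) \<le> card X"
      using c e by (simp add: powr_minus field_simps)
  qed
qed

text \<open>Take the points whose coordinates in an orthonormal basis are multiples of 1 / n and
  whose vertical coordinate is a multiple of \<open>1 / n\<^sup>2\<close>, within fixed bounds. At
  scale 1 / n they are separated and also form a net; the finer vertical step is why the centre
  contributes 2 to the exponent.\<close>

lemma hom_subgroup_lattice: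
  fixes G :: "'n::finite heis set"
  assumes G: "hom_subgroup G"
  obtains L :: nat and R D :: real and X where "0 < D"
    "\<And>n::nat. 0 < n \<Longrightarrow> finite (X n) \<and> X n \<subseteq> G \<and> X n \<subseteq> cball 1 R"
    "\<And>n x y. 0 < n \<Longrightarrow> x \<in> X n \<Longrightarrow> y \<in> X n \<Longrightarrow> x \<noteq> y \<Longrightarrow> 1 / n \<le> dist x y"
    "\<And>n w. 0 < n \<Longrightarrow> w \<in> G \<Longrightarrow> dist 1 w \<le> 1 \<Longrightarrow> \<exists>x\<in>X n. dist x w \<le> L / n"
    "\<And>n. 0 < n \<Longrightarrow> n ^ hom_dim G \<le> card (X n)" "0 < L"
    "\<And>n. 0 < n \<Longrightarrow> card (X n) \<le> D * real n ^ hom_dim G"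
proof -
  define V where "V = horiz ` G"
  have V: "subspace V" unfolding V_def by (rule subspace_horiz_hom_subgroup [OF G])
  obtain B where B: "B \<subseteq> V" "pairwise orthogonal B" "\<And>x. x \<in> B \<Longrightarrow> norm x = 1"
      "independent B" "card B = dim V" "span B = V"
    by (rule orthonormal_basis_subspace [OF V]) (rule that)
  have fin: "finite B" by (rule independent_imp_finite [OF B(4)])
  define k where "k = card B"
  \<comment> \<open>Room for the vertical shift: a point of the unit ball has vertical part at most
    1, and the form with a lattice point adds at most \<open>2 * k\<close>.\<close>
  define M where "M = 2 * k + 2"
  define P where "P n = PiE B (\<lambda>_. {- int n .. int n}) \<times>
    (if Heis 0 1 \<in> G then {- int (M * n\<^sup>2) .. int (M * n\<^sup>2)} else {0})" for n
  define h where "h n m = (\<Sum>b\<in>B. (of_int (m b) / real n) *\<^sub>R b)" for n and m :: "real ^ ('n + 'n) \<Rightarrow> int"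
  define p where "p n = (\<lambda>(m, l). Heis (h n m) (of_int l / (real n)\<^sup>2))" for n and x :: "_ \<times> int"
  define X where "X n = p n ` P n" for n
  have finP: "finite (P n)" for n
    by (simp add: P_def fin finite_PiE)
  have hV: "h n m \<in> V" for n m
    unfolding h_def using B(1) by (intro subspace_sum [OF V] subspace_scale [OF V]) auto
  have inner: "h n m \<bullet> b = of_int (m b) / real n" if b: "b \<in> B" for n m b
  proof -
    have "b' \<bullet> b = (if b' = b then 1 else 0)" if "b' \<in> B" for b'
      using B(2,3) b that by (auto simp: pairwise_def orthogonal_def norm_eq_1)
    then have "h n m \<bullet> b = (\<Sum>b'\<in>B. if b' = b then of_int (m b') / real n else 0)"
      unfolding h_def inner_sum_left by (intro sum.cong) auto
    then show ?thesis using fin b by simp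
  qed
  have norm_le: "norm (\<Sum>b\<in>B. f b *\<^sub>R b) \<le> k * e" if "\<And>b. b \<in> B \<Longrightarrow> \<bar>f b\<bar> \<le> e" for f and e :: real
  proof -
    have "norm (\<Sum>b\<in>B. f b *\<^sub>R b) \<le> (\<Sum>b\<in>B. \<bar>f b\<bar>)"
      by (rule order_trans [OF norm_sum]) (simp add: B(3))
    also have "\<dots> \<le> k * e"
      unfolding k_def using that by (rule sum_bounded_above)
    finally show ?thesis .
  qed
  have sep: "1 / n \<le> dist (p n q) (p n q')" if n: "0 < n" and q: "q \<in> P n" "q' \<in> P n" "q \<noteq> q'" for n q q'
  proof -
    obtain m l m' l' where ml: "q = (m, l)" "q' = (m', l')" by (cases q; cases q')
    show ?thesis
    proof (cases "m = m'")
      case False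
      have "m \<in> PiE B (\<lambda>_. {- int n .. int n})" "m' \<in> PiE B (\<lambda>_. {- int n .. int n})"
        using q by (auto simp: ml P_def)
      then obtain b where b: "b \<in> B" "m b \<noteq> m' b"
        using False PiE_ext by blast
      then have "1 \<le> \<bar>m' b - m b\<bar>" by linarith
      then have "1 \<le> \<bar>real_of_int (m' b) - of_int (m b)\<bar>" by linarith
      then have "1 / n \<le> \<bar>(h n m' - h n m) \<bullet> b\<bar>"
        using n by (simp add: inner_diff_left inner [OF b(1)] divide_right_mono flip: diff_divide_distrib)
      also have "\<dots> \<le> norm (h n m' - h n m) * norm b"
        by (rule Cauchy_Schwarz_ineq2)
      also have "\<dots> \<le> dist (p n q) (p n q')"
        using norm_horiz_le [of "p n q'" "p n q"] B(3) [OF b(1)] by (simp add: p_def ml)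
      finally show ?thesis .
    next
      case True
      then have "1 \<le> \<bar>l' - l\<bar>" using q(3) ml by auto
      then have "1 \<le> \<bar>real_of_int l' - of_int l\<bar>" by linarith
      then have 1: "1 \<le> (real_of_int l' - of_int l)\<^sup>2"
        by (metis abs_le_square_iff abs_one one_power2)
      \<comment> \<open>With equal horizontal parts the form vanishes, and the distance is purely
        vertical.\<close>
      have "dist (p n q) (p n q') ^ 4 = (of_int l' / (real n)\<^sup>2 - of_int l / (real n)\<^sup>2)\<^sup>2"
        unfolding dist_pow4 using True by (simp add: p_def ml heis_form_self)
      also have "\<dots> = (real_of_int l' - of_int l)\<^sup>2 * (1 / n) ^ 4"
        by (simp add: power_divide flip: diff_divide_distrib)
      finally have "(1 / n) ^ 4 \<le> dist (p n q) (p n q') ^ 4"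
        using mult_right_mono [OF 1, of "(1 / real n) ^ 4"] by simp
      then show ?thesis by (simp add: power_mono_iff)
    qed
  qed
  have inj: "inj_on (p n) (P n)" if "0 < n" for n
  proof (rule inj_onI, rule ccontr)
    fix q q' assume "q \<in> P n" "q' \<in> P n" "p n q = p n q'" "q \<noteq> q'"
    then show False using sep [OF that, of q q'] that by simp
  qed
  have cardX: "card (X n) = (2 * n + 1) ^ k * (if Heis 0 1 \<in> G then 2 * (M * n\<^sup>2) + 1 else 1)" if "0 < n" for n
  proof -
    have "card (X n) = card (P n)"
      unfolding X_def by (rule card_image [OF inj [OF that]])
    also have "\<dots> = (2 * n + 1) ^ k * (if Heis 0 1 \<in> G then 2 * (M * n\<^sup>2) + 1 else 1)"
    proof -
      have "card {- int a .. int a} = 2 * a + 1" for a by simp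
      then show ?thesis
        unfolding P_def card_cartesian_product card_PiE [OF fin]
        by (simp add: k_def del: card_atLeastAtMost_int of_nat_mult of_nat_power)
    qed
    finally show ?thesis .
  qed
  have dim: "hom_dim G = k + (if Heis 0 1 \<in> G then 2 else 0)"
    by (simp add: hom_dim_def k_def B(5) V_def)
  have PD: "\<bar>of_int (m b) / real n\<bar> \<le> 1"
    if n: "0 < n" and b: "b \<in> B" and q: "(m, l) \<in> P n" for n m l b
  proof -
    have "m b \<in> {- int n .. int n}"
      using q b by (auto simp: P_def PiE_iff)
    then have "\<bar>m b\<bar> \<le> int n" by auto
    then have "\<bar>real_of_int (m b)\<bar> \<le> real n" by linarith
    then show "\<bar>of_int (m b) / real n\<bar> \<le> 1"
      using n by (simp add: divide_le_eq)
  qed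
  have PD': "\<bar>of_int l / (real n)\<^sup>2\<bar> \<le> M" "Heis 0 1 \<in> G \<or> l = 0"
    if n: "0 < n" and q: "(m, l) \<in> P n" for n m l
  proof -
    show "Heis 0 1 \<in> G \<or> l = 0"
      using q by (simp add: P_def split: if_splits)
    have "\<bar>l\<bar> \<le> int (M * n\<^sup>2)"
      using q by (auto simp: P_def abs_le_iff split: if_splits)
    then have "\<bar>real_of_int l\<bar> \<le> real (M * n\<^sup>2)" by linarith
    then show "\<bar>of_int l / (real n)\<^sup>2\<bar> \<le> M"
      using n by (simp add: divide_le_eq)
  qed
  have norm_h: "norm (h n m) \<le> k" if "0 < n" "(m, l) \<in> P n" for n m l
    unfolding h_def using norm_le [of "\<lambda>b. of_int (m b) / real n" 1] PD [OF that(1) _ that(2)] by simp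
  \<comment> \<open>Crude: a distance of at least 1 is at most its own fourth power, and smaller
    ones are covered by the summand 1.\<close>
  define R where "R = real k ^ 4 + (real M)\<^sup>2 + 1"
  show ?thesis
  proof
    show "finite (X n) \<and> X n \<subseteq> G \<and> X n \<subseteq> cball 1 R" if n: "0 < n" for n
    proof (intro conjI subsetI)
      show "finite (X n)" by (simp add: X_def finP)
      fix x assume "x \<in> X n"
      then obtain m l where x: "(m, l) \<in> P n" "x = Heis (h n m) (of_int l / (real n)\<^sup>2)"
        by (auto simp: X_def p_def)
      show "x \<in> G"
        by (subst hom_subgroup_eq [OF G]) (use hV PD'(2) [OF n x(1)] x(2) in \<open>auto simp: V_def\<close>)
      have "norm (h n m) ^ 4 + (of_int l / (real n)\<^sup>2)\<^sup>2 \<le> real k ^ 4 + (real M)\<^sup>2"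
        using PD'(1) [OF n x(1)] abs_le_square_iff [of "of_int l / (real n)\<^sup>2" M]
        by (intro add_mono power_mono [OF norm_h [OF n x(1)] norm_ge_zero]) simp
      then have "dist 1 x ^ 4 \<le> real k ^ 4 + (real M)\<^sup>2"
        unfolding dist_pow4 by (simp only: x(2) horiz_one vert_one heis.sel heis_form_zero diff_zero)
      moreover have "dist 1 x \<le> dist 1 x ^ 4" if "1 \<le> dist 1 x"
        using power_increasing [OF _ that, of 1 4] by simp
      moreover have "0 \<le> real k ^ 4 + (real M)\<^sup>2" by simp
      ultimately have "dist 1 x \<le> R"
        unfolding R_def by linarith
      then show "x \<in> cball 1 R" by simp
    qed
    show "1 / n \<le> dist x y" if "0 < n" "x \<in> X n" "y \<in> X n" "x \<noteq> y" for n x y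
      using that sep unfolding X_def by blast
    show "\<exists>x\<in>X n. dist x w \<le> real (k + 1) / n" if n: "0 < n" and w: "w \<in> G" "dist 1 w \<le> 1" for n w
    proof -
      have hw: "horiz w \<in> V" "norm (horiz w) \<le> 1"
        using w norm_horiz_le [of w 1] by (auto simp: V_def)
      have vw: "\<bar>vert w\<bar> \<le> 1"
        using vert_diff_le [of w 1] power_mono [OF w(2), of 2] by simp
      define m where "m = restrict (\<lambda>b. \<lfloor>(horiz w \<bullet> b) * n\<rfloor>) B"
      have mb: "\<bar>horiz w \<bullet> b\<bar> \<le> 1" if "b \<in> B" for b
        using Cauchy_Schwarz_ineq2 [of "horiz w" b] B(3) [OF that] hw by simp
      have mP: "m \<in> PiE B (\<lambda>_. {- int n .. int n})"
      proof (rule PiE_I)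
        fix b assume b: "b \<in> B"
        have "- real n \<le> (horiz w \<bullet> b) * n" "(horiz w \<bullet> b) * n \<le> real n"
          using mult_right_mono [of "-1" "horiz w \<bullet> b" "real n"] mult_right_mono [of "horiz w \<bullet> b" 1 "real n"] mb [OF b]
          by (auto simp: abs_le_iff)
        then show "m b \<in> {- int n .. int n}"
          using b by (simp add: m_def le_floor_iff floor_le_iff)
      qed (simp add: m_def)
      have m_close: "\<bar>horiz w \<bullet> b - of_int (m b) / real n\<bar> \<le> 1 / n" if b: "b \<in> B" for b
      proof -
        have "\<bar>(horiz w \<bullet> b) * n - of_int (m b)\<bar> \<le> 1"
          using b by (simp add: m_def) linarith
        then have "\<bar>((horiz w \<bullet> b) * n - of_int (m b)) / n\<bar> \<le> 1 / n"
          by (simp add: abs_divide divide_right_mono)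
        then show ?thesis
          using n by (simp add: diff_divide_distrib)
      qed
      have "horiz w - h n m = (\<Sum>b\<in>B. (horiz w \<bullet> b - of_int (m b) / real n) *\<^sub>R b)"
        using orthonormal_basis_expand [OF B(2,3) _ fin, of "horiz w"] hw B(6)
        by (simp add: h_def scaleR_diff_left sum_subtractf)
      then have hdiff: "norm (horiz w - h n m) \<le> k * (1 / n)"
        using norm_le [of "\<lambda>b. horiz w \<bullet> b - of_int (m b) / real n" "1 / n"] m_close by simp
      have nh: "norm (h n m) \<le> k"
        by (rule norm_h [OF n, of _ 0]) (use mP in \<open>simp add: P_def\<close>)
      \<comment> \<open>The number to be rounded is not \<open>vert w\<close> but its value relative
        to the lattice points above \<open>h n m\<close>, which the group law twists by the
        form.\<close>
      define \<tau> where "\<tau> = vert w - heis_form (h n m) (horiz w)"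
      have "\<bar>heis_form (h n m) (horiz w)\<bar> \<le> 2 * real k * 1"
        using heis_form_bound [of "h n m" "horiz w"] mult_mono [OF nh hw(2)] by (simp add: mult.assoc)
      then have tau: "\<bar>\<tau>\<bar> \<le> M"
        using vw by (simp add: \<tau>_def M_def)
      obtain l where l: "(m, l) \<in> P n" "\<bar>\<tau> - of_int l / (real n)\<^sup>2\<bar> \<le> (1 / n)\<^sup>2"
      proof (cases "Heis 0 1 \<in> G")
        case True
        define l where "l = \<lfloor>\<tau> * (real n)\<^sup>2\<rfloor>"
        have "\<bar>\<tau> * (real n)\<^sup>2\<bar> \<le> M * (real n)\<^sup>2"
          using tau by (simp add: abs_mult mult_right_mono)
        then have "- real (M * n\<^sup>2) \<le> \<tau> * (real n)\<^sup>2" "\<tau> * (real n)\<^sup>2 \<le> real (M * n\<^sup>2)"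
          by (auto simp: abs_le_iff)
        then have "l \<in> {- int (M * n\<^sup>2) .. int (M * n\<^sup>2)}"
          unfolding l_def by (simp only: atLeastAtMost_iff le_floor_iff floor_le_iff) auto
        moreover have "\<bar>\<tau> - of_int l / (real n)\<^sup>2\<bar> \<le> (1 / n)\<^sup>2"
        proof -
          have "\<bar>\<tau> * (real n)\<^sup>2 - of_int l\<bar> \<le> 1"
            unfolding l_def by linarith
          then have "\<bar>(\<tau> * (real n)\<^sup>2 - of_int l) / (real n)\<^sup>2\<bar> \<le> 1 / (real n)\<^sup>2"
            by (simp add: abs_divide divide_right_mono)
          then show ?thesis
            using n by (simp add: diff_divide_distrib power_divide)
        qed
        ultimately show ?thesis
          using that [of l] mP True by (simp add: P_def)
      next
        case False
        \<comment> \<open>Without the centre the only choice is l = 0, but then the horizontal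
          subspace is isotropic and \<open>\<tau>\<close> is 0.\<close>
        have "heis_form (h n m) (horiz w) = 0"
          using hom_subgroup_isotropic [OF G False] hV hw by (simp add: V_def)
        moreover have "vert w = 0"
          using w(1) False hom_subgroup_eq [OF G] by blast
        ultimately show ?thesis
          using that [of 0] mP False by (simp add: P_def \<tau>_def)
      qed
      define x where "x = p n (m, l)"
      have "dist x w ^ 4 = norm (horiz w - h n m) ^ 4 + (\<tau> - of_int l / (real n)\<^sup>2)\<^sup>2"
        unfolding dist_pow4 by (simp add: x_def p_def \<tau>_def algebra_simps)
      also have "\<dots> \<le> (k * (1 / n)) ^ 4 + ((1 / n)\<^sup>2)\<^sup>2"
        using power_mono [OF hdiff, of 4] l(2) abs_le_square_iff [of "\<tau> - of_int l / (real n)\<^sup>2" "(1 / real n)\<^sup>2"]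
        by (intro add_mono) auto
      also have "\<dots> = (real k ^ 4 + 1 ^ 4) * (1 / n) ^ 4"
        unfolding power_mult_distrib distrib_right by simp
      also have "\<dots> \<le> (real k + 1) ^ 4 * (1 / n) ^ 4"
        by (intro mult_right_mono) (auto simp: power4_eq_xxxx algebra_simps)
      also have "\<dots> = (real (k + 1) / n) ^ 4"
        by (simp add: power_divide add.commute)
      finally have "dist x w \<le> real (k + 1) / n"
        by (simp add: power_mono_iff)
      moreover have "x \<in> X n" using l(1) by (auto simp: x_def X_def)
      ultimately show ?thesis by blast
    qed
    show "n ^ hom_dim G \<le> card (X n)" if n: "0 < n" for n
    proof -
      have "n ^ k \<le> (2 * n + 1) ^ k" by (intro power_mono) auto
      moreover have "n ^ (if Heis 0 1 \<in> G then 2 else 0) \<le> (if Heis 0 1 \<in> G then 2 * (M * n\<^sup>2) + 1 else 1)"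
        by (simp add: M_def)
      ultimately show ?thesis
        unfolding cardX [OF n] dim power_add by (rule mult_le_mono)
    qed
    show "card (X n) \<le> (3 ^ k * (2 * real M + 1)) * real n ^ hom_dim G" if n: "0 < n" for n
    proof -
      have n1: "1 \<le> real n" using n by simp
      have 1: "(2 * real n + 1) ^ k \<le> (3 * real n) ^ k"
        using n1 by (intro power_mono) auto
      have "1 \<le> (real n)\<^sup>2" using n1 by simp
      then have 2: "2 * (real M * (real n)\<^sup>2) + 1 \<le> (2 * real M + 1) * (real n)\<^sup>2"
        by (simp add: algebra_simps)
      show ?thesis
      proof (cases "Heis 0 1 \<in> G")
        case True
        have "real (card (X n)) = (2 * real n + 1) ^ k * (2 * (real M * (real n)\<^sup>2) + 1)"
          using cardX [OF n] True by (simp add: algebra_simps)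
        also have "\<dots> \<le> (3 * real n) ^ k * ((2 * real M + 1) * (real n)\<^sup>2)"
          using 1 2 by (intro mult_mono) auto
        finally show ?thesis
          using True by (simp add: dim power_add power_mult_distrib power2_eq_square mult_ac)
      next
        case False
        have "real (card (X n)) = (2 * real n + 1) ^ k * 1"
          using cardX [OF n] False by (simp add: add.commute)
        also have "\<dots> \<le> (3 * real n) ^ k * (2 * real M + 1)"
          using 1 by (intro mult_mono) auto
        finally show ?thesis
          using False by (simp add: dim power_mult_distrib mult_ac)
      qed
    qed
  qed simp_all
qed

section \<open>Comparison of growth exponents\<close>

lemma powr_growth_le:
  assumes "0 < a" and le: "\<And>n::nat. 0 < n \<Longrightarrow> a * real n powr p \<le> b * real n powr q"
  shows "p \<le> q"
proof (rule ccontr)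
  assume "\<not> p \<le> q"
  then have "0 < p - q" by simp
  then have "filterlim (\<lambda>n. real n powr (p - q)) at_top sequentially"
    by real_asymp
  then have "\<forall>\<^sub>F n in sequentially. b / a < real n powr (p - q)"
    by (simp add: filterlim_at_top_dense)
  then have "\<forall>\<^sub>F n in sequentially. 0 < n \<and> b / a < real n powr (p - q)"
    by (intro eventually_conj eventually_gt_at_top)
  then obtain n :: nat where n: "0 < n" "b / a < real n powr (p - q)"
    using eventually_happens [of _ "sequentially"] by auto
  then have "b * real n powr q < a * real n powr p"
    using assms(1) by (simp add: powr_diff field_simps)
  then show False using le [OF n(1)] by simp
qed

text \<open>The lattice, used for packing with balls of radius 1 / (2 n), gives
  \<open>hom_dim G \<le> s\<close>; used as a net at scale L / n it gives the reverse
  inequality.\<close>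

theorem uniform_functional_dim:
  fixes I :: "('n::finite heis \<Rightarrow> real) \<Rightarrow> real"
  assumes I: "uniform_functional s c I" and G: "hom_subgroup G" "fsupport I = G"
  shows "s = hom_dim G"
proof -
  obtain L R D X where X: "0 < (D::real)"
    "\<And>n::nat. 0 < n \<Longrightarrow> finite (X n) \<and> X n \<subseteq> G \<and> X n \<subseteq> cball 1 R"
    "\<And>n x y. 0 < n \<Longrightarrow> x \<in> X n \<Longrightarrow> y \<in> X n \<Longrightarrow> x \<noteq> y \<Longrightarrow> 1 / n \<le> dist x y"
    "\<And>n w. 0 < n \<Longrightarrow> w \<in> G \<Longrightarrow> dist 1 w \<le> 1 \<Longrightarrow> \<exists>x\<in>X n. dist x w \<le> real L / n"
    "\<And>n. 0 < n \<Longrightarrow> n ^ hom_dim G \<le> card (X n)" "0 < L"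
    "\<And>n. 0 < n \<Longrightarrow> card (X n) \<le> D * real n ^ hom_dim G"
    by (rule hom_subgroup_lattice [OF G(1)]) (rule that)
  obtain C where C: "\<forall>X e. finite X \<longrightarrow> X \<subseteq> fsupport I \<longrightarrow> X \<subseteq> cball 1 R \<longrightarrow> 0 < e \<longrightarrow> e \<le> 1 \<longrightarrow>
    (\<forall>x\<in>X. \<forall>y\<in>X. x \<noteq> y \<longrightarrow> 2 * e \<le> dist x y) \<longrightarrow> card X \<le> C * e powr (- s)"
    using separated_set_card_le [OF I, of R] ..
  obtain E where E: "0 < E" "\<forall>X e. finite X \<longrightarrow> X \<subseteq> fsupport I \<longrightarrow> 0 < e \<longrightarrow>
    (\<forall>w\<in>fsupport I. dist 1 w \<le> 1 \<longrightarrow> (\<exists>x\<in>X. dist x w \<le> e)) \<longrightarrow> E * e powr (- s) \<le> card X"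
    using net_card_ge [OF I] by (elim exE conjE)
  have "real (hom_dim G) \<le> s"
  proof (rule powr_growth_le [of 1 _ "C * 2 powr s"])
    fix n :: nat assume n: "0 < n"
    have "real (n ^ hom_dim G) \<le> card (X n)"
      using X(5) [OF n] by (simp only: of_nat_le_iff)
    also have "\<dots> \<le> C * (1 / (2 * real n)) powr (- s)"
      using X(2) [OF n] X(3) [OF n] n by (intro C [rule_format]) (auto simp: G(2))
    also have "\<dots> = C * 2 powr s * real n powr s"
      using n by (simp add: powr_divide powr_minus powr_mult)
    finally show "1 * real n powr real (hom_dim G) \<le> C * 2 powr s * real n powr s"
      using n by (simp add: powr_realpow)
  qed simp
  moreover have "s \<le> real (hom_dim G)"
  proof (rule powr_growth_le [of "E * real L powr (- s)" _ D])
    show "0 < E * real L powr (- s)" using E X by simp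
    fix n :: nat assume n: "0 < n"
    have "E * real L powr (- s) * real n powr s = E * (real L / n) powr (- s)"
      using n X(6) powr_divide [of "real L" "real n" "- s"] powr_minus [of "real n" s]
      by (simp add: field_simps)
    also have "\<dots> \<le> card (X n)"
      using X(2,4) n X(6) by (intro E(2) [rule_format]) (auto simp: G(2))
    also have "\<dots> \<le> D * real n ^ hom_dim G"
      by (rule X(7) [OF n])
    finally show "E * real L powr (- s) * real n powr s \<le> D * real n powr real (hom_dim G)"
      using n by (simp add: powr_realpow)
  qed
  ultimately show ?thesis by simp
qed

section \<open>Gaussian integrals and ball growth\<close>

text \<open>\<open>gauss t x w\<close> is the integral of \<open>exp (- v)\<close> over the v above
  \<open>t * dist x w ^ 4\<close>; after Fubini the sublevel sets in w are balls.\<close>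

lemma nn_integral_gauss_layer_cake:
  fixes M :: "'n::finite heis measure"
  assumes fin: "finite_measure M" and M: "sets M = sets borel" and t: "0 < t"
  shows "(\<integral>\<^sup>+w. ennreal (gauss t x w) \<partial>M) =
    (\<integral>\<^sup>+v. ennreal (exp (- v)) * (indicator {0..} v * emeasure M (cball x (root 4 (v / t)))) \<partial>lborel)"
proof -
  interpret finite_measure M by fact
  interpret pair_sigma_finite M lborel ..
  define a where "a w = t * dist x w ^ 4" for w
  have a: "a \<in> borel_measurable M"
  proof -
    have "continuous_on UNIV a" unfolding a_def by (intro continuous_intros)
    then show ?thesis
      using borel_measurable_continuous_onI M by (simp cong: measurable_cong_sets)
  qed
  have "ennreal (gauss t x w) = (\<integral>\<^sup>+v. ennreal (exp (- v)) * indicator {a w ..} v \<partial>lborel)" for w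
  proof -
    have "((\<lambda>v. - exp (- v)) \<longlongrightarrow> - (0 :: real)) at_top"
      by (intro tendsto_minus filterlim_compose [OF exp_at_bot] filterlim_uminus_at_bot_at_top)
    then have "(\<integral>\<^sup>+v. ennreal (exp (- v)) * indicator {a w ..} v \<partial>lborel) = ennreal (- 0 - (- exp (- a w)))"
      by (intro nn_integral_FTC_atLeast) (auto intro!: derivative_eq_intros)
    then show ?thesis
      by (simp add: gauss_def a_def)
  qed
  then have "(\<integral>\<^sup>+w. ennreal (gauss t x w) \<partial>M) =
      (\<integral>\<^sup>+w. (\<integral>\<^sup>+v. ennreal (exp (- v)) * (if a w \<le> v then 1 else 0) \<partial>lborel) \<partial>M)"
    by (simp add: indicator_def of_bool_def)
  also have "\<dots> = (\<integral>\<^sup>+v. (\<integral>\<^sup>+w. ennreal (exp (- v)) * (if a w \<le> v then 1 else 0) \<partial>M) \<partial>lborel)"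
    by (rule Fubini' [symmetric]) (use a in measurable)
  also have "\<dots> = (\<integral>\<^sup>+v. ennreal (exp (- v)) * (indicator {0..} v * emeasure M (cball x (root 4 (v / t)))) \<partial>lborel)"
  proof (rule nn_integral_cong)
    fix v :: real
    have "(\<integral>\<^sup>+w. ennreal (exp (- v)) * (if a w \<le> v then 1 else 0) \<partial>M) =
        (\<integral>\<^sup>+w. ennreal (exp (- v)) * indicator {w \<in> space M. a w \<le> v} w \<partial>M)"
      by (intro nn_integral_cong) (simp add: indicator_def)
    also have "\<dots> = ennreal (exp (- v)) * emeasure M {w \<in> space M. a w \<le> v}"
      using a by (intro nn_integral_cmult_indicator) measurable
    also have "emeasure M {w \<in> space M. a w \<le> v} = indicator {0..} v * emeasure M (cball x (root 4 (v / t)))"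
    proof (cases "0 \<le> v")
      case True
      have "a w \<le> v \<longleftrightarrow> dist x w \<le> root 4 (v / t)" for w
      proof -
        have "a w \<le> v \<longleftrightarrow> dist x w ^ 4 \<le> v / t"
          using t by (simp add: a_def field_simps)
        also have "\<dots> \<longleftrightarrow> root 4 (dist x w ^ 4) \<le> root 4 (v / t)"
          by (rule real_root_le_iff [symmetric]) simp
        also have "root 4 (dist x w ^ 4) = dist x w"
          by (rule real_root_power_cancel) auto
        finally show ?thesis .
      qed
      then have "{w \<in> space M. a w \<le> v} = cball x (root 4 (v / t))"
        using sets_eq_imp_space_eq [OF M] by auto
      then show ?thesis using True by simp
    next
      case False
      then have "{w \<in> space M. a w \<le> v} = {}"
        using t by (auto simp: a_def not_le intro: less_le_trans)
      then show ?thesis using False by (simp only: emeasure_empty) simp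
    qed
    finally show "(\<integral>\<^sup>+w. ennreal (exp (- v)) * (if a w \<le> v then 1 else 0) \<partial>M) =
        ennreal (exp (- v)) * (indicator {0..} v * emeasure M (cball x (root 4 (v / t))))" .
  qed
  finally show ?thesis .
qed

text \<open>The model case of balls of mass exactly \<open>r powr p\<close>. It is the source of the
  constant \<open>\<theta> * Gamma (s / 4 + 1)\<close> in the law for blow-ups.\<close>

lemma nn_integral_Gamma:
  assumes p: "0 < p" and t: "0 < t"
  shows "(\<integral>\<^sup>+v. ennreal (indicator {0..} v * (exp (- v) * (v / t) powr (p / 4))) \<partial>lborel) =
    ennreal (Gamma (p / 4 + 1) * t powr (- p / 4))"
proof -
  have "((\<lambda>v. t powr (- p / 4) * (v powr (p / 4 + 1 - 1) / exp v)) has_integral t powr (- p / 4) * Gamma (p / 4 + 1)) {0..}"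
    using p by (intro has_integral_mult_right Gamma_integral_real) simp
  then have "(\<integral>\<^sup>+v. ennreal (indicator {0..} v * (t powr (- p / 4) * (v powr (p / 4 + 1 - 1) / exp v))) \<partial>lborel) =
      ennreal (t powr (- p / 4) * Gamma (p / 4 + 1))"
    by (intro nn_integral_has_integral_lebesgue) auto
  moreover have "indicator {0..} v * (t powr (- p / 4) * (v powr (p / 4 + 1 - 1) / exp v)) =
      indicator {0..} v * (exp (- v) * (v / t) powr (p / 4))" for v
  proof (cases "0 \<le> v")
    case True
    have "t powr (- p / 4) = inverse (t powr (p / 4))"
      using powr_minus [of t "p / 4"] by simp
    then show ?thesis
      using True t by (simp add: powr_divide exp_minus field_simps)
  qed simp
  ultimately show ?thesis
    by (simp add: mult.commute)
qed

lemma integrable_gauss_decay: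
  fixes M :: "'n::finite heis measure"
  assumes fin: "finite_measure M" and M: "sets M = sets borel" and f: "f \<in> gauss_decay"
  shows "integrable M f"
proof -
  interpret finite_measure M by fact
  obtain t C where C: "0 < t" "0 \<le> C" "\<And>w. \<bar>f w\<bar> \<le> C * gauss t 1 w"
    by (rule gauss_decayE [OF f], rule that)
  have "\<bar>f w\<bar> \<le> C" for w
    using C(3) [of w] mult_left_mono [OF gauss_le_1 [of t 1 w] C(2)] C(1) by simp
  moreover have "f \<in> borel_measurable M"
    using borel_measurable_continuous_onI [OF gauss_decay_cont [OF f]] M
    by (simp cong: measurable_cong_sets)
  ultimately show ?thesis
    by (intro integrable_const_bound [of _ C]) auto
qed

lemma positive_functional_integral:
  fixes M :: "'n::finite heis measure"
  assumes "finite_measure M" "sets M = sets borel"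
  shows "positive_functional (\<lambda>f. \<integral>w. f w \<partial>M)"
  using integrable_gauss_decay [OF assms]
  by (auto simp: positive_functional_def intro!: integral_nonneg_AE)

text \<open>Transfers estimates from balls to Gaussians. The term with \<kappa> is the error at
  small radii; the term of order s + 1 pays for large radii, where only the total mass is known, and
  gains a factor r under rescaling.\<close>

lemma gauss_integral_estimate:
  fixes M :: "'n::finite heis measure"
  assumes fin: "finite_measure M" and M: "sets M = sets borel" and t: "0 < t" and s: "0 < s"
    and nonneg: "0 \<le> \<theta>" "0 \<le> \<kappa>" "0 \<le> L"
    and near: "\<And>r. 0 < r \<Longrightarrow> \<bar>measure M (cball x r) - \<theta> * r powr s\<bar> \<le> \<kappa> * r powr s + L * r powr (s + 1)"
  shows "\<bar>(\<integral>w. gauss t x w \<partial>M) - \<theta> * Gamma (s / 4 + 1) * t powr (- s / 4)\<bar> \<le>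
    \<kappa> * Gamma (s / 4 + 1) * t powr (- s / 4) + L * Gamma ((s + 1) / 4 + 1) * t powr (- (s + 1) / 4)"
proof -
  interpret finite_measure M by fact
  define m where "m v = measure M (cball x (root 4 (v / t)))" for v
  define W where "W p v = indicator {0..} v * (exp (- v) * (v / t) powr (p / 4))" for p v :: real
  define A where "A = Gamma (s / 4 + 1) * t powr (- s / 4)"
  define A' where "A' = Gamma ((s + 1) / 4 + 1) * t powr (- (s + 1) / 4)"
  have A: "0 \<le> A" "0 \<le> A'"
  proof -
    have "0 < s / 4 + 1" "0 < (s + 1) / 4 + 1" using s by (simp_all add: add_pos_pos)
    then show "0 \<le> A" "0 \<le> A'"
      by (simp_all add: A_def A'_def Gamma_real_nonneg)
  qed
  have WA: "(\<integral>\<^sup>+v. ennreal (W s v) \<partial>lborel) = ennreal A" "(\<integral>\<^sup>+v. ennreal (W (s + 1) v) \<partial>lborel) = ennreal A'"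
    unfolding W_def A_def A'_def using s t by (simp_all only: nn_integral_Gamma add_pos_pos zero_less_one)
  have Wm [measurable]: "W p \<in> borel_measurable borel" for p
    unfolding W_def by measurable
  have W0: "0 \<le> W p v" for p v by (simp add: W_def)
  define N where "N = (\<integral>w. gauss t x w \<partial>M)"
  have N0: "0 \<le> N" unfolding N_def by simp
  define g where "g v = indicator {0..} v * exp (- v) * m v" for v
  have g0: "0 \<le> g v" for v by (simp add: g_def m_def)
  have mono_m: "m v \<le> m v'" if "v \<le> v'" for v v'
  proof -
    have "root 4 (v / t) \<le> root 4 (v' / t)"
      using that t by (intro real_root_le_mono divide_right_mono) auto
    then show ?thesis
      unfolding m_def using M by (intro finite_measure_mono subset_cball) auto
  qed
  then have "mono m" by (rule monoI)
  then have [measurable]: "m \<in> borel_measurable borel" by (rule borel_measurable_mono)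
  have [measurable]: "g \<in> borel_measurable borel" unfolding g_def by measurable
  have "ennreal N = (\<integral>\<^sup>+w. ennreal (gauss t x w) \<partial>M)"
    unfolding N_def using integrable_gauss_decay [OF fin M gauss_in_decay [OF t]]
    by (intro nn_integral_eq_integral [symmetric]) auto
  also have "\<dots> = (\<integral>\<^sup>+v. ennreal (g v) \<partial>lborel)"
    unfolding nn_integral_gauss_layer_cake [OF fin M t]
    by (intro nn_integral_cong)
      (simp add: g_def m_def emeasure_eq_measure ennreal_mult' split: split_indicator)
  finally have Ng: "ennreal N = (\<integral>\<^sup>+v. ennreal (g v) \<partial>lborel)" .
  \<comment> \<open>At v = 0 the radius is 0, where \<open>near\<close> says nothing; a single point
    is negligible.\<close>
  have AE: "AE v in lborel. v \<noteq> (0::real)"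
    by (rule AE_lborel_singleton)
  have gW: "g v \<le> (\<theta> + \<kappa>) * W s v + L * W (s + 1) v" "\<theta> * W s v \<le> g v + (\<kappa> * W s v + L * W (s + 1) v)"
    if v: "v \<noteq> 0" for v
  proof -
    have "g v \<le> (\<theta> + \<kappa>) * W s v + L * W (s + 1) v \<and> \<theta> * W s v \<le> g v + (\<kappa> * W s v + L * W (s + 1) v)"
    proof (cases "0 \<le> v")
      case True
      then have vt: "0 < v / t" using v t by simp
      define r where "r = root 4 (v / t)"
      have r: "0 < r" using vt by (simp add: r_def)
      have rp: "r powr p = (v / t) powr (p / 4)" for p
        unfolding r_def using root_powr_inverse [of 4 "v / t"] vt by (simp add: powr_powr)
      have W: "W p v = exp (- v) * r powr p" for p
        using True by (simp add: W_def rp)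
      have g: "g v = exp (- v) * m v" using True by (simp add: g_def)
      have mr: "\<bar>m v - \<theta> * r powr s\<bar> \<le> \<kappa> * r powr s + L * r powr (s + 1)"
        unfolding m_def r_def [symmetric] by (rule near [OF r])
      have "exp (- v) * m v \<le> exp (- v) * ((\<theta> + \<kappa>) * r powr s + L * r powr (s + 1))"
        using mr by (intro mult_left_mono) (auto simp: distrib_right)
      moreover have "exp (- v) * (\<theta> * r powr s) \<le> exp (- v) * (m v + (\<kappa> * r powr s + L * r powr (s + 1)))"
        using mr by (intro mult_left_mono) (auto simp: distrib_right)
      ultimately show ?thesis
        unfolding W g by (simp add: algebra_simps)
    qed (simp add: g_def W_def)
    then show "g v \<le> (\<theta> + \<kappa>) * W s v + L * W (s + 1) v" "\<theta> * W s v \<le> g v + (\<kappa> * W s v + L * W (s + 1) v)"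
      by auto
  qed
  have lin: "(\<integral>\<^sup>+v. ennreal (a * W s v + b * W (s + 1) v) \<partial>lborel) = ennreal (a * A + b * A')"
    if "0 \<le> a" "0 \<le> b" for a b
  proof -
    have "(\<integral>\<^sup>+v. ennreal (a * W s v + b * W (s + 1) v) \<partial>lborel) =
        (\<integral>\<^sup>+v. ennreal a * ennreal (W s v) + ennreal b * ennreal (W (s + 1) v) \<partial>lborel)"
      using that W0 by (intro nn_integral_cong) (simp add: ennreal_mult' ennreal_plus)
    also have "\<dots> = ennreal a * ennreal A + ennreal b * ennreal A'"
      by (simp add: nn_integral_add nn_integral_cmult WA)
    finally show ?thesis using that A by (simp add: ennreal_mult' ennreal_plus)
  qed
  have "ennreal N \<le> (\<integral>\<^sup>+v. ennreal ((\<theta> + \<kappa>) * W s v + L * W (s + 1) v) \<partial>lborel)"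
    unfolding Ng by (intro nn_integral_mono_AE eventually_mono [OF AE] ennreal_leI gW(1))
  also have "\<dots> = ennreal ((\<theta> + \<kappa>) * A + L * A')"
    using nonneg by (intro lin) auto
  finally have up: "N \<le> (\<theta> + \<kappa>) * A + L * A'"
    by (subst (asm) ennreal_le_iff) (use nonneg A in auto)
  have "(\<integral>\<^sup>+v. ennreal (\<theta> * W s v + 0 * W (s + 1) v) \<partial>lborel) \<le>
      (\<integral>\<^sup>+v. ennreal (g v) + ennreal (\<kappa> * W s v + L * W (s + 1) v) \<partial>lborel)"
  proof (intro nn_integral_mono_AE)
    show "AE v in lborel. ennreal (\<theta> * W s v + 0 * W (s + 1) v) \<le> ennreal (g v) + ennreal (\<kappa> * W s v + L * W (s + 1) v)"
      using AE
    proof eventually_elim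
      case (elim v)
      have "ennreal (g v) + ennreal (\<kappa> * W s v + L * W (s + 1) v) = ennreal (g v + (\<kappa> * W s v + L * W (s + 1) v))"
        using nonneg W0 g0 by (intro ennreal_plus [symmetric]) auto
      then show ?case
        using gW(2) [OF elim] by (simp add: ennreal_leI)
    qed
  qed
  also have "\<dots> = ennreal N + ennreal (\<kappa> * A + L * A')"
    using nonneg by (simp add: nn_integral_add Ng lin)
  finally have "ennreal (\<theta> * A + 0 * A') \<le> ennreal N + ennreal (\<kappa> * A + L * A')"
    using nonneg by (subst (asm) lin) auto
  then have "\<theta> * A \<le> N + (\<kappa> * A + L * A')"
    using nonneg A N0 by (simp add: ennreal_le_iff flip: ennreal_plus)
  then have "\<bar>N - \<theta> * A\<bar> \<le> \<kappa> * A + L * A'"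
    using up by (simp add: distrib_right abs_le_iff)
  then show ?thesis
    by (simp add: N_def A_def A'_def mult.assoc)
qed

section \<open>Uniform convergence of the density\<close>

text \<open>Monotonicity under ball inclusion compares the radius r at the limit point with the
  radius \<open>r - dist x (X n)\<close> at \<open>X n\<close>. The function \<phi> is abstract
  because it stands for the mass of a ball and also for the mass of a ball outside a set.\<close>

lemma closed_ball_growth_ge:
  fixes \<phi> :: "'a::metric_space \<Rightarrow> real \<Rightarrow> real"
  assumes mono: "\<And>x y r r'. dist x y + r' \<le> r \<Longrightarrow> \<phi> y r' \<le> \<phi> x r"
  shows "closed {x. \<forall>r. 0 < r \<and> r < \<delta> \<longrightarrow> q * r powr s \<le> \<phi> x r}"
  unfolding closed_sequential_limits
proof (intro allI impI, elim conjE)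
  fix X :: "nat \<Rightarrow> 'a" and x
  assume X: "\<forall>n. X n \<in> {x. \<forall>r. 0 < r \<and> r < \<delta> \<longrightarrow> q * r powr s \<le> \<phi> x r}" and lim: "X \<longlonglongrightarrow> x"
  have d: "(\<lambda>n. dist x (X n)) \<longlonglongrightarrow> 0"
    using tendsto_dist [OF tendsto_const lim, of x] by simp
  show "x \<in> {x. \<forall>r. 0 < r \<and> r < \<delta> \<longrightarrow> q * r powr s \<le> \<phi> x r}"
  proof (intro CollectI allI impI)
    fix r assume r: "0 < r \<and> r < \<delta>"
    have "(\<lambda>n. q * (r - dist x (X n)) powr s) \<longlonglongrightarrow> q * (r - 0) powr s"
      using r by (intro tendsto_intros d) auto
    moreover have "\<forall>\<^sub>F n in sequentially. q * (r - dist x (X n)) powr s \<le> \<phi> x r"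
    proof -
      have "\<forall>\<^sub>F n in sequentially. dist x (X n) < r"
        using r by (intro order_tendstoD(2) [OF d]) auto
      then show ?thesis
      proof eventually_elim
        case (elim n)
        then have "q * (r - dist x (X n)) powr s \<le> \<phi> (X n) (r - dist x (X n))"
          using X r by (smt (verit, best) mem_Collect_eq zero_le_dist)
        also have "\<dots> \<le> \<phi> x r"
          by (rule mono) simp
        finally show ?case .
      qed
    qed
    ultimately show "q * r powr s \<le> \<phi> x r"
      by (intro tendsto_upperbound [of "\<lambda>n. q * (r - dist x (X n)) powr s"]) auto
  qed
qed

text \<open>Here the radius grows by \<open>dist x (X n)\<close>; the strict bound by \<delta>
  leaves room for this.\<close>

lemma closed_ball_growth_le:
  fixes \<phi> :: "'a::metric_space \<Rightarrow> real \<Rightarrow> real"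
  assumes mono: "\<And>x y r r'. dist x y + r' \<le> r \<Longrightarrow> \<phi> y r' \<le> \<phi> x r"
  shows "closed {x. \<forall>r. 0 < r \<and> r < \<delta> \<longrightarrow> \<phi> x r \<le> q * r powr s}"
  unfolding closed_sequential_limits
proof (intro allI impI, elim conjE)
  fix X :: "nat \<Rightarrow> 'a" and x
  assume X: "\<forall>n. X n \<in> {x. \<forall>r. 0 < r \<and> r < \<delta> \<longrightarrow> \<phi> x r \<le> q * r powr s}" and lim: "X \<longlonglongrightarrow> x"
  have d: "(\<lambda>n. dist x (X n)) \<longlonglongrightarrow> 0"
    using tendsto_dist [OF tendsto_const lim, of x] by simp
  show "x \<in> {x. \<forall>r. 0 < r \<and> r < \<delta> \<longrightarrow> \<phi> x r \<le> q * r powr s}"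
  proof (intro CollectI allI impI)
    fix r assume r: "0 < r \<and> r < \<delta>"
    have "(\<lambda>n. q * (r + dist x (X n)) powr s) \<longlonglongrightarrow> q * (r + 0) powr s"
      using r by (intro tendsto_intros d) auto
    moreover have "\<forall>\<^sub>F n in sequentially. \<phi> x r \<le> q * (r + dist x (X n)) powr s"
    proof -
      have "\<forall>\<^sub>F n in sequentially. dist x (X n) < \<delta> - r"
        using r by (intro order_tendstoD(2) [OF d]) auto
      then show ?thesis
      proof eventually_elim
        case (elim n)
        have "\<phi> x r \<le> \<phi> (X n) (r + dist x (X n))"
          by (rule mono) (simp add: dist_commute)
        also have "\<dots> \<le> q * (r + dist x (X n)) powr s"
        proof -
          have "0 < r + dist x (X n)" "r + dist x (X n) < \<delta>"
            using r elim by (simp_all add: add_pos_nonneg)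
          then show ?thesis using X by blast
        qed
        finally show ?case .
      qed
    qed
    ultimately show "\<phi> x r \<le> q * r powr s"
      by (intro tendsto_lowerbound [of "\<lambda>n. q * (r + dist x (X n)) powr s"]) auto
  qed
qed

lemma cball_subset_cball_dist: "dist x y + r' \<le> r \<Longrightarrow> cball y r' \<subseteq> cball x r"
proof
  fix w assume "dist x y + r' \<le> r" "w \<in> cball y r'"
  then show "w \<in> cball x r"
    using dist_triangle [of x w y] by simp
qed

text \<open>The relative width of the band is fixed by k, so q need only approximate the density and
  can be taken rational.\<close>

definition density_band :: "real \<Rightarrow> 'a::metric_space measure \<Rightarrow> nat \<Rightarrow> real \<Rightarrow> real \<Rightarrow> 'a \<Rightarrow> bool" where
  "density_band s M k \<delta> q x \<longleftrightarrow> (\<forall>r. 0 < r \<and> r < \<delta> \<longrightarrow>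
     q * r powr s \<le> measure M (cball x r) \<and> measure M (cball x r) \<le> q * (1 + 1 / Suc k) * r powr s)"

definition uniform_density :: "real \<Rightarrow> 'a::metric_space measure \<Rightarrow> 'a set \<Rightarrow> bool" where
  "uniform_density s M E \<longleftrightarrow> (\<forall>k. \<exists>\<delta>>0. \<forall>x\<in>E. \<exists>q>0. density_band s M k \<delta> q x)"

text \<open>
  Egorov's theorem is not applied to the density itself, whose measurability would have to be shown:
  the sets of points whose balls grow within a fixed band up to a fixed radius are closed.
\<close>

lemma uniform_density_set:
  fixes M :: "'n::finite heis measure"
  assumes radon: "radon_measure M"
    and pos: "outer_measure_of M {x. density_exists s M x \<and> 0 < density_at s M x \<and> density_at s M x < \<infinity>} > 0"
  obtains E R where "closed E" "E \<subseteq> cball 1 R" "0 < emeasure M E"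
    "uniform_density s M E"
proof -
  have M: "sets M = sets borel" and fin: "\<And>K. compact K \<Longrightarrow> emeasure M K < \<infinity>"
    using radon by (auto simp: radon_measure_def)
  define \<phi> where "\<phi> x r = measure M (cball x r)" for x r
  have cb: "emeasure M (cball x r) = ennreal (\<phi> x r)" for x r
    using fin [OF compact_cball_heis, of x r] unfolding \<phi>_def by (intro emeasure_eq_ennreal_measure) auto
  have mono: "\<phi> y r' \<le> \<phi> x r" if "dist x y + r' \<le> r" for x y r r'
  proof -
    have "emeasure M (cball y r') \<le> emeasure M (cball x r)"
      using M cball_subset_cball_dist [OF that] by (intro emeasure_mono) auto
    then show ?thesis
      by (simp add: cb \<phi>_def)
  qed
  define band where "band k \<delta> q = {x. \<forall>r. 0 < r \<and> r < \<delta> \<longrightarrow> q * r powr s \<le> \<phi> x r} \<inter>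
    {x. \<forall>r. 0 < r \<and> r < \<delta> \<longrightarrow> \<phi> x r \<le> q * (1 + 1 / Suc k) * r powr s}" for k :: nat and \<delta> q
  have closed_band: "closed (band k \<delta> q)" for k \<delta> q
    unfolding band_def by (intro closed_Int closed_ball_growth_ge closed_ball_growth_le mono)
  \<comment> \<open>Pairs of an index for the radius and a positive rational q: countably many
    closed bands suffice.\<close>
  define I where "I = {p :: nat \<times> rat. 0 < snd p}"
  have I: "countable I" "I \<noteq> {}"
    by (auto simp: I_def intro: exI [of _ 1])
  define e where "e = from_nat_into I"
  have e: "range e = I"
    unfolding e_def by (rule range_from_nat_into [OF I(2,1)])
  define U where "U k j = band k (1 / real (Suc (fst (e j)))) (of_rat (snd (e j)))" for k j
  have U: "closed (U k j)" for k j by (simp add: U_def closed_band)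
  define A where "A = (\<Inter>k. \<Union>j. U k j)"
  have A [measurable]: "A \<in> sets M"
    unfolding A_def M using U by (intro sets.countable_INT sets.countable_UN) auto
  have sub: "{x. density_exists s M x \<and> 0 < density_at s M x \<and> density_at s M x < \<infinity>} \<subseteq> A"
  proof
    fix x assume "x \<in> {x. density_exists s M x \<and> 0 < density_at s M x \<and> density_at s M x < \<infinity>}"
    then have x: "upper_density s M x = lower_density s M x" "0 < upper_density s M x" "upper_density s M x < \<infinity>"
      by (auto simp: density_exists_def density_at_def)
    define \<theta> where "\<theta> = enn2real (upper_density s M x)"
    have \<theta>: "upper_density s M x = ennreal \<theta>" "0 < \<theta>"
      using x by (auto simp: \<theta>_def enn2real_positive_iff)
    have "((\<lambda>r. ennreal (r powr (- s)) * emeasure M (cball x r)) \<longlongrightarrow> ennreal \<theta>) (at_right 0)"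
      using x(1) \<theta>(1) unfolding upper_density_def lower_density_def
      by (intro Liminf_eq_Limsup) (auto simp: trivial_limit_at_right_real)
    then have "((\<lambda>r. ennreal (r powr (- s) * \<phi> x r)) \<longlongrightarrow> ennreal \<theta>) (at_right 0)"
      by (simp add: cb ennreal_mult' \<phi>_def)
    then have lim: "((\<lambda>r. r powr (- s) * \<phi> x r) \<longlongrightarrow> \<theta>) (at_right 0)"
      using \<theta>(2) by (intro tendsto_ennrealD) (auto simp: \<phi>_def)
    show "x \<in> A"
      unfolding A_def
    proof (intro INT_I)
      fix k :: nat
      \<comment> \<open>A rational q in this gap puts \<theta> strictly inside the band, so the band
        holds at all small radii.\<close>
      have "\<theta> / (1 + 1 / Suc k) < \<theta>"
        using \<theta>(2) by (simp add: divide_less_eq add_pos_pos)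
      then obtain q where q: "\<theta> / (1 + 1 / Suc k) < of_rat q" "of_rat q < \<theta>"
        using of_rat_dense by blast
      have "0 < real_of_rat q"
        using q(1) \<theta>(2) by (intro le_less_trans [OF _ q(1)]) (simp add: add_pos_pos)
      then have q0: "0 < q" by simp
      have up: "\<theta> < of_rat q * (1 + 1 / Suc k)"
        using q(1) by (simp add: pos_divide_less_eq add_pos_pos)
      have "\<forall>\<^sub>F r in at_right 0. of_rat q < r powr (- s) * \<phi> x r \<and> r powr (- s) * \<phi> x r < of_rat q * (1 + 1 / Suc k)"
        by (intro eventually_conj order_tendstoD [OF lim] q up)
      then obtain b where b: "0 < b" "\<And>r. 0 < r \<Longrightarrow> r < b \<Longrightarrow> of_rat q < r powr (- s) * \<phi> x r \<and>
          r powr (- s) * \<phi> x r < of_rat q * (1 + 1 / Suc k)"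
        unfolding eventually_at_right_field by blast
      obtain i :: nat where i: "1 / Suc i < b"
        using reals_Archimedean [OF b(1)] by (auto simp: inverse_eq_divide)
      have "x \<in> band k (1 / Suc i) (of_rat q)"
        unfolding band_def
      proof (intro IntI CollectI allI impI)
        fix r :: real assume r: "0 < r \<and> r < 1 / Suc i"
        then have *: "of_rat q < r powr (- s) * \<phi> x r" "r powr (- s) * \<phi> x r < of_rat q * (1 + 1 / Suc k)"
          using b(2) [of r] i by auto
        have rs: "r powr (- s) * \<phi> x r * r powr s = \<phi> x r"
          using r by (simp add: powr_minus field_simps)
        show "of_rat q * r powr s \<le> \<phi> x r"
          using mult_right_mono [OF less_imp_le [OF *(1)], of "r powr s"] rs by simp
        show "\<phi> x r \<le> of_rat q * (1 + 1 / Suc k) * r powr s"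
          using mult_right_mono [OF less_imp_le [OF *(2)], of "r powr s"] rs by simp
      qed
      moreover obtain j where "e j = (i, q)"
      proof -
        have "(i, q) \<in> range e" unfolding e using q0 by (simp add: I_def)
        then show ?thesis using that by force
      qed
      ultimately show "x \<in> (\<Union>j. U k j)"
        by (intro UN_I [of j]) (auto simp: U_def)
    qed
  qed
  have "outer_measure_of M {x. density_exists s M x \<and> 0 < density_at s M x \<and> density_at s M x < \<infinity>} \<le> emeasure M A"
    unfolding outer_measure_of_def using sub A by (intro INF_lower) simp
  then have "0 < emeasure M A"
    by (rule less_le_trans [OF pos])
  \<comment> \<open>Restriction to a ball makes the measures finite, as continuity from above
    requires.\<close>
  have "\<exists>R::nat. emeasure M (A \<inter> cball 1 (real R)) \<noteq> 0"
  proof (rule ccontr)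
    assume "\<not> ?thesis"
    then have "emeasure M (\<Union>R::nat. A \<inter> cball 1 (real R)) = 0"
      using A M by (intro emeasure_UN_eq_0) auto
    moreover have "(\<Union>R::nat. A \<inter> cball 1 (real R)) = A"
      using real_arch_simple by auto
    ultimately show False using \<open>0 < emeasure M A\<close> by simp
  qed
  then obtain R :: nat where R: "emeasure M (A \<inter> cball 1 (real R)) \<noteq> 0" ..
  define B where "B = cball (1 :: 'n heis) (real R)"
  define A1 where "A1 = A \<inter> B"
  have B: "closed B" "B \<in> sets M" by (auto simp: B_def M)
  have A1: "A1 \<in> sets M" unfolding A1_def using A B by auto
  have Bfin: "emeasure M B < \<infinity>" unfolding B_def by (intro fin compact_cball_heis)
  have fm: "C \<in> fmeasurable M" if "C \<in> sets M" "C \<subseteq> B" for C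
    using that Bfin B emeasure_mono [of C B M] by (auto simp: fmeasurable_def)
  define a where "a = measure M A1"
  have a: "0 < a"
    using R fm [OF A1] by (simp add: a_def A1_def B_def measure_def zero_less_iff_neq_zero enn2real_positive_iff fmeasurable_def)
  define V where "V k N = (\<Union>j<N. U k j)" for k N :: nat
  have V: "closed (V k N)" for k N unfolding V_def by (intro closed_UN ballI U) auto
  have Vs: "V k N \<in> sets M" for k N using V M by auto
  \<comment> \<open>For each k finitely many bands cover \<open>A1\<close> up to
    \<open>a / 2 ^ (k + 2)\<close>; these losses sum to a / 2, so something remains.\<close>
  have "\<exists>N. measure M (A1 - V k N) < a / 2 ^ (k + 2)" for k
  proof -
    have "(\<lambda>N. measure M (A1 - V k N)) \<longlonglongrightarrow> measure M (\<Inter>N. A1 - V k N)"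
    proof (rule Lim_measure_decseq)
      show "range (\<lambda>N. A1 - V k N) \<subseteq> sets M" using A1 Vs by auto
      show "decseq (\<lambda>N. A1 - V k N)" by (force simp: decseq_def V_def)
      show "emeasure M (A1 - V k N) \<noteq> \<infinity>" for N
      proof -
        have "A1 - V k N \<subseteq> B" by (auto simp: A1_def)
        then have "A1 - V k N \<in> fmeasurable M"
          by (rule fm [OF sets.Diff [OF A1 Vs]])
        then show ?thesis by (auto simp: fmeasurable_def)
      qed
    qed
    moreover have "(\<Inter>N. A1 - V k N) = {}"
      unfolding A1_def A_def V_def by blast
    ultimately have "(\<lambda>N. measure M (A1 - V k N)) \<longlonglongrightarrow> 0" by (simp only: measure_empty)
    then have "\<forall>\<^sub>F N in sequentially. measure M (A1 - V k N) < a / 2 ^ (k + 2)"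
      by (rule order_tendstoD(2)) (use a in simp)
    then show ?thesis
      using eventually_happens [of _ sequentially] by auto
  qed
  then obtain N where N: "\<And>k. measure M (A1 - V k (N k)) < a / 2 ^ (k + 2)"
    by metis
  \<comment> \<open>Intersecting with \<open>B\<close> instead of \<open>A1\<close> makes the set
    closed.\<close>
  define E where "E = B \<inter> (\<Inter>k. V k (N k))"
  show ?thesis
  proof
    show "closed E" unfolding E_def using B V by (intro closed_Int closed_INT) auto
    then have E: "E \<in> sets M" using M by auto
    show "E \<subseteq> cball 1 (real R)" by (auto simp: E_def B_def)
    show "0 < emeasure M E"
    proof (rule ccontr)
      assume "\<not> 0 < emeasure M E"
      then have E0: "emeasure M E = 0" by (simp add: zero_less_iff_neq_zero)
      have "emeasure M A1 \<le> emeasure M (E \<union> (\<Union>k. A1 - V k (N k)))"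
        using E A1 Vs by (intro emeasure_mono) (auto simp: E_def A1_def)
      also have "\<dots> \<le> emeasure M E + emeasure M (\<Union>k. A1 - V k (N k))"
        using E A1 Vs by (intro emeasure_subadditive) auto
      also have "\<dots> \<le> 0 + (\<Sum>k. emeasure M (A1 - V k (N k)))"
        unfolding E0 using A1 Vs by (intro add_left_mono emeasure_subadditive_countably) auto
      also have "\<dots> \<le> 0 + (\<Sum>k. ennreal (a / 2 ^ (k + 2)))"
      proof (intro add_left_mono suminf_le summableI)
        fix k
        have "emeasure M (A1 - V k (N k)) = ennreal (measure M (A1 - V k (N k)))"
          using A1 Vs by (intro emeasure_eq_measure2 fm) (auto simp: A1_def)
        then show "emeasure M (A1 - V k (N k)) \<le> ennreal (a / 2 ^ (k + 2))"
          using N [of k] by (simp add: ennreal_leI)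
      qed
      also have "(\<Sum>k. ennreal (a / 2 ^ (k + 2))) = ennreal (a / 2)"
      proof -
        have "(\<lambda>k. a / 4 * (1 / 2) ^ k) sums (a / 4 * (1 / (1 - 1 / 2)))"
          by (intro sums_mult geometric_sums) simp
        moreover have "(\<lambda>k. a / 2 ^ (k + 2)) = (\<lambda>k. a / 4 * (1 / 2) ^ k)"
          by (simp add: fun_eq_iff power_add power_divide)
        ultimately have "(\<lambda>k. a / 2 ^ (k + 2)) sums (a / 2)" by (simp only:) simp
        then show ?thesis
          using a by (intro suminf_ennreal_eq) auto
      qed
      finally have "ennreal a \<le> ennreal (a / 2)"
        using emeasure_eq_measure2 [OF fm [OF A1]] by (simp add: a_def A1_def)
      then show False using a by (simp add: ennreal_le_iff)
    qed
    show "uniform_density s M E"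
      unfolding uniform_density_def
    proof
      fix k
      \<comment> \<open>Finitely many bands occur for a given k, so the smallest of their radii
        serves all of \<open>E\<close>; 0 is inserted in case there are none.\<close>
      define m where "m = Max (insert 0 ((\<lambda>j. fst (e j)) ` {..<N k}))"
      have m: "fst (e j) \<le> m" if "j < N k" for j
        unfolding m_def using that by (intro Max_ge) auto
      show "\<exists>\<delta>>0. \<forall>x\<in>E. \<exists>q>0. density_band s M k \<delta> q x"
      proof (rule exI [of _ "1 / real (Suc m)"], intro conjI ballI)
        fix x assume "x \<in> E"
        then obtain j where j: "j < N k" "x \<in> U k j" by (auto simp: E_def V_def)
        have le: "1 / real (Suc m) \<le> 1 / real (Suc (fst (e j)))"
          using m [OF j(1)] by (intro divide_left_mono) auto
        have "e j \<in> I" using e by blast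
        then have "0 < real_of_rat (snd (e j))" by (simp add: I_def)
        moreover have "density_band s M k (1 / real (Suc m)) (of_rat (snd (e j))) x"
          using j(2) le unfolding U_def band_def \<phi>_def density_band_def by auto
        ultimately show "\<exists>q>0. density_band s M k (1 / real (Suc m)) q x"
          by blast
      qed simp
    qed
  qed
qed

section \<open>Density points and blow-ups of the measure\<close>

text \<open>
  A weak form of the Lebesgue density theorem. Along a single sequence of radii a covering of \<open>E\<close>
  by balls of one fixed radius suffices, so Vitali's covering theorem is not needed.
\<close>

lemma density_point:
  fixes M :: "'a::metric_space measure"
  assumes fin: "finite_measure M" and M: "sets M = sets borel" and E: "closed E" "0 < measure M E"
    and d0: "0 < d0" and b: "\<And>x r. x \<in> E \<Longrightarrow> 0 < r \<Longrightarrow> r < d0 \<Longrightarrow> measure M (cball x r) \<le> b * r powr s"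
  obtains x where "x \<in> E"
    "\<And>n::nat. \<exists>r. 0 < r \<and> r < 1 / Suc n \<and> measure M (cball x r - E) \<le> r powr s / Suc n"
proof -
  interpret finite_measure M by fact
  have [simp]: "S \<in> sets M" if "closed S" for S using that M by simp
  have Es: "E \<in> sets M" using E by simp
  have cs: "cball x r \<in> sets M" for x r by simp
  define \<phi> where "\<phi> x r = measure M (cball x r - E)" for x r
  have mono: "\<phi> y r' \<le> \<phi> x r" if "dist x y + r' \<le> r" for x y r r'
    unfolding \<phi>_def using cball_subset_cball_dist [OF that] Es cs by (intro finite_measure_mono) auto
  \<comment> \<open>The points of \<open>E\<close> where the conclusion fails at every radius below
    1 / (n + 1).\<close>
  define Bad where "Bad n = E \<inter> {x. \<forall>r. 0 < r \<and> r < 1 / Suc n \<longrightarrow> (1 / Suc n) * r powr s \<le> \<phi> x r}" for n :: nat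
  have Bad: "closed (Bad n)" for n
    unfolding Bad_def by (intro closed_Int E closed_ball_growth_ge mono)
  define U where "U r = {w. infdist w E \<le> r} - E" for r
  have U: "U r \<in> sets M" for r
  proof -
    have "closed {w. infdist w E \<le> r}"
      by (intro closed_Collect_le continuous_on_infdist continuous_on_id continuous_on_const)
    then show ?thesis unfolding U_def using Es by (intro sets.Diff) simp_all
  qed
  have Ene: "E \<noteq> {}" using E(2) by auto
  \<comment> \<open>For a maximal separated subset of \<open>Bad n\<close>, the balls of radius r
    are disjoint and each puts mass of order at least \<open>r powr s\<close> into
    \<open>U r\<close>, while the balls of radius 2 r cover \<open>Bad n\<close> and have mass of
    order at most \<open>r powr s\<close>.\<close>
  have key: "measure M (Bad n) \<le> \<bar>b\<bar> * 2 powr s * Suc n * measure M (U r)"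
    if r: "0 < r" "r < 1 / Suc n" "2 * r < d0" for n r
  proof -
    define \<eta> where "\<eta> = 1 / real (Suc n)"
    have \<eta>: "0 < \<eta>" by (simp add: \<eta>_def)
    have rs: "0 < r powr s" using r by simp
    define sep where "sep X \<longleftrightarrow> finite X \<and> X \<subseteq> Bad n \<and> (\<forall>x\<in>X. \<forall>y\<in>X. x \<noteq> y \<longrightarrow> 2 * r < dist x y)" for X
    have card: "card X * (\<eta> * r powr s) \<le> measure M (U r)" if X: "sep X" for X
    proof -
      have "card X * (\<eta> * r powr s) \<le> (\<Sum>x\<in>X. measure M (cball x r - E))"
        using X r unfolding sep_def Bad_def \<phi>_def \<eta>_def by (intro sum_bounded_below) auto
      also have "\<dots> = measure M (\<Union>x\<in>X. cball x r - E)"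
      proof (rule finite_measure_finite_Union [symmetric])
        show "disjoint_family_on (\<lambda>x. cball x r - E) X"
          unfolding disjoint_family_on_def
        proof (intro ballI impI)
          fix x y assume xy: "x \<in> X" "y \<in> X" "x \<noteq> y"
          then have "2 * r < dist x y" using X by (auto simp: sep_def)
          show "(cball x r - E) \<inter> (cball y r - E) = {}"
          proof (rule equals0I)
            fix w assume "w \<in> (cball x r - E) \<inter> (cball y r - E)"
            then have "dist x w \<le> r" "dist y w \<le> r" by auto
            then show False using \<open>2 * r < dist x y\<close> dist_triangle2 [of x y w] by linarith
          qed
        qed
      qed (use X Es cs in \<open>auto simp: sep_def\<close>)
      also have "\<dots> \<le> measure M (U r)"
      proof (intro finite_measure_mono U)
        show "(\<Union>x\<in>X. cball x r - E) \<subseteq> U r"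
        proof
          fix w assume "w \<in> (\<Union>x\<in>X. cball x r - E)"
          then obtain x where x: "x \<in> X" "dist x w \<le> r" "w \<notin> E" by auto
          then have "x \<in> E" using X by (auto simp: sep_def Bad_def)
          then have "infdist w E \<le> dist w x" by (rule infdist_le)
          then show "w \<in> U r" using x by (simp add: U_def dist_commute)
        qed
      qed
      finally show ?thesis .
    qed
    \<comment> \<open>The mass of \<open>U r\<close> bounds the size of separated sets, so one of
      greatest cardinality exists.\<close>
    have "\<exists>X. sep X \<and> (\<forall>Y. sep Y \<longrightarrow> card Y \<le> card X)"
    proof (rule ex_has_greatest_nat)
      show "sep {}" by (simp add: sep_def)
      show "\<forall>Y. sep Y \<longrightarrow> card Y < Suc (nat \<lceil>measure M (U r) / (\<eta> * r powr s)\<rceil>)"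
      proof (intro allI impI)
        fix Y assume "sep Y"
        then have "real (card Y) \<le> measure M (U r) / (\<eta> * r powr s)"
          using card \<eta> rs by (simp only: pos_le_divide_eq mult_pos_pos)
        then have "real (card Y) \<le> real (nat \<lceil>measure M (U r) / (\<eta> * r powr s)\<rceil>)"
          by (rule order_trans [OF _ real_nat_ceiling_ge])
        then show "card Y < Suc (nat \<lceil>measure M (U r) / (\<eta> * r powr s)\<rceil>)"
          by (simp only: of_nat_le_iff less_Suc_eq_le)
      qed
    qed
    then obtain X where X: "sep X" "\<And>Y. sep Y \<Longrightarrow> card Y \<le> card X" by blast
    have cover: "Bad n \<subseteq> (\<Union>x\<in>X. cball x (2 * r))"
    proof
      fix w assume w: "w \<in> Bad n"
      show "w \<in> (\<Union>x\<in>X. cball x (2 * r))"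
      proof (rule ccontr)
        assume "\<not> ?thesis"
        then have far: "2 * r < dist x w" if "x \<in> X" for x using that by force
        then have "w \<notin> X" using r by force
        moreover have "sep (insert w X)"
          using X(1) far w by (auto simp: sep_def dist_commute)
        ultimately show False
          using X(2) [of "insert w X"] X(1) by (simp add: sep_def)
      qed
    qed
    have "measure M (Bad n) \<le> measure M (\<Union>x\<in>X. cball x (2 * r))"
      using cover X(1) by (intro finite_measure_mono sets.finite_UN) (auto simp: sep_def)
    also have "\<dots> \<le> (\<Sum>x\<in>X. measure M (cball x (2 * r)))"
      using X(1) by (intro finite_measure_subadditive_finite) (auto simp: sep_def)
    also have "\<dots> \<le> card X * (\<bar>b\<bar> * (2 * r) powr s)"
    proof (rule sum_bounded_above)
      fix x assume "x \<in> X"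
      then have "x \<in> E" using X(1) by (auto simp: sep_def Bad_def)
      then have "measure M (cball x (2 * r)) \<le> b * (2 * r) powr s"
        using r by (intro b) auto
      also have "\<dots> \<le> \<bar>b\<bar> * (2 * r) powr s" by (intro mult_right_mono) auto
      finally show "measure M (cball x (2 * r)) \<le> \<bar>b\<bar> * (2 * r) powr s" .
    qed
    also have "\<dots> = \<bar>b\<bar> * 2 powr s * Suc n * (card X * (\<eta> * r powr s))"
      using r by (simp add: powr_mult \<eta>_def)
    also have "\<dots> \<le> \<bar>b\<bar> * 2 powr s * Suc n * measure M (U r)"
      by (intro mult_left_mono card X) simp
    finally show ?thesis .
  qed
  \<comment> \<open>The neighbourhoods of \<open>E\<close> shrink to \<open>E\<close> because it is
    closed, so nothing is left outside it.\<close>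
  have U0: "(\<lambda>j. measure M (U (1 / Suc j))) \<longlonglongrightarrow> 0"
  proof -
    have "(\<lambda>j. measure M (U (1 / Suc j))) \<longlonglongrightarrow> measure M (\<Inter>j::nat. U (1 / Suc j))"
    proof (rule finite_Lim_measure_decseq)
      show "decseq (\<lambda>j. U (1 / real (Suc j)))"
      proof (rule decseq_SucI)
        fix j :: nat
        have "1 / real (Suc (Suc j)) \<le> 1 / real (Suc j)"
          by (intro divide_left_mono) auto
        then show "U (1 / real (Suc (Suc j))) \<le> U (1 / real (Suc j))"
          unfolding U_def by (auto intro: order_trans)
      qed
    qed (use U in auto)
    moreover have "(\<Inter>j::nat. U (1 / Suc j)) = {}"
    proof (rule ccontr)
      assume "(\<Inter>j::nat. U (1 / Suc j)) \<noteq> {}"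
      then obtain w where w: "w \<notin> E" "\<And>j::nat. infdist w E \<le> 1 / Suc j" by (auto simp: U_def)
      have "infdist w E \<le> 0"
      proof (rule ccontr)
        assume "\<not> infdist w E \<le> 0"
        then obtain j :: nat where "1 / Suc j < infdist w E"
          using reals_Archimedean [of "infdist w E"] by (auto simp: inverse_eq_divide)
        then show False using w(2) [of j] by simp
      qed
      then have "infdist w E = 0" using infdist_nonneg [of w E] by linarith
      then show False using w(1) in_closed_iff_infdist_zero [OF E(1) Ene] by blast
    qed
    ultimately show ?thesis by (simp only: measure_empty)
  qed
  have null: "measure M (Bad n) = 0" for n
  proof -
    have "measure M (Bad n) \<le> \<bar>b\<bar> * 2 powr s * Suc n * 0"
    proof (rule tendsto_lowerbound [OF tendsto_mult_left [OF U0]])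
      have lim: "(\<lambda>j. 1 / real (Suc j)) \<longlonglongrightarrow> 0"
        by (rule LIMSEQ_Suc [OF lim_1_over_n])
      have "\<forall>\<^sub>F j in sequentially. 1 / real (Suc j) < 1 / Suc n"
        by (rule order_tendstoD(2) [OF lim]) simp
      moreover have "\<forall>\<^sub>F j in sequentially. 1 / real (Suc j) < d0 / 2"
        using d0 by (intro order_tendstoD(2) [OF lim]) simp
      ultimately show "\<forall>\<^sub>F j in sequentially. measure M (Bad n) \<le> \<bar>b\<bar> * 2 powr s * Suc n * measure M (U (1 / Suc j))"
        by eventually_elim (intro key, auto)
    qed simp
    then show ?thesis using measure_nonneg [of M "Bad n"] by simp
  qed
  have "measure M (\<Union>n. Bad n) \<le> (\<Sum>n. measure M (Bad n))"
    using Bad by (intro finite_measure_subadditive_countably) (auto simp: null)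
  then have "measure M (\<Union>n. Bad n) < measure M E"
    using E(2) by (simp add: null)
  moreover have "(\<Union>n. Bad n) \<in> sets M"
    using Bad by (intro sets.countable_UN) auto
  ultimately have "\<not> E \<subseteq> (\<Union>n. Bad n)"
    using finite_measure_mono [of E "\<Union>n. Bad n"] by linarith
  then obtain x where x: "x \<in> E" "\<And>n. x \<notin> Bad n" by blast
  show ?thesis
  proof
    show "x \<in> E" by fact
    show "\<exists>r. 0 < r \<and> r < 1 / Suc n \<and> measure M (cball x r - E) \<le> r powr s / Suc n" for n :: nat
      using x(2) [of n] x(1) by (auto simp: Bad_def \<phi>_def not_le intro: less_imp_le)
  qed
qed

text \<open>The band constant at x and the density at x0 are compared at one fixed radius R, where
  balls about nearby centres are nested after a slight enlargement; the band at x then carries the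
  comparison to all smaller radii at once.\<close>

lemma density_continuous:
  fixes M :: "'a::metric_space measure"
  assumes fin: "finite_measure M" and M: "sets M = sets borel" and s: "0 < s" and x0: "x0 \<in> E"
    and unif: "uniform_density s M E"
  obtains \<theta> where "0 < \<theta>" "\<And>\<kappa>. 0 < \<kappa> \<Longrightarrow> \<exists>\<delta>>0. \<forall>x\<in>E. dist x0 x < \<delta> \<longrightarrow>
    (\<forall>r. 0 < r \<and> r < \<delta> \<longrightarrow> \<bar>measure M (cball x r) - \<theta> * r powr s\<bar> \<le> \<kappa> * r powr s)"
proof -
  interpret finite_measure M by fact
  define \<phi> where "\<phi> x r = measure M (cball x r)" for x r
  have mono: "\<phi> y r' \<le> \<phi> x r" if "dist x y + r' \<le> r" for x y r r'
    unfolding \<phi>_def using cball_subset_cball_dist [OF that] M by (intro finite_measure_mono) auto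
  obtain d where d: "\<And>k. 0 < d k" "\<And>k x. x \<in> E \<Longrightarrow> \<exists>q>0. density_band s M k (d k) q x"
    using unif unfolding uniform_density_def by metis
  define q where "q k x = (SOME q. 0 < q \<and> density_band s M k (d k) q x)" for k x
  have q': "0 < q k x \<and> density_band s M k (d k) (q k x) x" if "x \<in> E" for k x
    unfolding q_def by (rule someI_ex) (rule d(2) [OF that])
  have q: "0 < q k x"
    "0 < r \<Longrightarrow> r < d k \<Longrightarrow> q k x * r powr s \<le> \<phi> x r"
    "0 < r \<Longrightarrow> r < d k \<Longrightarrow> \<phi> x r \<le> q k x * (1 + 1 / Suc k) * r powr s" if "x \<in> E" for k x r
    using q' [OF that] unfolding density_band_def \<phi>_def by blast+
  define D where "D r = \<phi> x0 r / r powr s" for r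
  have D: "D r \<in> {q k x0 .. q k x0 * (1 + 1 / Suc k)}" if "0 < r" "r < d k" for r k
    using q(2,3) [OF x0 that] that by (simp add: D_def pos_le_divide_eq pos_divide_le_eq)
  \<comment> \<open>Any two bands at x0 overlap, so the supremum of their lower bounds lies in all
    of them; it is the density at x0.\<close>
  define \<theta> where "\<theta> = (SUP k. q k x0)"
  have qq: "q l x0 \<le> q k x0 * (1 + 1 / Suc k)" for k l
  proof -
    define r where "r = min (d k) (d l) / 2"
    have "0 < r" "r < d k" "r < d l" using d(1) [of k] d(1) [of l] by (auto simp: r_def min_def)
    then show ?thesis using D [of r k] D [of r l] by auto
  qed
  have th1: "q k x0 \<le> \<theta>" for k
    unfolding \<theta>_def using qq [of _ 0] by (intro cSUP_upper bdd_aboveI2) auto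
  have th2: "\<theta> \<le> q k x0 * (1 + 1 / Suc k)" for k
    unfolding \<theta>_def using qq by (intro cSUP_least) auto
  have \<theta>: "0 < \<theta>"
    using q(1) [OF x0, of 0] th1 [of 0] by linarith
  show ?thesis
  proof
    show "0 < \<theta>" by fact
    fix \<kappa> :: real assume \<kappa>: "0 < \<kappa>"
    \<comment> \<open>Three factors 1 + 1 / (k + 1) are lost between x and x0: for the band at x0,
      the band at x, and the enlarged radius.\<close>
    have "(\<lambda>k. \<theta> * ((1 + 1 / real (Suc k)) ^ 3 - 1)) \<longlonglongrightarrow> \<theta> * ((1 + 0) ^ 3 - 1)"
      by (intro tendsto_intros LIMSEQ_Suc [OF lim_1_over_n])
    then have "\<forall>\<^sub>F k in sequentially. \<theta> * ((1 + 1 / real (Suc k)) ^ 3 - 1) < \<kappa>"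
      by (rule order_tendstoD(2)) (use \<kappa> in simp)
    then obtain k where k: "\<theta> * ((1 + 1 / real (Suc k)) ^ 3 - 1) < \<kappa>"
      using eventually_happens [of _ sequentially] by auto
    define y where "y = 1 + 1 / real (Suc k)"
    have y: "1 < y" by (simp add: y_def)
    define R where "R = d k / 2"
    have R: "0 < R" "R < d k" using d(1) [of k] by (simp_all add: R_def)
    have "((\<lambda>e. (R + e) powr s) \<longlongrightarrow> (R + 0) powr s) (at_right 0)"
      using R by (intro tendsto_intros) auto
    then have "\<forall>\<^sub>F e in at_right 0. (R + e) powr s < y * R powr s"
      by (rule order_tendstoD(2)) (use R y in simp)
    then obtain \<eta> where \<eta>: "0 < \<eta>" "\<And>e. 0 < e \<Longrightarrow> e < \<eta> \<Longrightarrow> (R + e) powr s < y * R powr s"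
      unfolding eventually_at_right_field by blast
    have Re: "(R + e) powr s \<le> y * R powr s" if "0 \<le> e" "e < \<eta>" for e
      using \<eta>(2) [of e] that y R by (cases "e = 0") (auto intro: less_imp_le)
    have Rs: "0 < R powr s" using R by simp
    have up0: "\<phi> x0 r \<le> \<theta> * y * r powr s" and lo0: "\<theta> * r powr s \<le> y * \<phi> x0 r"
      if r: "0 < r" "r < d k" for r
    proof -
      have "\<phi> x0 r \<le> q k x0 * y * r powr s"
        using q(3) [OF x0 r] by (simp add: y_def)
      also have "\<dots> \<le> \<theta> * y * r powr s"
        using th1 [of k] y by (intro mult_right_mono) auto
      finally show "\<phi> x0 r \<le> \<theta> * y * r powr s" .
      have "\<theta> * r powr s \<le> (q k x0 * y) * r powr s"
        using th2 [of k] by (intro mult_right_mono) (auto simp: y_def)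
      also have "\<dots> = y * (q k x0 * r powr s)" by simp
      also have "\<dots> \<le> y * \<phi> x0 r"
        using q(2) [OF x0 r] y by (intro mult_left_mono) auto
      finally show "\<theta> * r powr s \<le> y * \<phi> x0 r" .
    qed
    show "\<exists>\<delta>>0. \<forall>x\<in>E. dist x0 x < \<delta> \<longrightarrow>
      (\<forall>r. 0 < r \<and> r < \<delta> \<longrightarrow> \<bar>measure M (cball x r) - \<theta> * r powr s\<bar> \<le> \<kappa> * r powr s)"
    proof (rule exI [of _ "min \<eta> R"], intro conjI ballI allI impI)
      show "0 < min \<eta> R" using \<eta> R by simp
      fix x r assume x: "x \<in> E" "dist x0 x < min \<eta> R" and r: "0 < r \<and> r < min \<eta> R"
      define e where "e = dist x0 x"
      have e: "0 \<le> e" "e < \<eta>" "R + e < d k" "0 < R + e"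
        using x R by (auto simp: e_def R_def add_pos_nonneg)
      have rd: "0 < r" "r < d k" using r R by auto
      define p where "p = q k x"
      have p: "0 < p" using q(1) [OF x(1)] by (simp add: p_def)
      have "p * R powr s \<le> \<phi> x R"
        using q(2) [OF x(1) R] by (simp add: p_def)
      also have "\<dots> \<le> \<phi> x0 (R + e)" by (rule mono) (simp add: e_def)
      also have "\<dots> \<le> \<theta> * y * (R + e) powr s" by (rule up0 [OF e(4,3)])
      also have "\<dots> \<le> \<theta> * y * (y * R powr s)"
        using \<theta> y Re [OF e(1,2)] by (intro mult_left_mono) auto
      finally have "p * R powr s \<le> (\<theta> * y\<^sup>2) * R powr s" by (simp add: power2_eq_square mult_ac)
      then have p_up: "p \<le> \<theta> * y\<^sup>2" using Rs by simp
      have "\<theta> * R powr s \<le> y * \<phi> x0 R" by (rule lo0 [OF R])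
      also have "\<dots> \<le> y * \<phi> x (R + e)"
        using y by (intro mult_left_mono mono) (auto simp: e_def dist_commute)
      also have "\<dots> \<le> y * (p * y * (R + e) powr s)"
        using q(3) [OF x(1) e(4,3)] y by (intro mult_left_mono) (auto simp: p_def y_def)
      also have "\<dots> \<le> y * (p * y * (y * R powr s))"
        using y p Re [OF e(1,2)] by (intro mult_left_mono) auto
      finally have "\<theta> * R powr s \<le> (p * y ^ 3) * R powr s" by (simp add: power3_eq_cube mult_ac)
      then have p_lo: "\<theta> \<le> p * y ^ 3" using Rs by simp
      have "\<phi> x r \<le> p * y * r powr s"
        using q(3) [OF x(1) rd] by (simp add: p_def y_def)
      also have "\<dots> \<le> (\<theta> * y\<^sup>2) * y * r powr s"
        using p_up y by (intro mult_right_mono) auto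
      finally have 1: "\<phi> x r \<le> \<theta> * y ^ 3 * r powr s"
        by (simp add: power2_eq_square power3_eq_cube mult_ac)
      \<comment> \<open>Replaces \<open>\<theta> / y ^ 3\<close> by a linear bound, so that the
        deviation downwards is governed by \<open>y ^ 3 - 1\<close> as well.\<close>
      have "\<theta> * (2 - y ^ 3) \<le> p"
      proof -
        have "y ^ 3 * (2 - y ^ 3) \<le> 1"
          using zero_le_power2 [of "y ^ 3 - 1"] by (simp add: power2_eq_square algebra_simps)
        show ?thesis
        proof (cases "2 - y ^ 3 \<le> 0")
          case True
          then have "\<theta> * (2 - y ^ 3) \<le> 0" using \<theta> by (simp add: mult_nonneg_nonpos)
          then show ?thesis using p by simp
        next
          case False
          then have "\<theta> * (2 - y ^ 3) \<le> (p * y ^ 3) * (2 - y ^ 3)"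
            using p_lo by (intro mult_right_mono) auto
          also have "\<dots> = p * (y ^ 3 * (2 - y ^ 3))" by simp
          also have "\<dots> \<le> p * 1"
            using p \<open>y ^ 3 * (2 - y ^ 3) \<le> 1\<close> by (intro mult_left_mono) auto
          finally show ?thesis by simp
        qed
      qed
      then have "\<theta> * (2 - y ^ 3) * r powr s \<le> p * r powr s"
        by (intro mult_right_mono) auto
      also have "\<dots> \<le> \<phi> x r"
        using q(2) [OF x(1) rd] by (simp add: p_def)
      finally have 2: "\<theta> * (2 - y ^ 3) * r powr s \<le> \<phi> x r" .
      have "\<bar>\<phi> x r - \<theta> * r powr s\<bar> \<le> \<theta> * (y ^ 3 - 1) * r powr s"
        using 1 2 by (simp add: abs_le_iff algebra_simps)
      also have "\<dots> \<le> \<kappa> * r powr s"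
        using k by (intro mult_right_mono) (auto simp: y_def)
      finally show "\<bar>measure M (cball x r) - \<theta> * r powr s\<bar> \<le> \<kappa> * r powr s"
        by (simp add: \<phi>_def)
    qed
  qed
qed

text \<open>\<open>limit_functional\<close> is applied with \<open>S j\<close> the rescaled set
  \<open>E\<close>: uniform density near x0 gives the law on \<open>S j\<close>, and the small mass
  outside \<open>E\<close> gives the loss of mass away from \<open>S j\<close>.\<close>

lemma blowup_of_measure:
  fixes M :: "'n::finite heis measure"
  assumes fin: "finite_measure M" and M: "sets M = sets borel" and s: "0 < s"
    and x0: "x0 \<in> E" and \<theta>: "0 < \<theta>"
    and sparse: "\<And>n::nat. \<exists>r. 0 < r \<and> r < 1 / Suc n \<and> measure M (cball x0 r - E) \<le> r powr s / Suc n"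
    and dens: "\<And>\<kappa>. 0 < \<kappa> \<Longrightarrow> \<exists>\<delta>>0. \<forall>x\<in>E. dist x0 x < \<delta> \<longrightarrow>
      (\<forall>r. 0 < r \<and> r < \<delta> \<longrightarrow> \<bar>measure M (cball x r) - \<theta> * r powr s\<bar> \<le> \<kappa> * r powr s)"
    and E: "closed E"
  obtains J :: "('n heis \<Rightarrow> real) \<Rightarrow> real" where "uniform_functional s (\<theta> * Gamma (s / 4 + 1)) J"
proof -
  interpret finite_measure M by fact
  \<comment> \<open>The blow-ups must have little mass outside \<open>E\<close> in larger and larger
    balls, so the scale is a good radius divided by j + 1. The choice of n makes up for the factor
    \<open>Suc j powr s\<close> this causes, with one more factor for the quotient by j + 1.\<close>
  have "\<exists>r::real. 0 < r \<and> r \<le> 1 / Suc j \<and> measure M (cball x0 (Suc j * r) - E) \<le> r powr s / Suc j" for j :: nat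
  proof -
    obtain n :: nat where n: "Suc j powr (s + 1) \<le> real n"
      using real_arch_simple by blast
    obtain \<rho> where \<rho>: "0 < \<rho>" "\<rho> < 1 / Suc n" "measure M (cball x0 \<rho> - E) \<le> \<rho> powr s / Suc n"
      using sparse by blast
    define r where "r = \<rho> / Suc j"
    have r: "0 < r" "\<rho> = Suc j * r" using \<rho> by (simp_all add: r_def)
    have "r \<le> 1 / Suc j"
    proof -
      have "1 / real (Suc n) \<le> 1" by simp
      then have "\<rho> \<le> 1" using \<rho>(2) by linarith
      then show ?thesis unfolding r_def by (intro divide_right_mono) auto
    qed
    moreover have "measure M (cball x0 (Suc j * r) - E) \<le> r powr s / Suc j"
    proof -
      have "measure M (cball x0 (Suc j * r) - E) \<le> \<rho> powr s / Suc n"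
        using \<rho>(3) r(2) by simp
      also have "\<dots> \<le> \<rho> powr s / (Suc j powr (s + 1))"
        using n \<rho>(1) by (intro divide_left_mono) auto
      also have "\<rho> powr s = Suc j powr s * r powr s"
        unfolding r(2) using r(1) by (intro powr_mult)
      also have "Suc j powr s * r powr s / Suc j powr (s + 1) = r powr s / Suc j"
        by (simp add: powr_add)
      finally show ?thesis .
    qed
    ultimately show ?thesis using r(1) by blast
  qed
  then obtain r :: "nat \<Rightarrow> real" where r: "\<And>j. 0 < r j" "\<And>j. r j \<le> 1 / Suc j"
    "\<And>j. measure M (cball x0 (Suc j * r j) - E) \<le> r j powr s / Suc j"
    by metis
  have r0: "r \<longlonglongrightarrow> 0"
  proof (rule tendsto_sandwich [OF _ _ tendsto_const LIMSEQ_Suc [OF lim_1_over_n]])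
    show "\<forall>\<^sub>F j in sequentially. 0 \<le> r j"
      by (simp add: less_imp_le r(1))
    show "\<forall>\<^sub>F j in sequentially. r j \<le> 1 / real (Suc j)"
      by (intro always_eventually allI r(2))
  qed
  define I where "I j = blowup s x0 (r j) (\<lambda>f. \<integral>w. f w \<partial>M)" for j
  define S where "S j = {y. x0 * dil (r j) y \<in> E}" for j
  define c where "c = \<theta> * Gamma (s / 4 + 1)"
  have c: "0 < c" using \<theta> s by (simp add: c_def Gamma_real_pos)
  have int: "integrable M (\<lambda>w. f (dil (1 / r j) (inverse x0 * w)))" if "f \<in> gauss_decay" for f j
    by (rule integrable_gauss_decay [OF fin M gauss_decay_blowup [OF that r(1)]])
  have pf: "positive_functional (I j)" for j
    unfolding I_def by (rule positive_functional_blowup [OF positive_functional_integral [OF fin M] r(1)])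
  have Ig: "I j (gauss t y) = r j powr (- s) * (\<integral>w. gauss (t / r j ^ 4) (x0 * dil (r j) y) w \<partial>M)" for j t y
    unfolding I_def by (rule blowup_gauss [OF r(1)])
  obtain J :: "('n heis \<Rightarrow> real) \<Rightarrow> real" where J: "uniform_functional s c J"
  proof (rule limit_functional [OF c pf])
    show "1 \<in> S j" for j using x0 by (simp add: S_def)
    show "\<forall>\<^sub>F j in sequentially. \<forall>y\<in>S j. dist 1 y \<le> R \<longrightarrow> \<bar>I j (gauss t y) - c * t powr (- s / 4)\<bar> \<le> e"
      if t: "0 < t" and e: "0 < e" for t R e
    proof -
      define A where "A = Gamma (s / 4 + 1) * t powr (- s / 4)"
      have A: "0 < A" using s t by (simp add: A_def Gamma_real_pos)
      define \<kappa> where "\<kappa> = e / (2 * A)"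
      have \<kappa>: "0 < \<kappa>" using e A by (simp add: \<kappa>_def)
      obtain \<delta> where \<delta>: "0 < \<delta>" "\<And>x r. x \<in> E \<Longrightarrow> dist x0 x < \<delta> \<Longrightarrow> 0 < r \<Longrightarrow> r < \<delta> \<Longrightarrow>
          \<bar>measure M (cball x r) - \<theta> * r powr s\<bar> \<le> \<kappa> * r powr s"
        using dens [OF \<kappa>] by blast
      define T where "T = measure M (space M)"
      \<comment> \<open>Beyond radius \<delta> only the total mass T is known; since \<rho> /
        \<delta> is at least 1 there, T and the main term are both bounded by a multiple of
        \<open>\<rho> powr (s + 1)\<close>.\<close>
      define L where "L = (T / \<delta> powr s + \<theta>) / \<delta>"
      have L: "0 \<le> L" using \<theta> \<delta> by (simp add: L_def T_def)
      have near: "\<bar>measure M (cball x \<rho>) - \<theta> * \<rho> powr s\<bar> \<le> \<kappa> * \<rho> powr s + L * \<rho> powr (s + 1)"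
        if x: "x \<in> E" "dist x0 x < \<delta>" and \<rho>: "0 < \<rho>" for x \<rho>
      proof (cases "\<rho> < \<delta>")
        case True
        then show ?thesis using \<delta>(2) [OF x \<rho>] L by (simp add: add_increasing2)
      next
        case False
        have mT: "measure M (cball x \<rho>) \<le> T" unfolding T_def by (rule bounded_measure)
        have "\<delta> powr s \<le> \<rho> powr s" using False \<delta> s by (intro powr_mono2) auto
        then have "T \<le> T / \<delta> powr s * \<rho> powr s"
          using \<delta>(1) mult_left_mono [of "\<delta> powr s" "\<rho> powr s" "T / \<delta> powr s"] by (simp add: T_def)
        then have "\<bar>measure M (cball x \<rho>) - \<theta> * \<rho> powr s\<bar> \<le> (T / \<delta> powr s + \<theta>) * \<rho> powr s"
          using mT measure_nonneg [of M "cball x \<rho>"] mult_nonneg_nonneg [OF less_imp_le [OF \<theta>] powr_ge_zero [of \<rho> s]]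
          unfolding distrib_right by linarith
        also have "\<dots> = L * (\<delta> * \<rho> powr s)"
          using \<delta>(1) by (simp add: L_def)
        also have "\<dots> \<le> L * (\<rho> * \<rho> powr s)"
          using False L by (intro mult_left_mono mult_right_mono) auto
        also have "\<rho> * \<rho> powr s = \<rho> powr (s + 1)"
          using \<rho> by (simp add: powr_add)
        finally show ?thesis using \<kappa> by (simp add: add_increasing)
      qed
      define B where "B = L * Gamma ((s + 1) / 4 + 1) * t powr (- (s + 1) / 4)"
      have "(\<lambda>j. B * r j) \<longlonglongrightarrow> 0" by (rule tendsto_mult_right_zero [OF r0])
      then have "\<forall>\<^sub>F j in sequentially. B * r j < e / 2"
        by (rule order_tendstoD(2)) (use e in simp)
      moreover have "(\<lambda>j. r j * R) \<longlonglongrightarrow> 0" by (rule tendsto_mult_left_zero [OF r0])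
      then have "\<forall>\<^sub>F j in sequentially. r j * R < \<delta>"
        by (rule order_tendstoD(2)) (use \<delta> in simp)
      ultimately show ?thesis
      proof eventually_elim
        case (elim j)
        show ?case
        proof (intro ballI impI)
          fix y assume y: "y \<in> S j" "dist 1 y \<le> R"
          define x where "x = x0 * dil (r j) y"
          have xE: "x \<in> E" using y by (simp add: S_def x_def)
          have "dist x0 x = r j * dist 1 y"
            using dist_mult_left [of x0 1 "dil (r j) y"] dist_dil_one [of "r j" y] r(1) [of j]
            by (simp add: x_def)
          also have "\<dots> \<le> r j * R"
            using y(2) r(1) [of j] by (intro mult_left_mono) auto
          finally have dx: "dist x0 x < \<delta>" using elim by simp
          define \<tau> where "\<tau> = t / r j ^ 4"
          have \<tau>: "0 < \<tau>" using t r(1) [of j] by (simp add: \<tau>_def)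
          have est: "\<bar>(\<integral>w. gauss \<tau> x w \<partial>M) - \<theta> * Gamma (s / 4 + 1) * \<tau> powr (- s / 4)\<bar> \<le>
              \<kappa> * Gamma (s / 4 + 1) * \<tau> powr (- s / 4) + L * Gamma ((s + 1) / 4 + 1) * \<tau> powr (- (s + 1) / 4)"
            using \<theta> \<kappa> L by (intro gauss_integral_estimate [OF fin M \<tau> s] near [OF xE dx]) auto
          have 1: "r j powr (- s) * \<tau> powr (- s / 4) = t powr (- s / 4)"
            using powr_rescale [OF t r(1), of j s s] r(1) [of j] by (simp add: \<tau>_def)
          have 2: "r j powr (- s) * \<tau> powr (- (s + 1) / 4) = t powr (- (s + 1) / 4) * r j"
            using powr_rescale [OF t r(1), of j s "s + 1"] r(1) [of j] by (simp only: \<tau>_def) simp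
          have ab: "\<bar>a * X - u * (a * Y)\<bar> = a * \<bar>X - u * Y\<bar>" if "0 \<le> a" for a X u Y :: real
          proof -
            have "a * X - u * (a * Y) = a * (X - u * Y)"
              by (simp add: right_diff_distrib mult.left_commute)
            then show ?thesis using that by (simp add: abs_mult)
          qed
          have "\<bar>I j (gauss t y) - c * t powr (- s / 4)\<bar> =
              r j powr (- s) * \<bar>(\<integral>w. gauss \<tau> x w \<partial>M) - \<theta> * Gamma (s / 4 + 1) * \<tau> powr (- s / 4)\<bar>"
            unfolding Ig c_def 1 [symmetric] \<tau>_def [symmetric] x_def [symmetric]
            by (rule ab) simp
          also have "\<dots> \<le> r j powr (- s) * (\<kappa> * Gamma (s / 4 + 1) * \<tau> powr (- s / 4) +
              L * Gamma ((s + 1) / 4 + 1) * \<tau> powr (- (s + 1) / 4))"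
            by (intro mult_left_mono est) simp
          also have "\<dots> = \<kappa> * Gamma (s / 4 + 1) * (r j powr (- s) * \<tau> powr (- s / 4)) +
              L * Gamma ((s + 1) / 4 + 1) * (r j powr (- s) * \<tau> powr (- (s + 1) / 4))"
            by (simp only: distrib_left mult_ac)
          also have "\<dots> = \<kappa> * A + B * r j"
            unfolding 1 2 A_def B_def by (simp only: mult_ac)
          also have "\<kappa> * A = e / 2"
            using A by (simp add: \<kappa>_def)
          finally show "\<bar>I j (gauss t y) - c * t powr (- s / 4)\<bar> \<le> e"
            using elim(1) by linarith
        qed
      qed
    qed
    show "\<forall>\<^sub>F j in sequentially. S j \<inter> ball z e = {} \<longrightarrow> I j (bump z (e / 2)) \<le> q"
      if e: "0 < e" and q: "0 < q" for z e q
    proof -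
      have "(\<lambda>j. 1 / real (Suc j)) \<longlonglongrightarrow> 0"
        by (rule LIMSEQ_Suc [OF lim_1_over_n])
      then have "\<forall>\<^sub>F j in sequentially. 1 / real (Suc j) < q"
        by (rule order_tendstoD(2)) (rule q)
      \<comment> \<open>For such j the bump about z lives inside the rescaled ball of radius
        \<open>Suc j * r j\<close> about x0, where the mass outside \<open>E\<close> is
        controlled.\<close>
      moreover have "\<forall>\<^sub>F j in sequentially. dist 1 z + e < real j"
        using filterlim_real_sequentially unfolding filterlim_at_top_dense by blast
      ultimately show ?thesis
      proof eventually_elim
        case (elim j)
        show ?case
        proof
          assume S: "S j \<inter> ball z e = {}"
          have rj: "0 < r j" by (rule r(1))
          define C where "C = cball x0 (Suc j * r j) - E"
          have C: "C \<in> sets M" using E M by (auto simp: C_def)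
          have b: "bump z (e / 2) (dil (1 / r j) (inverse x0 * w)) \<le> indicator C w" for w
          proof (cases "dist z (dil (1 / r j) (inverse x0 * w)) < e / 2")
            case True
            define v where "v = dil (1 / r j) (inverse x0 * w)"
            have w: "w = x0 * dil (r j) v" using rj by (simp add: v_def)
            have v: "dist z v < e" using True e by (simp add: v_def)
            then have "w \<notin> E" using S w by (auto simp: S_def)
            moreover have "dist x0 w \<le> Suc j * r j"
            proof -
              have "dist x0 w = r j * dist 1 v"
                using dist_mult_left [of x0 1 "dil (r j) v"] dist_dil_one [of "r j" v] rj
                by (simp add: w)
              also have "\<dots> \<le> r j * Suc j"
                using dist_triangle [of 1 v z] v elim(2) rj by (intro mult_left_mono) auto
              finally show ?thesis by (simp add: mult.commute)
            qed
            ultimately have "w \<in> C" by (simp add: C_def)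
            then show ?thesis using bump_le_1 [of "e / 2"] e by simp
          next
            case False
            then show ?thesis using e by (simp add: bump_outside)
          qed
          have "(\<integral>w. bump z (e / 2) (dil (1 / r j) (inverse x0 * w)) \<partial>M) \<le> (\<integral>w. indicator C w \<partial>M)"
            using e C b by (intro integral_mono int integrable_real_indicator) (auto simp: emeasure_eq_measure)
          also have "\<dots> = measure M C" using C by simp
          also have "\<dots> \<le> r j powr s / Suc j" unfolding C_def by (rule r(3))
          finally have "I j (bump z (e / 2)) \<le> r j powr (- s) * (r j powr s / Suc j)"
            unfolding I_def blowup_def by (intro mult_left_mono) auto
          also have "\<dots> = 1 / Suc j" using rj by (simp add: powr_minus)
          finally show "I j (bump z (e / 2)) \<le> q" using elim(1) by linarith
        qed
      qed
    qed
  qed blast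
  then show ?thesis using that by (simp add: c_def)
qed

theorem theorem1p2:
  fixes s :: real
  assumes "s > 0"
    and "\<exists>\<mu> :: 'n::finite heis measure. radon_measure \<mu> \<and>
      outer_measure_of \<mu> {x. density_exists s \<mu> x \<and> 0 < density_at s \<mu> x \<and> density_at s \<mu> x < \<infinity>} > 0"
  shows "s \<in> \<int>"
proof -
  obtain \<mu> :: "'n heis measure" where \<mu>: "radon_measure \<mu>"
    "outer_measure_of \<mu> {x. density_exists s \<mu> x \<and> 0 < density_at s \<mu> x \<and> density_at s \<mu> x < \<infinity>} > 0"
    using assms(2) by blast
  obtain E R where E: "closed E" "E \<subseteq> cball 1 R" "0 < emeasure \<mu> E"
    and unif\<mu>: "uniform_density s \<mu> E"
    by (rule uniform_density_set [OF \<mu>]) (rule that)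
  have sets\<mu>: "sets \<mu> = sets borel" and fin\<mu>: "\<And>K. compact K \<Longrightarrow> emeasure \<mu> K < \<infinity>"
    using \<mu>(1) by (auto simp: radon_measure_def)
  \<comment> \<open>Restriction to a ball makes the measure finite. The margin 1 leaves balls of
    radius below 1 about points of \<open>E\<close> intact, so the bands survive at these
    radii.\<close>
  define B where "B = cball (1 :: 'n heis) (R + 1)"
  have B: "B \<in> sets \<mu>" by (simp add: B_def sets\<mu>)
  define M where "M = density \<mu> (indicator B)"
  have M: "sets M = sets borel" by (simp add: M_def sets\<mu>)
  have eM: "emeasure M A = emeasure \<mu> (B \<inter> A)" if "A \<in> sets borel" for A
    unfolding M_def using B that sets\<mu> by (intro emeasure_restricted) auto
  have fin: "finite_measure M"
  proof
    have "emeasure M (space M) = emeasure \<mu> B"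
      using eM [of UNIV] sets_eq_imp_space_eq [OF M] by simp
    also have "\<dots> < \<infinity>" unfolding B_def by (intro fin\<mu> compact_cball_heis)
    finally show "emeasure M (space M) \<noteq> \<infinity>" by simp
  qed
  interpret finite_measure M by (rule fin)
  have mM: "measure M (cball x r) = measure \<mu> (cball x r)" if "x \<in> E" "r < 1" for x r
  proof -
    have "cball x r \<subseteq> B"
      unfolding B_def using E(2) that by (intro cball_subset_cball_dist) auto
    then have "B \<inter> cball x r = cball x r" by blast
    then show ?thesis using eM [of "cball x r"] by (simp add: measure_def)
  qed
  have unif: "uniform_density s M E"
    unfolding uniform_density_def
  proof
    fix k
    obtain \<delta> where \<delta>: "0 < \<delta>" "\<forall>x\<in>E. \<exists>q>0. density_band s \<mu> k \<delta> q x"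
      using unif\<mu> unfolding uniform_density_def by blast
    have "density_band s M k (min \<delta> 1) q x" if "x \<in> E" "density_band s \<mu> k \<delta> q x" for q x
      using that(2) mM [OF that(1)] by (simp add: density_band_def)
    then show "\<exists>\<delta>>0. \<forall>x\<in>E. \<exists>q>0. density_band s M k \<delta> q x"
      using \<delta> by (intro exI [of _ "min \<delta> 1"]) force
  qed
  have ME: "0 < measure M E"
  proof -
    have "B \<inter> E = E" using E(2) by (auto simp: B_def)
    then have "emeasure M E = emeasure \<mu> E" using eM [of E] E(1) by simp
    then have "0 < ennreal (measure M E)"
      using E(3) by (simp only: emeasure_eq_measure)
    then show ?thesis by simp
  qed
  obtain d0 where d0: "0 < d0" "\<forall>x\<in>E. \<exists>q>0. density_band s M 0 d0 q x"
    using unif unfolding uniform_density_def by blast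
  \<comment> \<open>The band for k = 0 has ratio 2, and its q is bounded by the total mass through
    the radius d0 / 2.\<close>
  define b where "b = 2 * (measure M (space M) / (d0 / 2) powr s)"
  have bd: "measure M (cball x r) \<le> b * r powr s" if x: "x \<in> E" and r: "0 < r" "r < d0" for x r
  proof -
    obtain q where q: "\<And>r. 0 < r \<Longrightarrow> r < d0 \<Longrightarrow>
      q * r powr s \<le> measure M (cball x r) \<and> measure M (cball x r) \<le> q * (1 + 1 / Suc 0) * r powr s"
      using d0(2) x unfolding density_band_def by blast
    have "q * (d0 / 2) powr s \<le> measure M (space M)"
      using q [of "d0 / 2"] d0(1) bounded_measure [of "cball x (d0 / 2)"] by simp
    then have "2 * q \<le> b"
      using d0(1) by (simp add: b_def pos_le_divide_eq)
    then have "2 * q * r powr s \<le> b * r powr s"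
      by (intro mult_right_mono) auto
    then show ?thesis using q [OF r] by (simp add: mult.commute)
  qed
  obtain x0 where x0: "x0 \<in> E"
    "\<And>n::nat. \<exists>r. 0 < r \<and> r < 1 / Suc n \<and> measure M (cball x0 r - E) \<le> r powr s / Suc n"
    by (rule density_point [OF fin M E(1) ME d0(1) bd]) (assumption+, rule that)
  obtain \<theta> where \<theta>: "0 < \<theta>" "\<And>\<kappa>. 0 < \<kappa> \<Longrightarrow> \<exists>\<delta>>0. \<forall>x\<in>E. dist x0 x < \<delta> \<longrightarrow>
    (\<forall>r. 0 < r \<and> r < \<delta> \<longrightarrow> \<bar>measure M (cball x r) - \<theta> * r powr s\<bar> \<le> \<kappa> * r powr s)"
    by (rule density_continuous [OF fin M assms(1) x0(1) unif]) (rule that)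
  obtain J :: "('n heis \<Rightarrow> real) \<Rightarrow> real" where J: "uniform_functional s (\<theta> * Gamma (s / 4 + 1)) J"
    by (rule blowup_of_measure [OF fin M assms(1) x0(1) \<theta>(1) x0(2) \<theta>(2) E(1)]) (assumption, rule that)
  obtain J' :: "('n heis \<Rightarrow> real) \<Rightarrow> real" and G where
    "uniform_functional s (\<theta> * Gamma (s / 4 + 1)) J'" "hom_subgroup G" "fsupport J' = G"
    by (rule uniform_functional_on_subgroup [OF J]) (rule that)
  then have "s = hom_dim G"
    by (rule uniform_functional_dim)
  then show ?thesis by simp
qed

end
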